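(* Let $\sigma=\frac4n$ and let $k,\gamma_0\in\mathbb{R}$ be constants. Suppose that the equation $$\Delta A_0(\mathbf{x})+A_0^{\sigma+1}(\mathbf{x})=(k|\mathbf{x}|^2+\gamma_0)A_0(\mathbf{x})$$ has at least one nonnegative solution $A_0(\mathbf{x})$. Then the nonlinear Schrödinger equation $$i\Psi'_t+\Delta\Psi+|\Psi|^\sigma\Psi=0,\qquad \mathbf{x}\in\mathbb{R}^n,$$ has a special solution given by the explicit formula $$\Psi(t,\mathbf{x})=\exp\Big(-\frac n2\int_0^t a(\tau)d\tau\Big)A_0\Big[(\mathbf{x}-\mathbf{x}_0)\exp\Big(-\int_0^t a(\tau)d\tau\Big)\Big]\exp\Big(ia(t)\frac{|\mathbf{x}-\mathbf{x}_0|^2}{4}\Big)\exp\Big(i\gamma_0\int_0^t\exp\Big(-2\int_0^\tau a(\tau_1)d\tau_1\Big)d\tau\Big)\exp(i\theta),$$ where $\mathbf{x}_0\in\mathbb{R}^n$ is an arbitrary fixed point (in particular $\mathbf{x}_0=0$ is allowed), $\theta\in\mathbb{R}$, and the function $a(t)$ is governed by the equation $$a'(t)+a^2(t)=4k\exp\Big(-4\int_0^t a(\tau)d\tau\Big).$$ If $\mathbf{x}A_0(\mathbf{x})\in L^2(\mathbb{R}^n)$, then this formula can be written as $$\Psi(t,\mathbf{x})=\Big(\frac{M(0)}{M(t)}\Big)^{\frac n4}A_0\Big[\Big(\frac{M(0)}{M(t)}\Big)^{\frac12}(\mathbf{x}-\mathbf{x}_0)\Big]\exp\Big(i\frac{M'(t)}{8M(t)}|\mathbf{x}-\mathbf{x}_0|^2\Big)\exp\Big(i\gamma_0M(0)\int_0^tM^{-1}(\tau)d\tau\Big)\exp(i\theta),$$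 with the quadratic function $M(t)$ having the explicit form $M(t)=4Ht^2+M'(0)t+M(0)$. The behavior of the solution depends on the sign of the constant $k=\frac{K}{16M^2(0)}=\frac{16HM(0)-(M'(0))^2}{16M^2(0)}$. If $k>0$, then the solution decays. Namely, $$\max_{\mathbf{x}\in\mathbb{R}^n}|\Psi(t,\mathbf{x})|=A^+\Big(\frac{M(0)}{4H}\Big)^{\frac n4}t^{-n/2},\qquad A^+=\max_{\mathbb{R}^n}A_0(\mathbf{x}).$$ If $k\le0$, then the solution blows up at the point $\mathbf{x}_0$ at a finite moment of time $T$. This time is positive in the following cases: (i) if $H=0$, $M'(0)<0$, then $T=\frac{-M(0)}{M'(0)}$; (ii) if $H>0$, $M'(0)<0$, then $T=\frac{-M'(0)-\sqrt{|K|}}{2H}$; (iii) if $H<0$, then $T=\frac{-M'(0)+\sqrt{|K|}}{2H}$. Moreover, for $k=0$, $$\max_{\mathbf{x}\in\mathbb{R}^n}|\Psi(t,\mathbf{x})|=A^+\Big(\frac{M(0)}{4H}\Big)^{\frac n4}(T-t)^{-n/2},$$ and for $k<0$, $$\max_{\mathbf{x}\in\mathbb{R}^n}|\Psi(t,\mathbf{x})|=A^+\Big(\frac{M(0)}{\sqrt{|K|}}\Big)^{\frac n4}(T-t)^{-n/4}.$$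
   Context: $\Delta$ and $\nabla$ act in $\mathbf{x}\in\mathbb{R}^n$; $\Psi$ is complex-valued and $A_0=|\Psi(0,\cdot+\mathbf{x}_0)|$ is real-valued. For the solution $\Psi$ (with $A_0\in H^1(\mathbb{R}^n)$ and $\mathbf{x}A_0\in L^2(\mathbb{R}^n)$, so that the quantities below make sense) define: - the conserved energy $H=\|\nabla\Psi(t,\cdot)\|_{L^2(\mathbb{R}^n)}^2-\frac{2}{\sigma+2}\|\Psi(t,\cdot)\|_{L^{\sigma+2}(\mathbb{R}^n)}^{\sigma+2}$; - $M(t)=\int_{\mathbb{R}^n}|\Psi(t,\mathbf{x})|^2|\mathbf{x}-\mathbf{x}_0|^2\,d\mathbf{x}$; - $K=16HM(0)-(M'(0))^2$. Blow-up at time $T$ means that $\int_{\mathbb{R}^n}|\nabla\Psi(t,\mathbf{x})|^2d\mathbf{x}\to\infty$ as $t\to T$; it corresponds here to the vanishing of $M(t)$ at $T$, i.e. concentration of the solution at $\mathbf{x}_0$.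
   Formalization: In (ii),(iii) T is corrected to (-M'(0)-sqrt|K|)/(8H); the max formulas for k>0 and k<0 hold only asymptotically (t→∞, t→T), with |T-t| for T-t; blow-up for k≤0 excludes the standing wave H=M'(0)=0; A_0 is C^2, in H^1 and nonzero where M, H occur. *)

theory Defs
  imports "HOL-Analysis.Analysis" "HOL-Library.Landau_Symbols"
begin

section \<open>Classical differential operators\<close>

definition partial_deriv ::
  "'a::euclidean_space \<Rightarrow> ('a \<Rightarrow> 'b::real_normed_vector) \<Rightarrow> 'a \<Rightarrow> 'b" where
  "partial_deriv b f x = frechet_derivative f (at x) b"

definition C1 :: "('a::euclidean_space \<Rightarrow> 'b::real_normed_vector) \<Rightarrow> bool" where
  "C1 f \<longleftrightarrow> (\<forall>x. f differentiable (at x)) \<and>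
     (\<forall>b\<in>Basis. continuous_on UNIV (partial_deriv b f))"

definition C2 :: "('a::euclidean_space \<Rightarrow> 'b::real_normed_vector) \<Rightarrow> bool" where
  "C2 f \<longleftrightarrow> C1 f \<and> (\<forall>b\<in>Basis. C1 (partial_deriv b f))"

definition laplacian :: "('a::euclidean_space \<Rightarrow> 'b::real_normed_vector) \<Rightarrow> 'a \<Rightarrow> 'b" where
  "laplacian f x = (\<Sum>b\<in>Basis. partial_deriv b (partial_deriv b f) x)"

definition grad_sq :: "('a::euclidean_space \<Rightarrow> 'b::real_normed_vector) \<Rightarrow> 'a \<Rightarrow> real" where
  "grad_sq f x = (\<Sum>b\<in>Basis. (norm (partial_deriv b f x))\<^sup>2)"

section \<open>Function spaces and functionals\<close>

definition in_L2 :: "('a::euclidean_space \<Rightarrow> 'b::euclidean_space) \<Rightarrow> bool" where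
  "in_L2 f \<longleftrightarrow> f \<in> borel_measurable lborel \<and> integrable lborel (\<lambda>x. (norm (f x))\<^sup>2)"

text \<open>Membership in the Sobolev space, only meant for functions of class \<open>C1\<close>: for these
  the weak gradient is the classical one.\<close>

definition in_H1 :: "('a::euclidean_space \<Rightarrow> 'b::euclidean_space) \<Rightarrow> bool" where
  "in_H1 f \<longleftrightarrow> in_L2 f \<and> (\<forall>b\<in>Basis. in_L2 (partial_deriv b f))"

definition energy :: "real \<Rightarrow> ('a::euclidean_space \<Rightarrow> complex) \<Rightarrow> real" where
  "energy \<sigma> \<psi> = (LINT x|lborel. grad_sq \<psi> x)
     - 2 / (\<sigma> + 2) * (LINT x|lborel. cmod (\<psi> x) powr (\<sigma> + 2))"

definition second_moment :: "'a::euclidean_space \<Rightarrow> ('a \<Rightarrow> complex) \<Rightarrow> real" where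
  "second_moment x0 \<psi> = (LINT x|lborel. (cmod (\<psi> x))\<^sup>2 * (norm (x - x0))\<^sup>2)"

definition has_max :: "('a \<Rightarrow> real) \<Rightarrow> real \<Rightarrow> bool" where
  "has_max f m \<longleftrightarrow> (\<exists>x. f x = m) \<and> (\<forall>x. f x \<le> m)"

section \<open>The nonlinear Schroedinger equation\<close>

text \<open>Classical solutions on an open time interval: one time derivative and two space
  derivatives, all jointly continuous in time and space.\<close>

definition nls_solution ::
  "real \<Rightarrow> real set \<Rightarrow> (real \<Rightarrow> 'a::euclidean_space \<Rightarrow> complex) \<Rightarrow> bool" where
  "nls_solution \<sigma> I \<Psi> \<longleftrightarrow>
     (\<forall>t\<in>I. C2 (\<Psi> t)) \<and>
     continuous_on (I \<times> UNIV) (\<lambda>(t, x). \<Psi> t x) \<and>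
     (\<forall>b\<in>Basis. continuous_on (I \<times> UNIV) (\<lambda>(t, x). partial_deriv b (\<Psi> t) x)) \<and>
     (\<forall>b\<in>Basis. \<forall>c\<in>Basis.
        continuous_on (I \<times> UNIV) (\<lambda>(t, x). partial_deriv c (partial_deriv b (\<Psi> t)) x)) \<and>
     (\<exists>\<Psi>t. continuous_on (I \<times> UNIV) (\<lambda>(t, x). \<Psi>t t x) \<and>
        (\<forall>t\<in>I. \<forall>x. ((\<lambda>s. \<Psi> s x) has_vector_derivative \<Psi>t t x) (at t) \<and>
           \<i> * \<Psi>t t x + laplacian (\<Psi> t) x
             + complex_of_real (cmod (\<Psi> t x) powr \<sigma>) * \<Psi> t x = 0))"

text \<open>Time may be negative. The integral \<open>LBINT \<tau>=0..t\<close> is oriented, so it changes sign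
  with \<open>t\<close>.\<close>

definition a_solution :: "real \<Rightarrow> real set \<Rightarrow> (real \<Rightarrow> real) \<Rightarrow> bool" where
  "a_solution k I a \<longleftrightarrow> open I \<and> is_interval I \<and> 0 \<in> I \<and>
     (\<forall>t\<in>I. \<exists>a'. (a has_real_derivative a') (at t) \<and>
        a' + (a t)\<^sup>2 = 4 * k * exp (- 4 * (LBINT \<tau>=0..t. a \<tau>)))"

definition maximal_a_solution :: "real \<Rightarrow> real set \<Rightarrow> (real \<Rightarrow> real) \<Rightarrow> bool" where
  "maximal_a_solution k I a \<longleftrightarrow> a_solution k I a \<and>
     (\<forall>J b. a_solution k J b \<and> I \<subseteq> J \<and> (\<forall>t\<in>I. b t = a t) \<longrightarrow> J = I)"

definition special_wave ::
  "(real^'n \<Rightarrow> real) \<Rightarrow> real \<Rightarrow> real^'n \<Rightarrow> real \<Rightarrow> (real \<Rightarrow> real) \<Rightarrow> real \<Rightarrow> real^'n \<Rightarrow> complex"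
  where
  "special_wave A0 \<gamma>0 x0 \<theta> a t x =
     complex_of_real (exp (- (real CARD('n) / 2) * (LBINT \<tau>=0..t. a \<tau>))) *
     complex_of_real (A0 (exp (- (LBINT \<tau>=0..t. a \<tau>)) *\<^sub>R (x - x0))) *
     exp (\<i> * complex_of_real (a t * (norm (x - x0))\<^sup>2 / 4)) *
     exp (\<i> * complex_of_real (\<gamma>0 * (LBINT \<tau>=0..t. exp (- 2 * (LBINT \<tau>1=0..\<tau>. a \<tau>1))))) *
     exp (\<i> * complex_of_real \<theta>)"

text \<open>The same wave in terms of a function \<open>M\<close> of time (the second moment).\<close>

definition special_wave_M ::
  "(real^'n \<Rightarrow> real) \<Rightarrow> real \<Rightarrow> real^'n \<Rightarrow> real \<Rightarrow> (real \<Rightarrow> real) \<Rightarrow> real \<Rightarrow> real^'n \<Rightarrow> complex"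
  where
  "special_wave_M A0 \<gamma>0 x0 \<theta> M t x =
     complex_of_real ((M 0 / M t) powr (real CARD('n) / 4)) *
     complex_of_real (A0 (((M 0 / M t) powr (1/2)) *\<^sub>R (x - x0))) *
     exp (\<i> * complex_of_real (deriv M t / (8 * M t) * (norm (x - x0))\<^sup>2)) *
     exp (\<i> * complex_of_real (\<gamma>0 * M 0 * (LBINT \<tau>=0..t. 1 / M \<tau>))) *
     exp (\<i> * complex_of_real \<theta>)"

text \<open>Blow-up with concentration at \<open>x0\<close>, for a solution living on the open time interval
  \<open>I\<close>. Since \<open>T\<close> is a boundary point of \<open>I\<close>, the filter \<open>at T within I\<close> is nontrivial;
  it is a one-sided limit, from the left if \<open>T\<close> lies after \<open>I\<close>.\<close>

definition blows_up_at ::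
  "real set \<Rightarrow> (real \<Rightarrow> 'a::euclidean_space \<Rightarrow> complex) \<Rightarrow> 'a \<Rightarrow> real \<Rightarrow> bool" where
  "blows_up_at I \<Psi> x0 T \<longleftrightarrow> T \<in> frontier I \<and>
     filterlim (\<lambda>t. LINT x|lborel. grad_sq (\<Psi> t) x) at_top (at T within I) \<and>
     ((\<lambda>t. second_moment x0 (\<Psi> t)) \<longlongrightarrow> 0) (at T within I)"

end

(*
Along a solution a, the dilation factor mu = exp (2 int a) is the quadratic polynomial
(1 + a(0) t)^2 + 4 k t^2; inserting the ansatz into the equation leaves the profile equation for A0,
and every functional of the wave is an integral over the profile times a power of mu.

Two facts about the profile carry the analysis. The Pohozaev identity
int |grad A0|^2 - 2/(sigma+2) int A0^(sigma+2) = k int |x|^2 A0^2 makes the energy constant and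
identifies k. For k < 0 a nonnegative profile vanishes: the potential k |x|^2 is eventually too
negative for a positive supersolution, so A0 has a zero, and the strong maximum principle spreads it.
For k >= 0 the profile tends to 0 at infinity, hence attains its maximum: the nonlinearity is
L2-critical, so a point-picking argument bounds A0 by its L2 norm on balls where that norm is small.
All estimates come from averages of A0 against (1 - |y|^2)_+ and from
"the integral of a derivative of a compactly supported function is 0".
*)

theory Submission
  imports Defs
begin

section \<open>Classical derivatives and compactly supported test functions\<close>

text \<open>The facts have to come in a fixed order. The sign of k is settled before anything else:
  only for k >= 0 is the potential bounded below, which makes the profile a subsolution and hence
  bounded. Boundedness dominates A0^(sigma+2) by a multiple of A0^2, a substitute for the Sobolev
  embedding, and only then can the cut-off in the Pohozaev identity be removed. So the maximum of A0
  enters the energy, not just the rates. Criticality n sigma = 4 acts three times: a ball of radius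
  u^(-2/n) has volume of order u^(-2), which cancels u^2 in the point picking; it fixes the
  coefficient in the Pohozaev identity; and it makes kinetic and potential energy of the profile
  scale alike. Powers of 1 - |y|^2 replace balls because differentiation stays within this family,
  so no surface integrals occur. The discriminant of M(t) = 4 H t^2 + M'(0) t + M(0) is -K = -16 k
  M(0)^2. For k = 0 there is a double root, or else M is constant and the wave is a standing wave
  that never collapses, which the blow-up claim must exclude.\<close>

lemma partial_deriv_eq:
  "(f has_derivative f') (at x) \<Longrightarrow> partial_deriv b f x = f' b"
  unfolding partial_deriv_def using frechet_derivative_at by metis

lemma C1_has_derivative:
  assumes "C1 f"
  shows "(f has_derivative (\<lambda>h. \<Sum>b\<in>Basis. (h \<bullet> b) *\<^sub>R partial_deriv b f x)) (at x)"
proof -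
  have d: "(f has_derivative frechet_derivative f (at x)) (at x)"
    using assms by (simp add: C1_def frechet_derivative_works)
  then interpret bounded_linear "frechet_derivative f (at x)"
    by (rule has_derivative_bounded_linear)
  have "frechet_derivative f (at x) h = (\<Sum>b\<in>Basis. (h \<bullet> b) *\<^sub>R partial_deriv b f x)" for h
  proof -
    have "frechet_derivative f (at x) h = frechet_derivative f (at x) (\<Sum>b\<in>Basis. (h \<bullet> b) *\<^sub>R b)"
      by (simp add: euclidean_representation)
    then show ?thesis by (simp add: sum scaleR partial_deriv_def)
  qed
  then show ?thesis using d by (metis (no_types, lifting) ext)
qed

lemma C1I:
  assumes "\<And>x. (f has_derivative D x) (at x)"
    and "\<And>b. b \<in> Basis \<Longrightarrow> continuous_on UNIV (\<lambda>x. D x b)"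
  shows "C1 f"
  unfolding C1_def
proof (intro conjI allI ballI)
  show "f differentiable (at x)" for x using assms(1) differentiable_def by blast
  fix b :: 'a assume "b \<in> Basis"
  moreover have "partial_deriv b f = (\<lambda>x. D x b)"
    using partial_deriv_eq[OF assms(1)] by auto
  ultimately show "continuous_on UNIV (partial_deriv b f)" using assms(2) by simp
qed

lemma C1_continuous_on: "C1 f \<Longrightarrow> continuous_on S f"
  by (meson C1_has_derivative has_derivative_continuous continuous_at_imp_continuous_on)

lemma C1_partial_continuous_on: "C1 f \<Longrightarrow> b \<in> Basis \<Longrightarrow> continuous_on S (partial_deriv b f)"
  unfolding C1_def by (meson continuous_on_subset subset_UNIV)

lemma C2_C1: "C2 f \<Longrightarrow> C1 f" and C2_partial_C1: "C2 f \<Longrightarrow> b \<in> Basis \<Longrightarrow> C1 (partial_deriv b f)"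
  by (auto simp: C2_def)

lemma C2_laplacian_continuous_on: "C2 f \<Longrightarrow> continuous_on S (laplacian f)"
  unfolding laplacian_def[abs_def]
  by (intro continuous_on_sum C1_partial_continuous_on C2_partial_C1)

text \<open>The exponent is at least 2, so at the kink the difference quotient is a positive power
  of the positive part and tends to 0; elsewhere the function is locally a power or 0.\<close>

lemma has_derivative_max0_power:
  "((\<lambda>z::real. max 0 z ^ (m + 2)) has_real_derivative real (m + 2) * max 0 z ^ (m + 1)) (at z)"
proof -
  consider "z > 0" | "z < 0" | "z = 0" by linarith
  then show ?thesis
  proof cases
    case 1
    have "((\<lambda>z::real. z ^ (m + 2)) has_real_derivative real (m + 2) * z ^ (m + 1)) (at z)"
      by (rule DERIV_cong[OF DERIV_pow]) simp
    then have "((\<lambda>z::real. z ^ (m + 2)) has_real_derivative real (m + 2) * max 0 z ^ (m + 1)) (at z)"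
      using 1 by simp
    then show ?thesis
      by (rule has_field_derivative_transform_within_open[where S="{0<..}"]) (use 1 in auto)
  next
    case 2
    have "((\<lambda>z::real. 0) has_real_derivative real (m + 2) * max 0 z ^ (m + 1)) (at z)"
      using 2 by simp
    then show ?thesis
      by (rule has_field_derivative_transform_within_open[where S="{..<0}"]) (use 2 in auto)
  next
    case 3
    have "((\<lambda>h::real. max 0 h ^ (m + 1)) \<longlongrightarrow> max 0 0 ^ (m + 1)) (at 0)"
      by (intro tendsto_intros)
    moreover have "\<forall>\<^sub>F h in at 0. max 0 h ^ (m + 1) = (max 0 h ^ (m + 2) - max 0 0 ^ (m + 2)) / (h::real)"
      by (auto simp: eventually_at_filter max_def)
    ultimately have "((\<lambda>h::real. (max 0 h ^ (m + 2) - max 0 0 ^ (m + 2)) / h) \<longlongrightarrow> 0) (at 0)"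
      by (simp add: filterlim_cong)
    then show ?thesis using 3 by (simp add: DERIV_def)
  qed
qed

text \<open>A polynomial bump on the unit ball, of finite smoothness growing with \<open>m\<close>.
  Unlike a smooth cut-off it has an explicit gradient, \<open>- 2 m x bump (m - 1)\<close>, so
  derivatives of bumps are again bumps with polynomial weights.\<close>

definition bump :: "nat \<Rightarrow> 'a::euclidean_space \<Rightarrow> real" where
  "bump m x = max 0 (1 - (norm x)\<^sup>2) ^ m"

lemma bump_nonneg [simp]: "0 \<le> bump m x"
  by (simp add: bump_def)

lemma bump_le_1: "bump m x \<le> 1"
  unfolding bump_def by (rule power_le_one) auto

lemma bump_eq_0: "0 < m \<Longrightarrow> 1 \<le> norm x \<Longrightarrow> bump m x = 0"
  using one_le_power[of "norm x" 2] by (simp add: bump_def)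

lemma bump_continuous_on [continuous_intros]:
  "continuous_on S f \<Longrightarrow> continuous_on S (\<lambda>x. bump m (f x))"
  unfolding bump_def by (intro continuous_intros)

lemma has_derivative_bump:
  "(bump (m + 2) has_derivative (\<lambda>h. - (2 * real (m + 2) * bump (m + 1) x * (x \<bullet> h)))) (at x)"
proof -
  have 1: "((\<lambda>x::'a. 1 - (norm x)\<^sup>2) has_derivative (\<lambda>h. - (2 * (x \<bullet> h)))) (at x)"
    unfolding power2_norm_eq_inner
    by (auto intro!: derivative_eq_intros simp: inner_commute)
  have "((\<lambda>z::real. max 0 z ^ (m + 2)) has_derivative
      (\<lambda>h. (real (m + 2) * max 0 (1 - (norm x)\<^sup>2) ^ (m + 1)) * h)) (at (1 - (norm x)\<^sup>2))"
    using has_derivative_max0_power[of m "1 - (norm x)\<^sup>2"] by (simp add: has_field_derivative_def)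
  from has_derivative_compose[OF 1 this] show ?thesis
    unfolding bump_def by (rule has_derivative_eq_rhs) (simp add: fun_eq_iff)
qed

lemma has_derivative_bump_comp:
  assumes "(f has_derivative f') (at x within S)"
  shows "((\<lambda>x. bump (m + 2) (f x)) has_derivative
    (\<lambda>h. - (2 * real (m + 2) * bump (m + 1) (f x) * (f x \<bullet> f' h)))) (at x within S)"
  using has_derivative_compose[OF assms has_derivative_bump] by simp

section \<open>Integrals of compactly supported functions and affine changes of variables\<close>

lemma integrable_compact_support:
  fixes f :: "'a::euclidean_space \<Rightarrow> real"
  assumes "continuous_on UNIV f" "\<And>x. R < norm x \<Longrightarrow> f x = 0"
  shows "integrable lborel f"
proof -
  have "integrable lborel (\<lambda>x. indicator (cball 0 R) x *\<^sub>R f x)"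
    using assms(1) by (intro borel_integrable_compact) (auto intro: continuous_on_subset)
  moreover have "(\<lambda>x. indicator (cball 0 R) x *\<^sub>R f x) = f"
    using assms(2) by (fastforce simp: indicator_def)
  ultimately show ?thesis by simp
qed

text \<open>\<open>lborel\<close> is its own image under an affine map, reweighted by
  \<open>|c| ^ n\<close>. Used with \<open>c = 1\<close> for translations and with positive
  \<open>c\<close> for the radii of averages and the dilation of the wave.\<close>

lemma lborel_has_integral_affine:
  fixes f :: "'a::euclidean_space \<Rightarrow> real"
  assumes "c \<noteq> 0" "integrable lborel f"
  shows "integrable lborel (\<lambda>x. f (t + c *\<^sub>R x))"
    and "(LINT x|lborel. f (t + c *\<^sub>R x)) = (LINT x|lborel. f x) / \<bar>c\<bar> ^ DIM('a)"
proof -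
  have [measurable]: "f \<in> borel_measurable borel" using assms(2) by auto
  have T[measurable]: "(\<lambda>x. t + c *\<^sub>R x) \<in> borel \<rightarrow>\<^sub>M borel" for t :: 'a by measurable
  have "integrable (density (distr lborel borel (\<lambda>x. t + c *\<^sub>R x)) (\<lambda>_. ennreal (\<bar>c\<bar> ^ DIM('a)))) f"
    using assms lborel_affine[of c t] by (simp add: ennreal_power[symmetric])
  then have "integrable lborel (\<lambda>x. \<bar>c\<bar> ^ DIM('a) * f (t + c *\<^sub>R x))"
    by (simp add: integrable_density integrable_distr_eq)
  then show "integrable lborel (\<lambda>x. f (t + c *\<^sub>R x))" using assms(1) by simp
  have "(LINT x|lborel. f x)
    = (LINT x|(density (distr lborel borel (\<lambda>x. t + c *\<^sub>R x)) (\<lambda>_. ennreal (\<bar>c\<bar> ^ DIM('a)))). f x)"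
    using assms lborel_affine[of c t] by (simp add: ennreal_power[symmetric])
  also have "\<dots> = \<bar>c\<bar> ^ DIM('a) * (LINT x|lborel. f (t + c *\<^sub>R x))"
    by (simp add: integral_density integral_distr)
  finally show "(LINT x|lborel. f (t + c *\<^sub>R x)) = (LINT x|lborel. f x) / \<bar>c\<bar> ^ DIM('a)"
    using assms(1) by simp
qed

text \<open>Translation invariance makes the integral of every difference quotient of
  \<open>F\<close> in the direction \<open>b\<close> vanish; the mean value theorem bounds the
  quotients uniformly on a fixed ball, so dominated convergence passes to the derivative. All
  integrations by parts below reduce to this.\<close>

lemma integral_partial_deriv_eq_0:
  fixes F :: "'a::euclidean_space \<Rightarrow> real"
  assumes d: "\<And>x. (F has_derivative F' x) (at x)"
    and c: "continuous_on UNIV (\<lambda>x. F' x b)"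
    and s: "\<And>x. R < norm x \<Longrightarrow> F x = 0"
  shows "integrable lborel (\<lambda>x. F' x b)" "(LINT x|lborel. F' x b) = 0"
proof -
  \<comment> \<open>The increments have length at most \<open>norm b\<close>, so every difference
    quotient vanishes outside the ball of this enlarged radius.\<close>
  define R' where "R' = max R 0 + norm b"
  have Fc: "continuous_on UNIV F"
    using d by (meson has_derivative_continuous continuous_at_imp_continuous_on)
  have F'0: "F' x b = 0" if "R < norm x" for x
  proof -
    have "((\<lambda>_. 0::real) has_derivative F' x) (at x)"
      by (rule has_derivative_transform_within_open[OF d, where s="- cball 0 R"]) (use that s in auto)
    then have "F' x = (\<lambda>_. 0)" by (rule has_derivative_unique) (rule has_derivative_const)
    then show ?thesis by simp
  qed
  show "integrable lborel (\<lambda>x. F' x b)" by (rule integrable_compact_support[OF c F'0])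
  have Fi: "integrable lborel F" by (rule integrable_compact_support[OF Fc s])
  have "compact ((\<lambda>x. F' x b) ` cball 0 R')"
    by (intro compact_continuous_image) (auto intro: continuous_on_subset[OF c])
  then obtain B where "\<forall>y \<in> (\<lambda>x. F' x b) ` cball 0 R'. norm y \<le> B"
    using compact_imp_bounded bounded_iff by blast
  then have B: "\<bar>F' x b\<bar> \<le> B" if "norm x \<le> R'" for x
    using that by simp
  have B': "\<bar>F' x b\<bar> \<le> B" for x
  proof (cases "R < norm x")
    case True
    have "0 \<le> R'" by (simp add: R'_def)
    then show ?thesis using F'0[OF True] B[of 0] abs_ge_zero[of "F' 0 b"] by simp
  next
    case False
    then have "norm x \<le> R'" using norm_ge_zero[of b] unfolding R'_def by linarith
    then show ?thesis by (rule B)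
  qed
  define q where "q i x = real (Suc i) * (F (x + (1 / real (Suc i)) *\<^sub>R b) - F x)" for i x
  have line: "((\<lambda>t. F (x + t *\<^sub>R b)) has_real_derivative F' (x + t *\<^sub>R b) b) (at t)" for x t
  proof -
    have 1: "((\<lambda>t. x + t *\<^sub>R b) has_derivative (\<lambda>h. h *\<^sub>R b)) (at t)"
      by (auto intro!: derivative_eq_intros)
    have "F' (x + t *\<^sub>R b) (h *\<^sub>R b) = F' (x + t *\<^sub>R b) b * h" for h
      using linear_cmul[OF bounded_linear.linear[OF has_derivative_bounded_linear[OF d]], of "x + t *\<^sub>R b" h b] by simp
    with has_derivative_compose[OF 1 d] show ?thesis
      by (simp add: has_field_derivative_def)
  qed
  have lim: "(\<lambda>i. q i x) \<longlonglongrightarrow> F' x b" for x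
  proof -
    have "((\<lambda>h. (F (x + h *\<^sub>R b) - F x) / h) \<longlongrightarrow> F' x b) (at 0)"
      using line[of x 0] by (simp add: DERIV_def)
    moreover have "filterlim (\<lambda>i. 1 / real (Suc i)) (at 0) sequentially"
      using LIMSEQ_Suc[OF lim_1_over_n[where 'a=real]] by (auto simp: filterlim_at)
    ultimately have "(\<lambda>i. (F (x + (1 / real (Suc i)) *\<^sub>R b) - F x) / (1 / real (Suc i))) \<longlonglongrightarrow> F' x b"
      by (rule filterlim_compose)
    moreover have "(F (x + (1 / real (Suc i)) *\<^sub>R b) - F x) / (1 / real (Suc i)) = q i x" for i
      unfolding q_def by simp
    ultimately show ?thesis by simp
  qed
  have bd: "norm (q i x) \<le> B * indicator (cball 0 R') x" for i x
  proof (cases "norm x \<le> R'")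
    case True
    have "\<exists>z. 0 < z \<and> z < 1 / real (Suc i) \<and>
      F (x + (1 / real (Suc i)) *\<^sub>R b) - F (x + 0 *\<^sub>R b) = (1 / real (Suc i) - 0) * F' (x + z *\<^sub>R b) b"
      by (rule MVT2) (use line in auto)
    then obtain z where "F (x + (1 / real (Suc i)) *\<^sub>R b) - F x = (1 / real (Suc i)) * F' (x + z *\<^sub>R b) b"
      by auto
    then have "q i x = F' (x + z *\<^sub>R b) b" unfolding q_def by simp
    then show ?thesis using B' True by simp
  next
    case False
    have "norm ((1 / real (Suc i)) *\<^sub>R b) \<le> norm b" by (simp add: divide_le_eq algebra_simps)
    moreover have "norm x \<le> norm (x + (1 / real (Suc i)) *\<^sub>R b) + norm ((1 / real (Suc i)) *\<^sub>R b)"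
      using norm_triangle_ineq4[of "x + (1 / real (Suc i)) *\<^sub>R b" "(1 / real (Suc i)) *\<^sub>R b"] by simp
    ultimately have "R < norm (x + (1 / real (Suc i)) *\<^sub>R b)" "R < norm x"
      using False norm_ge_zero[of b] unfolding R'_def by linarith+
    then show ?thesis using s False by (simp add: q_def)
  qed
  have tr: "integrable lborel (\<lambda>x. F (x + t))" "(LINT x|lborel. F (x + t)) = (LINT x|lborel. F x)" for t
    using lborel_has_integral_affine[of 1 F t] Fi by (simp_all only: add.commute[of t] scaleR_one abs_one power_one div_by_1)
  have "(\<lambda>i. LINT x|lborel. q i x) \<longlonglongrightarrow> (LINT x|lborel. F' x b)"
  proof (rule integral_dominated_convergence)
    show "(\<lambda>x. F' x b) \<in> borel_measurable lborel" using borel_measurable_continuous_onI[OF c] by simp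
    have [measurable]: "F \<in> borel_measurable borel" using borel_measurable_continuous_onI[OF Fc] .
    show "q i \<in> borel_measurable lborel" for i unfolding q_def[abs_def] by measurable
    show "integrable lborel (\<lambda>x. B * indicator (cball 0 R') x)"
      using borel_integrable_compact[of "cball 0 R'" "\<lambda>_. B"] by (simp add: mult.commute)
  qed (use lim bd in auto)
  moreover have "(LINT x|lborel. q i x) = 0" for i
    unfolding q_def using tr Fi by (simp add: Bochner_Integration.integral_diff)
  ultimately show "(LINT x|lborel. F' x b) = 0" by (simp add: LIMSEQ_const_iff)
qed

lemma C1_has_derivative_comp:
  assumes "C1 f" "(g has_derivative g') (at x within S)"
  shows "((\<lambda>x. f (g x)) has_derivative
    (\<lambda>h. \<Sum>b\<in>Basis. (g' h \<bullet> b) *\<^sub>R partial_deriv b f (g x))) (at x within S)"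
  using has_derivative_compose[OF assms(2) C1_has_derivative[OF assms(1)]] .

text \<open>A vanishing integral would make the open set where \<open>f\<close> is nonzero
  negligible, which a nonempty open set never is.\<close>

lemma integral_pos_if_pos_at:
  fixes f :: "'a::euclidean_space \<Rightarrow> real"
  assumes "continuous_on UNIV f" "integrable lborel f" "\<And>x. 0 \<le> f x" "0 < f p"
  shows "0 < (LINT x|lborel. f x)"
proof (rule ccontr)
  assume "\<not> 0 < (LINT x|lborel. f x)"
  then have "(LINT x|lborel. f x) = 0"
    using assms(3) by (metis Bochner_Integration.integral_nonneg order_le_less)
  then have "AE x in lborel. f x = 0"
    using integral_nonneg_eq_0_iff_AE[OF assms(2)] assms(3) by simp
  moreover have op: "open {x. f x \<noteq> 0}"
    by (rule open_Collect_neq) (use assms(1) in auto)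
  ultimately have "{x. f x \<noteq> 0} \<in> null_sets lborel"
    by (simp add: AE_iff_null borel_open)
  then have "negligible {x. f x \<noteq> 0}"
    by (simp add: negligible_iff_null_sets null_sets_completionI)
  moreover have "{x. f x \<noteq> 0} \<noteq> {}" using assms(4) by force
  ultimately show False using open_not_negligible[OF op] by blast
qed

text \<open>Bridge to the Leibniz rule, which differentiates integrals over a compact box: the cube
  contains the unit ball, outside which the integrand vanishes.\<close>

lemma integral_cbox_eq_lborel:
  fixes g :: "'a::euclidean_space \<Rightarrow> real"
  assumes "continuous_on UNIV g" "\<And>y. 1 \<le> norm y \<Longrightarrow> g y = 0"
  shows "integral (cbox (- One) One) g = (LINT y|lborel. g y)"
proof -
  have "integrable lborel g"
    by (rule integrable_compact_support[where R=1]) (use assms in auto)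
  then have "(g has_integral (LINT y|lborel. g y)) UNIV"
    by (rule has_integral_integral_lborel)
  moreover have "(\<lambda>x. if x \<in> cbox (- One) One then g x else 0) = g"
  proof
    fix x :: 'a
    have "norm x \<ge> 1" if "x \<notin> cbox (- One) One"
    proof -
      from that obtain i where i: "i \<in> Basis" "\<not> (- 1 \<le> x \<bullet> i \<and> x \<bullet> i \<le> 1)"
        by (auto simp: mem_box)
      then have "1 \<le> \<bar>x \<bullet> i\<bar>" by linarith
      then show ?thesis using Basis_le_norm[OF i(1), of x] by linarith
    qed
    then show "(if x \<in> cbox (- One) One then g x else 0) = g x" using assms(2) by auto
  qed
  ultimately show ?thesis
    using has_integral_restrict[of "cbox (- One) One" UNIV g] by (simp add: integral_unique)
qed

section \<open>Mean value inequalities\<close>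

text \<open>The radius sits in the argument of \<open>u\<close>, not in the domain, so
  differentiating in \<open>r\<close> touches only \<open>u\<close> and the radius 0 is harmless.
  There is no normalisation: at radius 0 the value is \<open>u x\<close> times the mass of
  \<open>bump 1\<close>.\<close>

definition bump_average :: "('a::euclidean_space \<Rightarrow> real) \<Rightarrow> 'a \<Rightarrow> real \<Rightarrow> real" where
  "bump_average u x r = (LINT y|lborel. u (x + r *\<^sub>R y) * bump 1 y)"

lemma integrable_times_bump:
  assumes "continuous_on UNIV f" "0 < m"
  shows "integrable lborel (\<lambda>y. f (x + r *\<^sub>R y) * bump m y)"
proof (rule integrable_compact_support[where R=1])
  show "continuous_on UNIV (\<lambda>y. f (x + r *\<^sub>R y) * bump m y)"
    by (intro continuous_intros continuous_on_compose2[OF assms(1)]) auto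
qed (use assms(2) in \<open>simp add: bump_eq_0\<close>)

text \<open>Since \<open>4 y bump 1 y = - \<nabla> (bump 2) y\<close>, differentiating in the radius and integrating
  by parts produces the Laplacian.\<close>

lemma bump_average_DERIV:
  assumes u: "C2 (u :: 'a::euclidean_space \<Rightarrow> real)"
  shows "(bump_average u x has_real_derivative
    r / 4 * (LINT y|lborel. laplacian u (x + r *\<^sub>R y) * bump 2 y)) (at r)"
proof -
  define D where "D r y = (\<Sum>b\<in>Basis. (y \<bullet> b) * partial_deriv b u (x + r *\<^sub>R y) * bump 1 y)" for r y
  have uc: "continuous_on S u" for S using C1_continuous_on C2_C1 u by blast
  have pc: "continuous_on S (partial_deriv b u)" if "b \<in> Basis" for b S
    using C1_partial_continuous_on C2_C1 u that by blast
  have ppc: "continuous_on S (partial_deriv b (partial_deriv b u))" if "b \<in> Basis" for b S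
    using C1_partial_continuous_on C2_partial_C1 u that by blast
  have avg: "bump_average u x = (\<lambda>r. integral (cbox (- One) One) (\<lambda>y. u (x + r *\<^sub>R y) * bump 1 y))"
    unfolding bump_average_def
    by (intro ext integral_cbox_eq_lborel[symmetric] continuous_intros continuous_on_compose2[OF uc[of UNIV]])
      (auto simp: bump_eq_0)
  have "((\<lambda>r. integral (cbox (- One) One) (\<lambda>y. u (x + r *\<^sub>R y) * bump 1 y))
      has_real_derivative integral (cbox (- One) One) (D r)) (at r within UNIV)"
  proof (rule leibniz_rule_field_derivative)
    fix r :: real and y :: 'a
    have "((\<lambda>r. x + r *\<^sub>R y) has_derivative (\<lambda>h. h *\<^sub>R y)) (at r within UNIV)"
      by (auto intro!: derivative_eq_intros)
    from C1_has_derivative_comp[OF C2_C1[OF u] this]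
    have "((\<lambda>r. u (x + r *\<^sub>R y)) has_real_derivative
        (\<Sum>b\<in>Basis. (y \<bullet> b) * partial_deriv b u (x + r *\<^sub>R y))) (at r)"
      unfolding has_field_derivative_def
      by (rule has_derivative_eq_rhs) (auto simp: fun_eq_iff sum_distrib_left mult_ac)
    from DERIV_cmult_right[OF this, of "bump 1 y"]
    show "((\<lambda>r. u (x + r *\<^sub>R y) * bump 1 y) has_real_derivative D r y) (at r within UNIV)"
      unfolding D_def by (simp add: sum_distrib_right)
  next
    show "(\<lambda>y. u (x + r *\<^sub>R y) * bump 1 y) integrable_on cbox (- One) One" for r
      by (intro integrable_continuous continuous_intros continuous_on_compose2[OF uc[of UNIV]]) auto
    show "continuous_on (UNIV \<times> cbox (- One) One) (\<lambda>(r, y). D r y)"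
      unfolding D_def case_prod_beta
      by (intro continuous_intros continuous_on_compose2[OF pc[of _ UNIV]]) auto
  qed auto
  moreover have "integral (cbox (- One) One) (D r) = (LINT y|lborel. D r y)"
  proof (rule integral_cbox_eq_lborel)
    show "continuous_on UNIV (D r)"
      unfolding D_def[abs_def] by (intro continuous_intros continuous_on_compose2[OF pc[of _ UNIV]]) auto
  qed (simp add: D_def bump_eq_0)
  moreover have "(LINT y|lborel. D r y) = r / 4 * (LINT y|lborel. laplacian u (x + r *\<^sub>R y) * bump 2 y)"
  proof -
    \<comment> \<open>\<open>G b\<close> is the derivative in direction \<open>b\<close> of
      \<open>partial_deriv b u (x + r y) * bump 2 y\<close>; its vanishing integral trades each
      summand of \<open>D\<close> for \<open>r / 4\<close> times a second derivative.\<close>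
    define G where "G b y = r * (partial_deriv b (partial_deriv b u) (x + r *\<^sub>R y) * bump 2 y)
        - 4 * ((y \<bullet> b) * partial_deriv b u (x + r *\<^sub>R y) * bump 1 y)" for b y
    have 1: "integrable lborel (\<lambda>y. partial_deriv b (partial_deriv b u) (x + r *\<^sub>R y) * bump 2 y)"
      if "b \<in> Basis" for b
      by (rule integrable_times_bump) (use ppc that in auto)
    have 2: "integrable lborel (\<lambda>y. (y \<bullet> b) * partial_deriv b u (x + r *\<^sub>R y) * bump 1 y)"
      if "b \<in> Basis" for b
    proof (rule integrable_compact_support[where R=1])
      show "continuous_on UNIV (\<lambda>y. (y \<bullet> b) * partial_deriv b u (x + r *\<^sub>R y) * bump 1 y)"
        by (intro continuous_intros continuous_on_compose2[OF pc[OF that, of UNIV]]) auto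
    qed (simp add: bump_eq_0)
    have G0: "(LINT y|lborel. G b y) = 0" if b: "b \<in> Basis" for b
    proof -
      define F' where "F' y h = partial_deriv b u (x + r *\<^sub>R y) * (- (4 * bump 1 y * (y \<bullet> h)))
          + (\<Sum>c\<in>Basis. ((r *\<^sub>R h) \<bullet> c) *\<^sub>R partial_deriv c (partial_deriv b u) (x + r *\<^sub>R y)) * bump 2 y"
        for y h
      have F'G: "F' y b = G b y" for y
        unfolding F'_def G_def using b
        by (simp add: inner_Basis if_distrib[where f="\<lambda>z. r * z"] if_distribR
            if_distrib[where f="\<lambda>z. z * _"] sum.delta cong: if_cong)
      have "(LINT y|lborel. F' y b) = 0"
      proof (rule integral_partial_deriv_eq_0(2))
        fix y
        have g: "((\<lambda>y. x + r *\<^sub>R y) has_derivative (\<lambda>h. r *\<^sub>R h)) (at y)"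
          by (auto intro!: derivative_eq_intros)
        have bd: "(bump 2 has_derivative (\<lambda>h. - (4 * bump 1 y * (y \<bullet> h)))) (at y)"
          using has_derivative_bump[of 0 y] by (simp add: numeral_2_eq_2)
        show "((\<lambda>y. partial_deriv b u (x + r *\<^sub>R y) * bump 2 y) has_derivative F' y) (at y)"
          unfolding F'_def[abs_def]
          by (rule has_derivative_mult[OF C1_has_derivative_comp[OF C2_partial_C1[OF u b] g] bd])
      next
        show "continuous_on UNIV (\<lambda>y. F' y b)"
          unfolding F'G G_def
          by (intro continuous_intros continuous_on_compose2[OF pc[OF b, of UNIV]]
              continuous_on_compose2[OF ppc[OF b, of UNIV]]) auto
      next
        show "partial_deriv b u (x + r *\<^sub>R y) * bump 2 y = 0" if "1 < norm y" for y
          using that by (simp add: bump_eq_0)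
      qed
      then show ?thesis by (simp add: F'G)
    qed
    have "(LINT y|lborel. laplacian u (x + r *\<^sub>R y) * bump 2 y)
      = (\<Sum>b\<in>Basis. LINT y|lborel. partial_deriv b (partial_deriv b u) (x + r *\<^sub>R y) * bump 2 y)"
      unfolding laplacian_def sum_distrib_right using 1 by (intro Bochner_Integration.integral_sum)
    moreover have "(LINT y|lborel. D r y)
      = (\<Sum>b\<in>Basis. LINT y|lborel. (y \<bullet> b) * partial_deriv b u (x + r *\<^sub>R y) * bump 1 y)"
      unfolding D_def using 2 by (intro Bochner_Integration.integral_sum)
    moreover have "(\<Sum>b\<in>Basis. LINT y|lborel. (y \<bullet> b) * partial_deriv b u (x + r *\<^sub>R y) * bump 1 y)
      = (\<Sum>b\<in>Basis. r / 4 * (LINT y|lborel. partial_deriv b (partial_deriv b u) (x + r *\<^sub>R y) * bump 2 y))"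
    proof (rule sum.cong[OF refl])
      fix b :: 'a assume b: "b \<in> Basis"
      show "(LINT y|lborel. (y \<bullet> b) * partial_deriv b u (x + r *\<^sub>R y) * bump 1 y)
        = r / 4 * (LINT y|lborel. partial_deriv b (partial_deriv b u) (x + r *\<^sub>R y) * bump 2 y)"
        using G0[OF b] 1[OF b] 2[OF b] unfolding G_def by (subst (asm) Bochner_Integration.integral_diff) auto
    qed
    ultimately show ?thesis by (simp add: sum_distrib_left)
  qed
  ultimately show ?thesis by (simp add: avg)
qed

lemma bump_average_0:
  "bump_average u (x :: 'a::euclidean_space) 0 = u x * (LINT y|lborel. bump 1 (y :: 'a))"
  by (simp add: bump_average_def)

lemma integral_bump_pos: "0 < m \<Longrightarrow> 0 < (LINT y|lborel. bump m (y :: 'a::euclidean_space))"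
proof (rule integral_pos_if_pos_at[where p=0])
  assume "0 < m"
  then show "integrable lborel (bump m :: 'a \<Rightarrow> real)"
    using integrable_times_bump[of "\<lambda>_. 1" m 0 0] by simp
qed (auto intro!: continuous_intros simp: bump_def[of _ 0])

text \<open>A Gronwall argument in the radius. Since \<open>bump 2 \<le> bump 1\<close>, the radial
  derivative of the average is at least \<open>- L s / 4\<close> times the average; the integrating
  factor is \<open>exp (L s^2 / 8)\<close>, and the product is nondecreasing from radius 0 to
  \<open>r\<close>.\<close>

lemma mean_value_subsolution:
  fixes u :: "'a::euclidean_space \<Rightarrow> real"
  assumes u: "C2 u" and nn: "\<And>x. 0 \<le> u x" and L: "0 \<le> L" and r: "0 \<le> r"
    and sub: "\<And>z. z \<in> cball x r \<Longrightarrow> - L * u z \<le> laplacian u z"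
  shows "u x * (LINT y|lborel. bump 1 (y :: 'a)) \<le> exp (L * r\<^sup>2 / 8) * bump_average u x r"
proof -
  have uc: "continuous_on UNIV u" using C1_continuous_on C2_C1 u by blast
  have "exp (L * 0\<^sup>2 / 8) * bump_average u x 0 \<le> exp (L * r\<^sup>2 / 8) * bump_average u x r"
  proof (rule DERIV_nonneg_imp_nondecreasing[OF r])
    fix s :: real assume s: "0 \<le> s" "s \<le> r"
    let ?I = "LINT y|lborel. laplacian u (x + s *\<^sub>R y) * bump 2 y"
    have *: "- L * bump_average u x s \<le> ?I"
    proof -
      have "(LINT y|lborel. - L * (u (x + s *\<^sub>R y) * bump 1 y)) \<le> ?I"
      proof (rule integral_mono)
        show "integrable lborel (\<lambda>y. - L * (u (x + s *\<^sub>R y) * bump 1 y))"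
          using integrable_times_bump[OF uc, of 1] by simp
        show "integrable lborel (\<lambda>y. laplacian u (x + s *\<^sub>R y) * bump 2 y)"
          by (rule integrable_times_bump) (use u in \<open>auto intro: C2_laplacian_continuous_on\<close>)
        fix y :: 'a
        show "- L * (u (x + s *\<^sub>R y) * bump 1 y) \<le> laplacian u (x + s *\<^sub>R y) * bump 2 y"
        proof (cases "norm y \<le> 1")
          case True
          then have "s * norm y \<le> r * 1" using s by (intro mult_mono) auto
          then have "- L * u (x + s *\<^sub>R y) \<le> laplacian u (x + s *\<^sub>R y)"
            using s by (intro sub) (simp add: dist_norm)
          then have 1: "(- L * u (x + s *\<^sub>R y)) * bump 2 y \<le> laplacian u (x + s *\<^sub>R y) * bump 2 y"
            by (rule mult_right_mono) simp
          have "bump 2 y \<le> bump 1 y" unfolding bump_def by (rule power_decreasing) auto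
          then have "L * u (x + s *\<^sub>R y) * bump 2 y \<le> L * u (x + s *\<^sub>R y) * bump 1 y"
            using nn L by (intro mult_left_mono) auto
          then show ?thesis using 1 by simp
        qed (simp add: bump_eq_0)
      qed
      then show ?thesis by (simp add: bump_average_def)
    qed
    have "((\<lambda>s. exp (L * s\<^sup>2 / 8) * bump_average u x s) has_real_derivative
      exp (L * s\<^sup>2 / 8) * (s / 4) * (L * bump_average u x s + ?I)) (at s)"
    proof -
      have "((\<lambda>s. exp (L * s\<^sup>2 / 8)) has_real_derivative exp (L * s\<^sup>2 / 8) * (L * s / 4)) (at s)"
        by (auto intro!: derivative_eq_intros)
      from DERIV_mult[OF this bump_average_DERIV[OF u]] show ?thesis
        by (rule DERIV_cong) (simp add: field_simps)
    qed
    moreover have "0 \<le> exp (L * s\<^sup>2 / 8) * (s / 4) * (L * bump_average u x s + ?I)"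
      using * s by (intro mult_nonneg_nonneg) auto
    ultimately show "\<exists>y. ((\<lambda>s. exp (L * s\<^sup>2 / 8) * bump_average u x s) has_real_derivative y) (at s) \<and> 0 \<le> y"
      by blast
  qed
  then show ?thesis by (simp add: bump_average_0)
qed

text \<open>The mirror image, with the decaying factor \<open>exp (- (L s^2 / 8))\<close>:
  nonnegativity of \<open>u\<close> and \<open>L\<close> again allows passing from
  \<open>bump 2\<close> to \<open>bump 1\<close>, now in an upper bound.\<close>

lemma mean_value_supersolution:
  fixes u :: "'a::euclidean_space \<Rightarrow> real"
  assumes u: "C2 u" and nn: "\<And>x. 0 \<le> u x" and L: "0 \<le> L" and r: "0 \<le> r"
    and super: "\<And>z. z \<in> cball x r \<Longrightarrow> laplacian u z \<le> L * u z"
  shows "exp (- (L * r\<^sup>2 / 8)) * bump_average u x r \<le> u x * (LINT y|lborel. bump 1 (y :: 'a))"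
proof -
  have uc: "continuous_on UNIV u" using C1_continuous_on C2_C1 u by blast
  have "exp (- (L * r\<^sup>2 / 8)) * bump_average u x r \<le> exp (- (L * 0\<^sup>2 / 8)) * bump_average u x 0"
  proof (rule DERIV_nonpos_imp_nonincreasing[OF r])
    fix s :: real assume s: "0 \<le> s" "s \<le> r"
    let ?I = "LINT y|lborel. laplacian u (x + s *\<^sub>R y) * bump 2 y"
    have *: "?I \<le> L * bump_average u x s"
    proof -
      have "?I \<le> (LINT y|lborel. L * (u (x + s *\<^sub>R y) * bump 1 y))"
      proof (rule integral_mono)
        show "integrable lborel (\<lambda>y. L * (u (x + s *\<^sub>R y) * bump 1 y))"
          using integrable_times_bump[OF uc, of 1] by simp
        show "integrable lborel (\<lambda>y. laplacian u (x + s *\<^sub>R y) * bump 2 y)"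
          by (rule integrable_times_bump) (use u in \<open>auto intro: C2_laplacian_continuous_on\<close>)
        fix y :: 'a
        show "laplacian u (x + s *\<^sub>R y) * bump 2 y \<le> L * (u (x + s *\<^sub>R y) * bump 1 y)"
        proof (cases "norm y \<le> 1")
          case True
          then have "s * norm y \<le> r * 1" using s by (intro mult_mono) auto
          then have "laplacian u (x + s *\<^sub>R y) \<le> L * u (x + s *\<^sub>R y)"
            using s by (intro super) (simp add: dist_norm)
          then have 1: "laplacian u (x + s *\<^sub>R y) * bump 2 y \<le> (L * u (x + s *\<^sub>R y)) * bump 2 y"
            by (rule mult_right_mono) simp
          have "bump 2 y \<le> bump 1 y" unfolding bump_def by (rule power_decreasing) auto
          then have "L * u (x + s *\<^sub>R y) * bump 2 y \<le> L * u (x + s *\<^sub>R y) * bump 1 y"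
            using nn L by (intro mult_left_mono) auto
          then show ?thesis using 1 by simp
        qed (simp add: bump_eq_0)
      qed
      then show ?thesis by (simp add: bump_average_def)
    qed
    have "((\<lambda>s. exp (- (L * s\<^sup>2 / 8)) * bump_average u x s) has_real_derivative
      exp (- (L * s\<^sup>2 / 8)) * (s / 4) * (?I - L * bump_average u x s)) (at s)"
    proof -
      have "((\<lambda>s. exp (- (L * s\<^sup>2 / 8))) has_real_derivative exp (- (L * s\<^sup>2 / 8)) * (- (L * s / 4))) (at s)"
        by (auto intro!: derivative_eq_intros)
      from DERIV_mult[OF this bump_average_DERIV[OF u]] show ?thesis
        by (rule DERIV_cong) (simp add: field_simps)
    qed
    moreover have "exp (- (L * s\<^sup>2 / 8)) * (s / 4) * (?I - L * bump_average u x s) \<le> 0"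
      using * s by (intro mult_nonneg_nonpos) auto
    ultimately show "\<exists>y. ((\<lambda>s. exp (- (L * s\<^sup>2 / 8)) * bump_average u x s) has_real_derivative y) (at s) \<and> y \<le> 0"
      by blast
  qed
  then show ?thesis by (simp add: bump_average_0)
qed

text \<open>Upgrades the mean value inequality from an L1 to an L2 bound. A weighted AM-GM
  inequality with a free parameter \<open>d\<close> plays the part of Cauchy-Schwarz. The condition
  \<open>L * r\<^sup>2 \<le> 1\<close> keeps the exponential factor below 2, so \<open>C\<close> can
  be fixed before \<open>u\<close>, \<open>x\<close>, \<open>r\<close> and \<open>L\<close>.\<close>

lemma L2_mean_value:
  obtains C :: real where "0 < C"
    "\<And>(u :: 'a::euclidean_space \<Rightarrow> real) x r L. \<lbrakk>C2 u; \<And>x. 0 \<le> u x; 0 \<le> L; 0 < r; L * r\<^sup>2 \<le> 1;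
      \<And>z. z \<in> cball x r \<Longrightarrow> - L * u z \<le> laplacian u z\<rbrakk>
      \<Longrightarrow> (u x)\<^sup>2 * r ^ DIM('a) \<le> C * (LINT z|lborel. indicator (cball x r) z * (u z)\<^sup>2)"
proof -
  define c1 where "c1 = (LINT y|lborel. bump 1 (y :: 'a))"
  define c2 where "c2 = (LINT y|lborel. bump 2 (y :: 'a))"
  have c: "0 < c1" "0 < c2" by (simp_all add: c1_def c2_def integral_bump_pos)
  have i2: "integrable lborel (bump 2 :: 'a \<Rightarrow> real)"
    using integrable_times_bump[of "\<lambda>_. 1" 2 0 0] by simp
  show ?thesis
  proof (rule that[of "4 * c2 / c1\<^sup>2"])
    show "0 < 4 * c2 / c1\<^sup>2" using c by simp
    fix u :: "'a \<Rightarrow> real" and x r L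
    assume u: "C2 u" and nn: "\<And>x. 0 \<le> u x" and L: "0 \<le> L" and r: "0 < r" and Lr: "L * r\<^sup>2 \<le> 1"
      and sub: "\<And>z. z \<in> cball x r \<Longrightarrow> - L * u z \<le> laplacian u z"
    have uc: "continuous_on S u" for S using C1_continuous_on C2_C1 u by blast
    define J where "J = (LINT z|lborel. indicator (cball x r) z * (u z)\<^sup>2)"
    define E where "E = J / r ^ DIM('a)"
    define f where "f z = indicator (cball x r) z * (u z)\<^sup>2" for z
    have fi: "integrable lborel f"
    proof -
      have "integrable lborel (\<lambda>z. indicator (cball x r) z *\<^sub>R (u z)\<^sup>2)"
        by (intro borel_integrable_compact continuous_intros uc) simp
      then show ?thesis by (simp add: f_def[abs_def])
    qed
    have J0: "0 \<le> J" unfolding J_def by (intro Bochner_Integration.integral_nonneg) simp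
    have fa: "integrable lborel (\<lambda>y. f (x + r *\<^sub>R y))" "(LINT y|lborel. f (x + r *\<^sub>R y)) = E"
      using lborel_has_integral_affine[of r f x] r fi by (simp_all add: E_def J_def f_def[symmetric])
    have main: "c1 * u x \<le> d * E + c2 / d" if d: "0 < d" for d
    proof -
      have "exp (L * r\<^sup>2 / 8) \<le> exp (1/8)" using Lr by simp
      also have "exp (1/8::real) \<le> 2" using exp_bound[of "1/8"] by (simp add: power2_eq_square)
      finally have e2: "exp (L * r\<^sup>2 / 8) \<le> 2" .
      have avg0: "0 \<le> bump_average u x r"
        unfolding bump_average_def by (intro Bochner_Integration.integral_nonneg) (simp add: nn)
      have "bump_average u x r \<le> (LINT y|lborel. d / 2 * f (x + r *\<^sub>R y) + bump 2 y / (2 * d))"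
        unfolding bump_average_def
      proof (rule integral_mono)
        show "integrable lborel (\<lambda>y. u (x + r *\<^sub>R y) * bump 1 y)"
          by (rule integrable_times_bump[OF uc]) simp
        show "integrable lborel (\<lambda>y. d / 2 * f (x + r *\<^sub>R y) + bump 2 y / (2 * d))"
          using fa i2 by simp
        fix y :: 'a
        show "u (x + r *\<^sub>R y) * bump 1 y \<le> d / 2 * f (x + r *\<^sub>R y) + bump 2 y / (2 * d)"
        proof (cases "norm y \<le> 1")
          case True
          then have f: "f (x + r *\<^sub>R y) = (u (x + r *\<^sub>R y))\<^sup>2" using r by (simp add: f_def dist_norm mult_left_le)
          have "0 \<le> (d * u (x + r *\<^sub>R y) - bump 1 y)\<^sup>2 / (2 * d)" using d by simp
          moreover have "bump 2 y = (bump 1 y)\<^sup>2" by (simp add: bump_def)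
          ultimately show ?thesis unfolding f using d by (simp add: power2_eq_square field_simps)
        next
          case False
          then show ?thesis using d by (simp add: bump_eq_0 f_def)
        qed
      qed
      also have "\<dots> = d / 2 * E + c2 / (2 * d)"
        using fa i2 by (simp add: c2_def)
      finally have "2 * bump_average u x r \<le> d * E + c2 / d" using d by (simp add: field_simps)
      moreover have "c1 * u x \<le> exp (L * r\<^sup>2 / 8) * bump_average u x r"
        using mean_value_subsolution[OF u nn L less_imp_le[OF r] sub] by (simp add: c1_def mult.commute)
      moreover have "\<dots> \<le> 2 * bump_average u x r" using e2 avg0 by (rule mult_right_mono)
      ultimately show ?thesis by linarith
    qed
    have "(u x)\<^sup>2 \<le> 4 * c2 / c1\<^sup>2 * E"
    proof (cases "u x = 0")
      case True then show ?thesis using c J0 r by (simp add: E_def)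
    next
      case False
      then have ux: "0 < u x" using nn[of x] by simp
      \<comment> \<open>This \<open>d\<close> makes \<open>c2 / d\<close> half of the left-hand
        side, so that it can be absorbed; what remains gives the constant
        \<open>4 * c2 / c1^2\<close>.\<close>
      have "c1 * u x \<le> 2 * c2 / (c1 * u x) * E + c2 / (2 * c2 / (c1 * u x))"
        by (rule main) (use c ux in simp)
      also have "c2 / (2 * c2 / (c1 * u x)) = c1 * u x / 2" using c ux by (simp add: field_simps)
      finally have "c1 * u x / 2 \<le> 2 * c2 / (c1 * u x) * E" by linarith
      then have "c1 * u x / 2 * (2 * (c1 * u x)) \<le> 2 * c2 / (c1 * u x) * E * (2 * (c1 * u x))"
        using c ux by (intro mult_right_mono) auto
      also have "\<dots> = 4 * c2 * E" using c ux by simp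
      finally show ?thesis using c by (simp add: field_simps power2_eq_square)
    qed
    then have "(u x)\<^sup>2 * r ^ DIM('a) \<le> 4 * c2 / c1\<^sup>2 * E * r ^ DIM('a)"
      using r by (intro mult_right_mono) auto
    also have "\<dots> = 4 * c2 / c1\<^sup>2 * J" using r by (simp add: E_def)
    finally show "(u x)\<^sup>2 * r ^ DIM('a) \<le> 4 * c2 / c1\<^sup>2 * (LINT z|lborel. indicator (cball x r) z * (u z)\<^sup>2)"
      by (simp add: J_def)
  qed
qed

section \<open>Boundedness and vanishing of profiles\<close>

lemma power_powr: "0 < (x :: real) \<Longrightarrow> (x ^ m) powr a = x powr (real m * a)"
  by (simp add: powr_powr flip: powr_realpow)

lemma sum_Basis_inner_scaleR:
  fixes f :: "'a::euclidean_space \<Rightarrow> 'b::real_vector"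
  assumes "b \<in> Basis"
  shows "(\<Sum>c\<in>Basis. (b \<bullet> c) *\<^sub>R f c) = f b"
proof -
  have "(\<Sum>c\<in>Basis. (b \<bullet> c) *\<^sub>R f c) = (\<Sum>c\<in>Basis. if c = b then f c else 0)"
    by (rule sum.cong) (auto simp: inner_Basis assms)
  then show ?thesis using assms by simp
qed

text \<open>Point picking: maximise \<open>(1 - |z - x|)^n u(z)^2\<close> over the unit ball. Near a maximiser \<open>y\<close> the
  potential is at most a multiple of \<open>u(y)^(4/n)\<close>, and the mean value inequality on the ball of the
  corresponding radius \<open>u(y)^(- 2/n)\<close> bounds the \<open>L\<^sup>2\<close> mass from below by a constant.\<close>

lemma local_boundedness_critical:
  fixes K :: real
  assumes K: "0 < K"
  obtains \<epsilon> C :: real where "0 < \<epsilon>" "0 < C"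
    "\<And>(u :: 'a::euclidean_space \<Rightarrow> real) x. \<lbrakk>C2 u; \<And>x. 0 \<le> u x;
      \<And>z. - (u z powr (4 / real DIM('a)) + K) * u z \<le> laplacian u z;
      (LINT z|lborel. indicator (cball x 1) z * (u z)\<^sup>2) < \<epsilon>\<rbrakk>
      \<Longrightarrow> (u x)\<^sup>2 \<le> C * (LINT z|lborel. indicator (cball x 1) z * (u z)\<^sup>2)"
proof -
  define n where "n = DIM('a)"
  have n: "0 < n" by (simp add: n_def)
  obtain C where C: "0 < C" and mv:
    "\<And>(u :: 'a \<Rightarrow> real) x r L. \<lbrakk>C2 u; \<And>x. 0 \<le> u x; 0 \<le> L; 0 < r; L * r\<^sup>2 \<le> 1;
      \<And>z. z \<in> cball x r \<Longrightarrow> - L * u z \<le> laplacian u z\<rbrakk>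
      \<Longrightarrow> (u x)\<^sup>2 * r ^ n \<le> C * (LINT z|lborel. indicator (cball x r) z * (u z)\<^sup>2)"
    using L2_mean_value unfolding n_def by blast
  show ?thesis
  \<comment> \<open>The two summands of the second constant stem from the two possible values of
    \<open>r\<close> below; the smallness threshold is what rules out \<open>K \<le> 4 * W\<close>
    in the second case.\<close>
  proof (rule that[of "1 / (C * sqrt 8 ^ n)" "2 ^ n * C + C * sqrt (2 * K) ^ n"])
    show "0 < 1 / (C * sqrt 8 ^ n)" using C by simp
    show "0 < 2 ^ n * C + C * sqrt (2 * K) ^ n" using C K by (simp add: add_pos_pos)
    fix u :: "'a \<Rightarrow> real" and x
    assume u: "C2 u" and nn: "\<And>x. 0 \<le> u x"
      and sub: "\<And>z. - (u z powr (4 / real DIM('a)) + K) * u z \<le> laplacian u z"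
      and small: "(LINT z|lborel. indicator (cball x 1) z * (u z)\<^sup>2) < 1 / (C * sqrt 8 ^ n)"
    define E where "E = (LINT z|lborel. indicator (cball x 1) z * (u z)\<^sup>2)"
    have uc: "continuous_on S u" for S using C1_continuous_on C2_C1 u by blast
    have E0: "0 \<le> E" unfolding E_def by (intro Bochner_Integration.integral_nonneg) simp
    have ball_int: "integrable lborel (\<lambda>z. indicator (cball y r) z * (u z)\<^sup>2)" for y r
    proof -
      have "integrable lborel (\<lambda>z. indicator (cball y r) z *\<^sub>R (u z)\<^sup>2)"
        by (intro borel_integrable_compact continuous_intros uc) simp
      then show ?thesis by simp
    qed
    show "(u x)\<^sup>2 \<le> (2 ^ n * C + C * sqrt (2 * K) ^ n)
      * (LINT z|lborel. indicator (cball x 1) z * (u z)\<^sup>2)" unfolding E_def[symmetric]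
    proof (cases "u x = 0")
      case True then show "(u x)\<^sup>2 \<le> (2 ^ n * C + C * sqrt (2 * K) ^ n) * E" using C K E0 by simp
    next
      case False
      then have ux: "0 < u x" using nn[of x] by simp
      \<comment> \<open>The weight vanishes on the boundary of the unit ball, so the maximiser lies
        inside. Its exponent makes \<open>G\<close> the n-th power of boundary distance times
        \<open>u powr (2 / n)\<close>: halving the distance costs a factor \<open>2 ^ n\<close> in
        \<open>u^2\<close>.\<close>
      define G where "G z = (1 - dist x z) ^ n * (u z)\<^sup>2" for z
      have "\<exists>y\<in>cball x 1. \<forall>z\<in>cball x 1. G z \<le> G y"
        unfolding G_def by (intro continuous_attains_sup continuous_intros uc) auto
      then obtain y where y: "y \<in> cball x 1" and ymax: "\<And>z. z \<in> cball x 1 \<Longrightarrow> G z \<le> G y" by blast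
      define d where "d = 1 - dist x y"
      have Gx: "G x = (u x)\<^sup>2" by (simp add: G_def)
      then have Gy: "(u x)\<^sup>2 \<le> d ^ n * (u y)\<^sup>2" using ymax[of x] by (simp add: G_def d_def)
      have "d \<noteq> 0" "u y \<noteq> 0" using Gy ux n by (auto simp: power_0_left)
      then have d: "0 < d" "d \<le> 1" and uy: "0 < u y"
        using y nn[of y] by (auto simp: d_def less_le)
      define W where "W = u y powr (4 / real n)"
      have W: "0 < W" using uy by (simp add: W_def)
      \<comment> \<open>Criticality: the n-th power of the radius \<open>1 / sqrt W\<close> is
        \<open>1 / u(y)^2\<close>, which cancels \<open>u(y)^2\<close> in the mean value
        inequality.\<close>
      have sqW: "sqrt W ^ n = (u y)\<^sup>2"
      proof -
        have "sqrt W = W powr (1 / 2)" using W by (intro powr_half_sqrt[symmetric]) simp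
        also have "\<dots> = u y powr (2 / real n)" unfolding W_def powr_powr by simp
        finally have "sqrt W ^ n = u y powr (2 / real n * real n)"
          using uy n by (simp add: powr_power)
        also have "\<dots> = (u y)\<^sup>2" using uy n by simp
        finally show ?thesis .
      qed
      \<comment> \<open>Within distance \<open>d / 2\<close> of \<open>y\<close> one has
        \<open>u^2 \<le> 2 ^ n * u(y)^2\<close>, and \<open>(2 ^ n) powr (2 / n) = 4\<close>; hence
        the factor 4.\<close>
      define L where "L = 4 * W + K"
      have L: "0 < L" using W K by (simp add: L_def)
      define r where "r = min (d / 2) (1 / sqrt L)"
      have r: "0 < r" using d L by (simp add: r_def)
      have rL: "L * r\<^sup>2 \<le> 1"
      proof -
        have "r\<^sup>2 \<le> (1 / sqrt L)\<^sup>2" using r by (intro power_mono) (auto simp: r_def)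
        also have "\<dots> = 1 / L" using L by (simp add: power_divide)
        finally show ?thesis using L by (simp add: field_simps)
      qed
      have near: "1 - dist x z \<ge> d / 2" if "dist y z \<le> d / 2" for z
        using dist_triangle[of x z y] that by (simp add: d_def field_simps)
      have "- L * u z \<le> laplacian u z" if z: "z \<in> cball y r" for z
      proof -
        have "dist y z \<le> d / 2" using z by (simp add: r_def)
        note 1 = near[OF this]
        then have zb: "z \<in> cball x 1" using d by simp
        have "(d / 2) ^ n * (u z)\<^sup>2 \<le> G z"
          unfolding G_def using 1 d by (intro mult_right_mono power_mono) auto
        also have "\<dots> \<le> d ^ n * (u y)\<^sup>2" using ymax[OF zb] by (simp add: G_def d_def)
        finally have "(u z)\<^sup>2 \<le> 2 ^ n * (u y)\<^sup>2" using d by (simp add: field_simps)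
        then have "((u z)\<^sup>2) powr (2 / real n) \<le> (2 ^ n * (u y)\<^sup>2) powr (2 / real n)"
          by (intro powr_mono2) auto
        moreover have "((u z)\<^sup>2) powr (2 / real n) = u z powr (4 / real n)"
        proof (cases "u z = 0")
          case False
          then have "0 < u z" using nn[of z] by simp
          then show ?thesis by (simp add: power_powr)
        qed simp
        moreover have "(2 ^ n * (u y)\<^sup>2) powr (2 / real n) = 4 * W"
        proof -
          have "(2 ^ n :: real) powr (2 / real n) = 4"
            using n by (simp add: power_powr)
          moreover have "((u y)\<^sup>2) powr (2 / real n) = W"
            using uy by (simp add: W_def power_powr)
          ultimately show ?thesis by (simp add: powr_mult)
        qed
        ultimately have "(u z powr (4 / real n) + K) * u z \<le> L * u z"
          unfolding L_def using nn[of z] by (intro mult_right_mono) auto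
        then show ?thesis using sub[of z] unfolding n_def mult_minus_left by linarith
      qed
      then have "(u y)\<^sup>2 * r ^ n \<le> C * (LINT z|lborel. indicator (cball y r) z * (u z)\<^sup>2)"
        by (rule mv[OF u nn less_imp_le[OF L] r rL])
      also have "\<dots> \<le> C * E"
      proof -
        have "(LINT z|lborel. indicator (cball y r) z * (u z)\<^sup>2) \<le> E"
          unfolding E_def
        proof (rule integral_mono[OF ball_int ball_int])
          fix z
          have "dist x z \<le> 1" if "dist y z \<le> r"
          proof -
            have "dist y z \<le> d / 2" using that by (simp add: r_def)
            then show ?thesis using near[of z] d by simp
          qed
          then show "indicator (cball y r) z * (u z)\<^sup>2 \<le> indicator (cball x 1) z * (u z)\<^sup>2"
            by (auto simp: indicator_def)
        qed
        then show ?thesis using C by simp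
      qed
      finally have main: "(u y)\<^sup>2 * r ^ n \<le> C * E" .
      show "(u x)\<^sup>2 \<le> (2 ^ n * C + C * sqrt (2 * K) ^ n) * E"
      proof (cases "d / 2 \<le> 1 / sqrt L")
        case True
        then have "d = 2 * r" by (simp add: r_def)
        then have "d ^ n * (u y)\<^sup>2 = 2 ^ n * ((u y)\<^sup>2 * r ^ n)" by (simp add: power_mult_distrib)
        also have "\<dots> \<le> 2 ^ n * (C * E)" using main by (rule mult_left_mono) simp
        finally have "d ^ n * (u y)\<^sup>2 \<le> 2 ^ n * C * E" by simp
        moreover have "0 \<le> C * sqrt (2 * K) ^ n * E" using C K E0 by simp
        ultimately show ?thesis using Gy unfolding distrib_right by linarith
      next
        case False
        then have "r = 1 / sqrt L" by (simp add: r_def)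
        then have "(u y)\<^sup>2 = (u y)\<^sup>2 * r ^ n * sqrt L ^ n" using L by (simp add: power_one_over)
        also have "\<dots> \<le> C * E * sqrt L ^ n" using main L by (intro mult_right_mono) auto
        finally have 1: "(u y)\<^sup>2 \<le> C * E * sqrt L ^ n" .
        \<comment> \<open>Otherwise \<open>L \<le> 8 * W\<close>, and \<open>sqrt L ^ n\<close> is
          at most a constant times \<open>u(y)^2\<close>; this cancels against the left-hand side of
          the bound and contradicts the smallness of the mass.\<close>
        have "4 * W < K"
        proof (rule ccontr)
          assume "\<not> 4 * W < K"
          then have "sqrt L \<le> sqrt 8 * sqrt W" unfolding real_sqrt_mult[symmetric] by (simp add: L_def)
          then have "sqrt L ^ n \<le> (sqrt 8 * sqrt W) ^ n" using L by (intro power_mono) auto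
          also have "\<dots> = sqrt 8 ^ n * (u y)\<^sup>2" by (simp add: power_mult_distrib sqW)
          finally have "C * E * sqrt L ^ n \<le> C * E * (sqrt 8 ^ n * (u y)\<^sup>2)"
            using C E0 by (intro mult_left_mono) auto
          with 1 have "1 * (u y)\<^sup>2 \<le> (C * E * sqrt 8 ^ n) * (u y)\<^sup>2" by (simp add: mult_ac)
          then have "1 \<le> C * E * sqrt 8 ^ n" using uy by (subst (asm) mult_le_cancel_right) auto
          moreover have "C * E * sqrt 8 ^ n < 1"
            using small C unfolding E_def[symmetric] by (simp add: field_simps)
          ultimately show False by simp
        qed
        then have "sqrt L ^ n \<le> sqrt (2 * K) ^ n" using L by (intro power_mono) (auto simp: L_def)
        then have "C * E * sqrt L ^ n \<le> C * E * sqrt (2 * K) ^ n"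
          using C E0 by (intro mult_left_mono) auto
        moreover have "d ^ n * (u y)\<^sup>2 \<le> 1 * (u y)\<^sup>2"
          using d by (intro mult_right_mono power_le_one) auto
        moreover have "0 \<le> 2 ^ n * C * E" using C E0 by simp
        ultimately show ?thesis using Gy 1 by (simp add: algebra_simps)
      qed
    qed
  qed
qed

section \<open>Decay at infinity and attained maxima\<close>

lemma L2_tail_tendsto_0:
  fixes u :: "'a::euclidean_space \<Rightarrow> real"
  assumes "integrable lborel (\<lambda>x. (u x)\<^sup>2)"
  shows "(\<lambda>i. LINT z|lborel. indicator {z. real i \<le> norm z} z * (u z)\<^sup>2) \<longlonglongrightarrow> 0"
proof -
  have [measurable]: "(\<lambda>x. (u x)\<^sup>2) \<in> borel_measurable borel" using assms by auto
  have 1: "AE z in lborel. (\<lambda>i. indicator {z. real i \<le> norm z} z * (u z)\<^sup>2) \<longlonglongrightarrow> 0"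
  proof (rule AE_I2, rule tendsto_eventually)
    fix z :: 'a
    obtain N where "norm z < real N" using reals_Archimedean2 by blast
    then show "\<forall>\<^sub>F i in sequentially. indicator {z. real i \<le> norm z} z * (u z)\<^sup>2 = 0"
      by (intro eventually_sequentiallyI[of N]) (auto simp: indicator_def)
  qed
  have "(\<lambda>i. LINT z|lborel. indicator {z. real i \<le> norm z} z * (u z)\<^sup>2)
    \<longlonglongrightarrow> (LINT z|(lborel :: 'a measure). 0 :: real)"
    by (rule integral_dominated_convergence[OF _ _ assms 1]) (auto simp: indicator_def)
  then show ?thesis by simp
qed

text \<open>Far out every unit ball carries little L2 mass, so local boundedness applies there and
  its right-hand side drops below \<open>e\<^sup>2\<close>.\<close>

lemma subsolution_decay:
  fixes u :: "'a::euclidean_space \<Rightarrow> real"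
  assumes u: "C2 u" and nn: "\<And>x. 0 \<le> u x" and L2: "integrable lborel (\<lambda>x. (u x)\<^sup>2)"
    and sub: "\<And>z. - (u z powr (4 / real DIM('a)) + K) * u z \<le> laplacian u z"
    and e: "0 < e"
  shows "\<exists>R. \<forall>x. R \<le> norm x \<longrightarrow> u x < e"
proof -
  \<comment> \<open>Local boundedness wants a positive constant; enlarging \<open>K\<close> only
    weakens the inequality, since \<open>u\<close> is nonnegative.\<close>
  define K' where "K' = max K 1"
  have sub': "- (u z powr (4 / real DIM('a)) + K') * u z \<le> laplacian u z" for z
  proof -
    have "(u z powr (4 / real DIM('a)) + K) * u z \<le> (u z powr (4 / real DIM('a)) + K') * u z"
      unfolding K'_def using nn[of z] by (intro mult_right_mono) auto
    then show ?thesis using sub[of z] unfolding mult_minus_left by linarith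
  qed
  have "0 < K'" by (simp add: K'_def)
  then obtain \<epsilon> C where c: "0 < \<epsilon>" "0 < C" and
    lb: "\<And>(u :: 'a \<Rightarrow> real) x. \<lbrakk>C2 u; \<And>x. 0 \<le> u x;
      \<And>z. - (u z powr (4 / real DIM('a)) + K') * u z \<le> laplacian u z;
      (LINT z|lborel. indicator (cball x 1) z * (u z)\<^sup>2) < \<epsilon>\<rbrakk>
      \<Longrightarrow> (u x)\<^sup>2 \<le> C * (LINT z|lborel. indicator (cball x 1) z * (u z)\<^sup>2)"
    by (rule local_boundedness_critical[where 'a='a]) blast
  note bd = lb[OF u nn sub']
  have "\<forall>\<^sub>F i in sequentially. (LINT z|lborel. indicator {z. real i \<le> norm z} z * (u z)\<^sup>2) < min \<epsilon> (e\<^sup>2 / C)"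
  proof (rule order_tendstoD(2)[OF L2_tail_tendsto_0[OF L2]])
    show "0 < min \<epsilon> (e\<^sup>2 / C)" using c e by simp
  qed
  then obtain N where N: "(LINT z|lborel. indicator {z. real N \<le> norm z} z * (u z)\<^sup>2) < min \<epsilon> (e\<^sup>2 / C)"
    by (auto simp: eventually_sequentially)
  have m: "integrable lborel (\<lambda>z. indicator A z * (u z)\<^sup>2)" if "A \<in> sets lborel" for A
    using integrable_mult_indicator[OF that L2] by simp
  show ?thesis
  \<comment> \<open>The extra 1 keeps the unit ball about \<open>x\<close> outside radius
    \<open>N\<close>. In the minimum, \<open>\<epsilon>\<close> permits local boundedness and
    \<open>e^2 / C\<close> turns its conclusion into \<open>u x < e\<close>.\<close>
  proof (intro exI[of _ "real N + 1"] allI impI)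
    fix x :: 'a assume x: "real N + 1 \<le> norm x"
    have "(LINT z|lborel. indicator (cball x 1) z * (u z)\<^sup>2)
      \<le> (LINT z|lborel. indicator {z. real N \<le> norm z} z * (u z)\<^sup>2)"
    proof (rule integral_mono[OF m m])
      fix z
      have "real N \<le> norm z" if "dist x z \<le> 1"
        using that x norm_triangle_ineq2[of x z] by (simp add: dist_norm)
      then show "indicator (cball x 1) z * (u z)\<^sup>2 \<le> indicator {z. real N \<le> norm z} z * (u z)\<^sup>2"
        by (auto simp: indicator_def)
    qed auto
    then have 1: "(LINT z|lborel. indicator (cball x 1) z * (u z)\<^sup>2) < min \<epsilon> (e\<^sup>2 / C)" using N by linarith
    then have "(u x)\<^sup>2 \<le> C * (LINT z|lborel. indicator (cball x 1) z * (u z)\<^sup>2)" by (intro bd) simp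
    also have "\<dots> < C * (e\<^sup>2 / C)" using 1 c by (intro mult_strict_left_mono) auto
    finally have "(u x)\<^sup>2 < e\<^sup>2" using c by simp
    then show "u x < e" using e by (simp add: power2_less_imp_less)
  qed
qed

text \<open>Decay with \<open>e = u p\<close> confines the values that are at least
  \<open>u p\<close> to a ball; enlarged so as to contain \<open>p\<close>, it yields a maximum that
  also dominates the outside.\<close>

lemma has_max_if_decay:
  fixes u :: "'a::euclidean_space \<Rightarrow> real"
  assumes c: "continuous_on UNIV u" and p: "0 < u p"
    and decay: "\<And>e. 0 < e \<Longrightarrow> \<exists>R. \<forall>x. R \<le> norm x \<longrightarrow> u x < e"
  shows "\<exists>m. has_max u m"
proof -
  obtain R where R: "\<And>x. R \<le> norm x \<Longrightarrow> u x < u p" using decay[OF p] by blast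
  have "\<exists>y\<in>cball 0 (max R (norm p)). \<forall>z\<in>cball 0 (max R (norm p)). u z \<le> u y"
  proof (rule continuous_attains_sup)
    show "cball (0::'a) (max R (norm p)) \<noteq> {}" by (auto simp: le_max_iff_disj)
  qed (auto intro: continuous_on_subset[OF c])
  then obtain y where "\<forall>z\<in>cball 0 (max R (norm p)). u z \<le> u y" by blast
  then have y: "u z \<le> u y" if "norm z \<le> max R (norm p)" for z using that by simp
  have "u z \<le> u y" for z
    using y[of z] y[of p] R[of z] by (cases "norm z \<le> R") auto
  then show ?thesis unfolding has_max_def by blast
qed

text \<open>Testing against a bump function kills \<open>u\<close> wherever the potential is very negative;
  the strong maximum principle then propagates the zero.\<close>

lemma vanish_if_very_superharmonic:
  fixes u :: "'a::euclidean_space \<Rightarrow> real"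
  assumes u: "C2 u" and nn: "\<And>x. 0 \<le> u x"
    and super: "\<And>z. z \<in> cball p 1 \<Longrightarrow> laplacian u z \<le> - (48 + 8 * real DIM('a))\<^sup>2 * u z"
  shows "u p = 0"
proof -
  \<comment> \<open>Chosen to complete a square: with \<open>w = 1 - |x - p|^2\<close>, the factor
    of \<open>u\<close> in \<open>f\<close> is \<open>A^2 w^4 + 48 (1 - w) w^2 - 8 n w^3\<close>,
    that is \<open>w^2 (A^2 w^2 - A w + 48)\<close>, which is nonnegative.\<close>
  define A where "A = 48 + 8 * real DIM('a)"
  \<comment> \<open>The Laplacian of \<open>bump 4 (x - p)\<close>; two derivatives of
    \<open>bump 4\<close> leave the continuous weights \<open>bump 2\<close> and
    \<open>bump 3\<close>.\<close>
  define lapf where "lapf x = 48 * (norm (x - p))\<^sup>2 * bump 2 (x - p) - 8 * real DIM('a) * bump 3 (x - p)" for x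
  have uc: "continuous_on S u" for S using C1_continuous_on C2_C1 u by blast
  have pc: "continuous_on S (partial_deriv b u)" if "b \<in> Basis" for b S
    using C1_partial_continuous_on C2_C1 u that by blast
  have ppc: "continuous_on S (partial_deriv b (partial_deriv b u))" if "b \<in> Basis" for b S
    using C1_partial_continuous_on C2_partial_C1 u that by blast
  \<comment> \<open>One summand of Green's identity: the derivative in direction \<open>b\<close> of
    the bump times a derivative of \<open>u\<close>, minus \<open>u\<close> times that derivative of
    the bump.\<close>
  define G where "G b x = bump 4 (x - p) * partial_deriv b (partial_deriv b u) x
    - u x * (48 * ((x - p) \<bullet> b)\<^sup>2 * bump 2 (x - p) - 8 * bump 3 (x - p))" for b x
  have G: "integrable lborel (G b) \<and> (LINT x|lborel. G b x) = 0" if b: "b \<in> Basis" for b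
  proof -
    define F' where "F' x h =
       (bump 4 (x - p) * (\<Sum>c\<in>Basis. (h \<bullet> c) *\<^sub>R partial_deriv c (partial_deriv b u) x)
          + (- (8 * bump 3 (x - p) * ((x - p) \<bullet> h))) * partial_deriv b u x)
       - (u x * (- 8 * (bump 3 (x - p) * (h \<bullet> b) + (- (6 * bump 2 (x - p) * ((x - p) \<bullet> h))) * ((x - p) \<bullet> b)))
          + (\<Sum>c\<in>Basis. (h \<bullet> c) *\<^sub>R partial_deriv c u x) * (- 8 * (bump 3 (x - p) * ((x - p) \<bullet> b))))"
      for x h
    have F'G: "F' x b = G b x" for x
      unfolding F'_def G_def using b
      unfolding sum_Basis_inner_scaleR[OF b] by (simp add: power2_eq_square algebra_simps)
    have d: "((\<lambda>x. x - p) has_derivative (\<lambda>h. h)) (at x)" for x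
      by (auto intro!: derivative_eq_intros)
    define F where "F x = bump 4 (x - p) * partial_deriv b u x - u x * (- 8 * (bump 3 (x - p) * ((x - p) \<bullet> b)))" for x
    have F: "(F has_derivative F' x) (at x)" for x
    proof -
      have b4: "((\<lambda>x. bump 4 (x - p)) has_derivative (\<lambda>h. - (8 * bump 3 (x - p) * ((x - p) \<bullet> h)))) (at x)"
        using has_derivative_bump_comp[OF d, of 2] by simp
      have b3: "((\<lambda>x. bump 3 (x - p)) has_derivative (\<lambda>h. - (6 * bump 2 (x - p) * ((x - p) \<bullet> h)))) (at x)"
        using has_derivative_bump_comp[OF d, of 1] by (simp add: numeral_2_eq_2 numeral_3_eq_3)
      have i: "((\<lambda>x. (x - p) \<bullet> b) has_derivative (\<lambda>h. h \<bullet> b)) (at x)"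
        by (auto intro!: derivative_eq_intros)
      show ?thesis
        unfolding F'_def[abs_def] F_def[abs_def]
        by (rule has_derivative_diff has_derivative_mult has_derivative_mult_right b4 b3 i C1_has_derivative
            C2_C1[OF u] C2_partial_C1[OF u b])+
    qed
    have F'c: "continuous_on UNIV (\<lambda>x. F' x b)"
      unfolding F'G G_def by (intro continuous_intros uc ppc[OF b])
    have F0: "F x = 0" if "norm p + 1 < norm x" for x
      using that norm_triangle_ineq2[of x p] by (simp add: F_def bump_eq_0)
    show ?thesis using integral_partial_deriv_eq_0[OF F F'c F0] by (simp add: F'G)
  qed
  have "(LINT x|lborel. (\<Sum>b\<in>Basis. G b x)) = 0" using G by (simp add: Bochner_Integration.integral_sum)
  moreover have sumG: "(\<Sum>b\<in>Basis. G b x) = bump 4 (x - p) * laplacian u x - u x * lapf x" for x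
  proof -
    have "(\<Sum>b\<in>Basis. ((x - p) \<bullet> b)\<^sup>2) = (norm (x - p))\<^sup>2"
      unfolding power2_norm_eq_inner euclidean_inner[of "x - p" "x - p"] by (simp add: power2_eq_square)
    then have "(\<Sum>b\<in>Basis. 48 * ((x - p) \<bullet> b)\<^sup>2 * bump 2 (x - p) - 8 * bump 3 (x - p)) = lapf x"
      unfolding lapf_def sum_subtractf sum_distrib_right[symmetric] sum_distrib_left[symmetric] by simp
    then show ?thesis
      unfolding G_def sum_subtractf sum_distrib_left[symmetric] laplacian_def by simp
  qed
  ultimately have I0: "(LINT x|lborel. bump 4 (x - p) * laplacian u x - u x * lapf x) = 0" by simp
  have gi: "integrable lborel (\<lambda>x. bump 4 (x - p) * laplacian u x - u x * lapf x)"
    using G unfolding sumG[symmetric] by (intro Bochner_Integration.integrable_sum) auto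
  define f where "f x = u x * (A\<^sup>2 * bump 4 (x - p) + lapf x)" for x
  have fc: "continuous_on UNIV f"
    unfolding f_def[abs_def] lapf_def by (intro continuous_intros uc)
  have f0: "f x = 0" if "norm p + 1 < norm x" for x
    using that norm_triangle_ineq2[of x p] by (simp add: f_def lapf_def bump_eq_0)
  have fi: "integrable lborel f" by (rule integrable_compact_support[OF fc f0])
  have fnn: "0 \<le> f x" for x
  proof (cases "norm (x - p) \<le> 1")
    case True
    define w where "w = max 0 (1 - (norm (x - p))\<^sup>2)"
    have "(norm (x - p))\<^sup>2 \<le> 1" using True by (simp add: power_le_one)
    then have nx: "(norm (x - p))\<^sup>2 = 1 - w" by (simp add: w_def)
    have w0: "max 0 w = w" by (simp add: w_def)
    have "A\<^sup>2 * bump 4 (x - p) + lapf x = w\<^sup>2 * ((A * w - 1/2)\<^sup>2 + 191/4)"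
      unfolding lapf_def bump_def w_def[symmetric] nx A_def
      by (simp add: w0 power2_eq_square power3_eq_cube power4_eq_xxxx algebra_simps)
    then show ?thesis unfolding f_def using nn by simp
  next
    case False then show ?thesis by (simp add: f_def lapf_def bump_eq_0)
  qed
  \<comment> \<open>With Green's identity the hypothesis bounds the integral of the nonnegative
    continuous \<open>f\<close> by 0; so \<open>f\<close> cannot be positive at
    \<open>p\<close>.\<close>
  have "(LINT x|lborel. f x) \<le> (LINT x|lborel. - (bump 4 (x - p) * laplacian u x - u x * lapf x))"
  proof (rule integral_mono[OF fi])
    show "integrable lborel (\<lambda>x. - (bump 4 (x - p) * laplacian u x - u x * lapf x))"
      by (rule Bochner_Integration.integrable_minus[OF gi])
    fix x
    show "f x \<le> - (bump 4 (x - p) * laplacian u x - u x * lapf x)"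
    proof (cases "norm (x - p) \<le> 1")
      case True
      then have "laplacian u x \<le> - A\<^sup>2 * u x"
        unfolding A_def by (intro super) (simp add: dist_norm norm_minus_commute)
      then have "bump 4 (x - p) * laplacian u x \<le> bump 4 (x - p) * (- A\<^sup>2 * u x)"
        by (intro mult_left_mono) auto
      then show ?thesis by (simp add: f_def algebra_simps)
    qed (simp add: f_def lapf_def bump_eq_0)
  qed
  also have "\<dots> = 0" unfolding Bochner_Integration.integral_minus I0 by simp
  finally have "\<not> 0 < f p"
    using integral_pos_if_pos_at[OF fc fi fnn, of p] by linarith
  then have "f p \<le> 0" by simp
  moreover have "f p = u p * (A\<^sup>2 - 8 * real DIM('a))"
    by (simp add: f_def lapf_def bump_def)
  moreover have "0 < A\<^sup>2 - 8 * real DIM('a)"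
    unfolding A_def by (simp add: power2_eq_square algebra_simps add_pos_nonneg)
  ultimately show ?thesis using nn[of p] by (simp add: mult_le_0_iff)
qed

text \<open>The mean value inequality at the zero \<open>p\<close> forces the average over a ball
  around \<open>p\<close> to be nonpositive. The differential inequality holds on the whole space,
  so a single ball reaching \<open>q\<close> does the work of a chain of balls.\<close>

lemma strong_maximum_principle:
  fixes u :: "'a::euclidean_space \<Rightarrow> real"
  assumes u: "C2 u" and nn: "\<And>x. 0 \<le> u x" and super: "\<And>z. laplacian u z \<le> L * u z"
    and p: "u p = 0"
  shows "u q = 0"
proof (rule ccontr)
  assume "u q \<noteq> 0"
  then have q: "0 < u q" using nn[of q] by simp
  define r where "r = norm (q - p) + 1"
  have r: "0 < r" unfolding r_def using norm_ge_zero[of "q - p"] by linarith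
  have uc: "continuous_on UNIV u" using C1_continuous_on C2_C1 u by blast
  have "laplacian u z \<le> max L 0 * u z" for z
  proof -
    have "L * u z \<le> max L 0 * u z" using nn by (intro mult_right_mono) auto
    then show ?thesis using super[of z] by linarith
  qed
  then have "exp (- (max L 0 * r\<^sup>2 / 8)) * bump_average u p r \<le> u p * (LINT y|lborel. bump 1 (y :: 'a))"
    using r by (intro mean_value_supersolution[OF u nn]) auto
  then have "bump_average u p r \<le> 0" by (simp add: p mult_le_0_iff)
  moreover have "0 < bump_average u p r"
    unfolding bump_average_def
  proof (rule integral_pos_if_pos_at[where p="(q - p) /\<^sub>R r"])
    show "continuous_on UNIV (\<lambda>y. u (p + r *\<^sub>R y) * bump 1 y)"
      by (intro continuous_intros continuous_on_compose2[OF uc]) auto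
    show "integrable lborel (\<lambda>y. u (p + r *\<^sub>R y) * bump 1 y)"
      by (rule integrable_times_bump[OF uc]) simp
    have "norm ((q - p) /\<^sub>R r) = norm (q - p) / r" using r by (simp add: divide_inverse)
    then have "norm ((q - p) /\<^sub>R r) < 1" using r by (simp add: r_def)
    then have "(norm ((q - p) /\<^sub>R r))\<^sup>2 < 1" by (simp add: power_less_one_iff)
    then have "0 < bump 1 ((q - p) /\<^sub>R r)" by (simp add: bump_def)
    then show "0 < u (p + r *\<^sub>R ((q - p) /\<^sub>R r)) * bump 1 ((q - p) /\<^sub>R r)" using q r by simp
  qed (simp add: nn)
  ultimately show False by simp
qed

text \<open>Dropping the nonnegative power leaves a linear supersolution. Its potential acts twice:
  far out it lies below the threshold of the test function argument, and everywhere it is at most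
  \<open>\<gamma>\<close>, which feeds the maximum principle.\<close>

lemma profile_eq_0_if_neg:
  fixes u :: "'a::euclidean_space \<Rightarrow> real"
  assumes u: "C2 u" and nn: "\<And>x. 0 \<le> u x"
    and eq: "\<And>x. laplacian u x + u x powr s = (k * (norm x)\<^sup>2 + \<gamma>) * u x" and k: "k < 0"
  shows "u x = 0"
proof -
  define V where "V = (48 + 8 * real DIM('a))\<^sup>2"
  have lap: "laplacian u z \<le> (k * (norm z)\<^sup>2 + \<gamma>) * u z" for z
    using eq[of z] powr_ge_zero[of "u z" s] by linarith
  \<comment> \<open>\<open>1 \<le> R\<close> turns \<open>R \<le> norm z\<close> into
    \<open>R \<le> (norm z)^2\<close>, so a condition linear in \<open>R\<close> is enough.\<close>
  obtain R :: real where R: "1 \<le> R" "\<gamma> + V \<le> - k * R"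
  proof (rule that[of "max 1 ((\<gamma> + V) / (- k))"])
    have "(\<gamma> + V) / (- k) \<le> max 1 ((\<gamma> + V) / (- k))" by simp
    then show "\<gamma> + V \<le> - k * max 1 ((\<gamma> + V) / (- k))"
      using k by (subst (asm) pos_divide_le_eq) (auto simp: mult.commute)
  qed simp
  obtain p :: 'a where p: "norm p = R + 1"
    using vector_choose_size[of "R + 1"] R by auto
  have "u p = 0"
  proof (rule vanish_if_very_superharmonic[OF u nn])
    fix z assume "z \<in> cball p 1"
    then have "R \<le> norm z" using p norm_triangle_ineq2[of p z] by (simp add: dist_norm)
    then have "R * 1 \<le> norm z * norm z" using R by (intro mult_mono) auto
    then have "R \<le> (norm z)\<^sup>2" by (simp add: power2_eq_square)
    then have "k * (norm z)\<^sup>2 \<le> k * R" using k by (simp add: mult_left_mono_neg)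
    then have "(k * (norm z)\<^sup>2 + \<gamma>) * u z \<le> - V * u z" using R nn by (intro mult_right_mono) auto
    then show "laplacian u z \<le> - (48 + 8 * real DIM('a))\<^sup>2 * u z" using lap[of z] by (simp add: V_def)
  qed
  moreover have "laplacian u z \<le> \<gamma> * u z" for z
  proof -
    have "(k * (norm z)\<^sup>2 + \<gamma>) * u z \<le> \<gamma> * u z"
      using k nn by (intro mult_right_mono) (auto simp: mult_nonpos_nonneg)
    then show ?thesis using lap[of z] by linarith
  qed
  ultimately show ?thesis using strong_maximum_principle[OF u nn] by blast
qed

text \<open>With \<open>0 \<le> k\<close> the potential is at least \<open>- |\<gamma>|\<close>, so
  the profile is a subsolution of the critical inequality and decays; a positive value then makes
  the supremum attained.\<close>

lemma profile_has_max:
  fixes u :: "'a::euclidean_space \<Rightarrow> real"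
  assumes u: "C2 u" and nn: "\<And>x. 0 \<le> u x" and L2: "integrable lborel (\<lambda>x. (u x)\<^sup>2)"
    and eq: "\<And>x. laplacian u x + u x powr (4 / real DIM('a) + 1) = (k * (norm x)\<^sup>2 + \<gamma>) * u x"
    and k: "0 \<le> k" and p: "0 < u p"
  shows "\<exists>m. has_max u m"
proof (rule has_max_if_decay[where p=p])
  show "continuous_on UNIV u" using C1_continuous_on C2_C1 u by blast
  show "0 < u p" by (rule p)
  fix e :: real assume "0 < e"
  moreover have "- (u z powr (4 / real DIM('a)) + \<bar>\<gamma>\<bar>) * u z \<le> laplacian u z" for z
  proof -
    have "u z powr (4 / real DIM('a) + 1) = u z powr (4 / real DIM('a)) * u z"
      using nn[of z] by (simp add: powr_add)
    moreover have "- \<bar>\<gamma>\<bar> * u z \<le> (k * (norm z)\<^sup>2 + \<gamma>) * u z"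
    proof (rule mult_right_mono[OF _ nn])
      show "- \<bar>\<gamma>\<bar> \<le> k * (norm z)\<^sup>2 + \<gamma>" using mult_nonneg_nonneg[OF k zero_le_power2[of "norm z"]] by linarith
    qed
    ultimately show ?thesis using eq[of z] by (simp add: algebra_simps)
  qed
  ultimately show "\<exists>R. \<forall>x. R \<le> norm x \<longrightarrow> u x < e" using subsolution_decay[OF u nn L2] by blast
qed

section \<open>The Pohozaev identity\<close>

text \<open>The mean value theorem twice: along \<open>b\<close> for the increment in direction
  \<open>c\<close>, then along \<open>c\<close> for the derivative so obtained. The left-hand side
  is symmetric in \<open>b\<close> and \<open>c\<close>.\<close>

lemma second_difference_mean_value:
  fixes f :: "'a::euclidean_space \<Rightarrow> real"
  assumes f: "C2 f" and b: "b \<in> Basis" and c: "c \<in> Basis" and s: "0 < s"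
  shows "\<exists>\<sigma> \<tau>. 0 < \<sigma> \<and> \<sigma> < s \<and> 0 < \<tau> \<and> \<tau> < s \<and>
    f (x + s *\<^sub>R b + s *\<^sub>R c) - f (x + s *\<^sub>R b) - f (x + s *\<^sub>R c) + f x
      = s * (s * partial_deriv c (partial_deriv b f) (x + \<sigma> *\<^sub>R b + \<tau> *\<^sub>R c))"
proof -
  have line: "((\<lambda>t. g (y + t *\<^sub>R d)) has_real_derivative partial_deriv d g (y + t *\<^sub>R d)) (at t)"
    if "C1 g" "d \<in> Basis" for g :: "'a \<Rightarrow> real" and y d t
  proof -
    have "((\<lambda>t. y + t *\<^sub>R d) has_derivative (\<lambda>h. h *\<^sub>R d)) (at t)"
      by (auto intro!: derivative_eq_intros)
    from C1_has_derivative_comp[OF that(1) this] show ?thesis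
      unfolding has_field_derivative_def
      by (rule has_derivative_eq_rhs)
        (simp add: fun_eq_iff sum_distrib_left[symmetric] mult.assoc
          sum_Basis_inner_scaleR[OF that(2), where 'b=real, unfolded real_scaleR_def])
  qed
  define \<phi> where "\<phi> t = f ((x + s *\<^sub>R c) + t *\<^sub>R b) - f (x + t *\<^sub>R b)" for t
  have "\<exists>z>0. z < s \<and> \<phi> s - \<phi> 0
    = (s - 0) * (partial_deriv b f ((x + s *\<^sub>R c) + z *\<^sub>R b) - partial_deriv b f (x + z *\<^sub>R b))"
    unfolding \<phi>_def by (rule MVT2[OF s]) (intro DERIV_diff line C2_C1 f b)
  then obtain \<sigma> where \<sigma>: "0 < \<sigma>" "\<sigma> < s" and 1: "\<phi> s - \<phi> 0
    = s * (partial_deriv b f ((x + s *\<^sub>R c) + \<sigma> *\<^sub>R b) - partial_deriv b f (x + \<sigma> *\<^sub>R b))"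
    by auto
  have "\<exists>z>0. z < s \<and> partial_deriv b f ((x + \<sigma> *\<^sub>R b) + s *\<^sub>R c) - partial_deriv b f ((x + \<sigma> *\<^sub>R b) + 0 *\<^sub>R c)
    = (s - 0) * partial_deriv c (partial_deriv b f) ((x + \<sigma> *\<^sub>R b) + z *\<^sub>R c)"
    by (rule MVT2[OF s]) (intro line C2_partial_C1 f b c)
  then obtain \<tau> where "0 < \<tau>" "\<tau> < s" and 2:
    "partial_deriv b f ((x + \<sigma> *\<^sub>R b) + s *\<^sub>R c) - partial_deriv b f (x + \<sigma> *\<^sub>R b)
    = s * partial_deriv c (partial_deriv b f) ((x + \<sigma> *\<^sub>R b) + \<tau> *\<^sub>R c)"
    by auto
  moreover have e1: "(x + s *\<^sub>R c) + \<sigma> *\<^sub>R b = (x + \<sigma> *\<^sub>R b) + s *\<^sub>R c"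
    and e2: "(x + s *\<^sub>R c) + s *\<^sub>R b = (x + s *\<^sub>R b) + s *\<^sub>R c" by (simp_all add: algebra_simps)
  moreover have "f (x + s *\<^sub>R b + s *\<^sub>R c) - f (x + s *\<^sub>R b) - f (x + s *\<^sub>R c) + f x
      = s * (s * partial_deriv c (partial_deriv b f) (x + \<sigma> *\<^sub>R b + \<tau> *\<^sub>R c))"
    using 1 unfolding \<phi>_def e1 2 e2 by simp
  ultimately show ?thesis using \<sigma> by blast
qed

text \<open>Schwarz's theorem. Both orders of differentiation represent the same second difference,
  at points within \<open>2 * s\<close> of \<open>x\<close>; continuity of the second derivatives
  gives equality as \<open>s\<close> tends to 0.\<close>

lemma partial_deriv_commute:
  fixes f :: "'a::euclidean_space \<Rightarrow> real"
  assumes f: "C2 f" and b: "b \<in> Basis" and c: "c \<in> Basis"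
  shows "partial_deriv c (partial_deriv b f) x = partial_deriv b (partial_deriv c f) x"
proof -
  have close: "dist (x + \<sigma> *\<^sub>R b + \<tau> *\<^sub>R c) x \<le> 2 * s"
    if "0 < \<sigma>" "\<sigma> < s" "0 < \<tau>" "\<tau> < s" "b \<in> Basis" "c \<in> Basis" for \<sigma> \<tau> s and b c :: 'a
    using that norm_triangle_ineq[of "\<sigma> *\<^sub>R b" "\<tau> *\<^sub>R c"] by (simp add: dist_norm add.assoc)
  have "\<exists>p q. dist p x \<le> 2 * s \<and> dist q x \<le> 2 * s \<and>
    partial_deriv c (partial_deriv b f) p = partial_deriv b (partial_deriv c f) q" if s: "0 < s" for s
  proof -
    obtain \<sigma> \<tau> where 1: "0 < \<sigma>" "\<sigma> < s" "0 < \<tau>" "\<tau> < s"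
      "f (x + s *\<^sub>R b + s *\<^sub>R c) - f (x + s *\<^sub>R b) - f (x + s *\<^sub>R c) + f x
      = s * (s * partial_deriv c (partial_deriv b f) (x + \<sigma> *\<^sub>R b + \<tau> *\<^sub>R c))"
      using second_difference_mean_value[OF f b c s] by blast
    obtain \<sigma>' \<tau>' where 2: "0 < \<sigma>'" "\<sigma>' < s" "0 < \<tau>'" "\<tau>' < s"
      "f (x + s *\<^sub>R c + s *\<^sub>R b) - f (x + s *\<^sub>R c) - f (x + s *\<^sub>R b) + f x
      = s * (s * partial_deriv b (partial_deriv c f) (x + \<sigma>' *\<^sub>R c + \<tau>' *\<^sub>R b))"
      using second_difference_mean_value[OF f c b s] by blast
    have e: "x + s *\<^sub>R c + s *\<^sub>R b = x + s *\<^sub>R b + s *\<^sub>R c" by (simp add: algebra_simps)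
    have "s * (s * partial_deriv c (partial_deriv b f) (x + \<sigma> *\<^sub>R b + \<tau> *\<^sub>R c))
      = s * (s * partial_deriv b (partial_deriv c f) (x + \<sigma>' *\<^sub>R c + \<tau>' *\<^sub>R b))"
      using 1(5) 2(5)[unfolded e] by linarith
    then have "partial_deriv c (partial_deriv b f) (x + \<sigma> *\<^sub>R b + \<tau> *\<^sub>R c)
      = partial_deriv b (partial_deriv c f) (x + \<sigma>' *\<^sub>R c + \<tau>' *\<^sub>R b)" using s by simp
    then show ?thesis using close[OF 1(1-4) b c] close[OF 2(1-4) c b] by blast
  qed
  then have "\<forall>i. \<exists>p q. dist p x \<le> 2 * (1 / real (Suc i)) \<and> dist q x \<le> 2 * (1 / real (Suc i)) \<and>
    partial_deriv c (partial_deriv b f) p = partial_deriv b (partial_deriv c f) q"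
    using divide_pos_pos[OF zero_less_one of_nat_0_less_iff[THEN iffD2, OF zero_less_Suc]] by blast
  then obtain p q where p: "\<And>i. dist (p i) x \<le> 2 * (1 / real (Suc i))"
    and q: "\<And>i. dist (q i) x \<le> 2 * (1 / real (Suc i))"
    and pq: "\<And>i. partial_deriv c (partial_deriv b f) (p i) = partial_deriv b (partial_deriv c f) (q i)"
    by metis
  have l: "(\<lambda>i. 2 * (1 / real (Suc i))) \<longlonglongrightarrow> 0"
    using tendsto_mult_left[OF LIMSEQ_Suc[OF lim_1_over_n], of "2::real"] by simp
  have lim: "r \<longlonglongrightarrow> x" if "\<And>i. dist (r i) x \<le> 2 * (1 / real (Suc i))" for r
    unfolding tendsto_dist_iff[of r]
    by (rule tendsto_sandwich[OF _ _ tendsto_const l]) (use that in auto)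
  have "isCont (partial_deriv c (partial_deriv b f)) x" "isCont (partial_deriv b (partial_deriv c f)) x"
    using C1_partial_continuous_on[OF C2_partial_C1[OF f b] c, of UNIV]
      C1_partial_continuous_on[OF C2_partial_C1[OF f c] b, of UNIV]
    by (simp_all add: continuous_on_eq_continuous_at)
  from isCont_tendsto_compose[OF this(1) lim[OF p]] isCont_tendsto_compose[OF this(2) lim[OF q]]
  show ?thesis unfolding pq by (rule LIMSEQ_unique)
qed

text \<open>\<open>max 0 z powr p\<close> agrees with \<open>z powr p\<close> on the values of
  \<open>u\<close>, and for \<open>p > 1\<close> its difference quotient at 0 tends to 0. This
  covers the zeros of \<open>u\<close>, where the usual power rule is silent.\<close>

lemma has_derivative_nonneg_powr:
  fixes u :: "'a::real_normed_vector \<Rightarrow> real"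
  assumes u: "(u has_derivative u') (at x)" and nn: "\<And>x. 0 \<le> u x" and p: "1 < p"
  shows "((\<lambda>x. u x powr p) has_derivative (\<lambda>h. p * u x powr (p - 1) * u' h)) (at x)"
proof -
  have "((\<lambda>z. max 0 z powr p) has_real_derivative p * u x powr (p - 1)) (at (u x))"
  proof (cases "u x = 0")
    case True
    have "((\<lambda>h::real. max 0 h powr (p - 1)) \<longlongrightarrow> max 0 0 powr (p - 1)) (at 0)"
    proof (rule tendsto_powr')
      show "((\<lambda>h::real. max 0 h) \<longlongrightarrow> max 0 0) (at 0)" by (intro tendsto_intros)
    qed (use p in auto)
    moreover have "\<forall>\<^sub>F h in at 0. max 0 h powr (p - 1) = (max 0 h powr p - max 0 0 powr p) / (h::real)"
      by (auto simp: eventually_at_filter max_def powr_diff)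
    ultimately have "((\<lambda>h::real. (max 0 h powr p - max 0 0 powr p) / h) \<longlongrightarrow> 0) (at 0)"
      by (simp add: filterlim_cong)
    then show ?thesis using True by (simp add: DERIV_def)
  next
    case False
    then have pos: "0 < u x" using nn[of x] by simp
    have "((\<lambda>z. z powr p) has_real_derivative p * u x powr (p - 1)) (at (u x))"
      by (rule has_real_derivative_powr[OF pos])
    then show ?thesis
      by (rule has_field_derivative_transform_within_open[where S="{0<..}"]) (use pos in auto)
  qed
  then have "((\<lambda>z. max 0 z powr p) has_derivative (\<lambda>h. p * u x powr (p - 1) * h)) (at (u x))"
    by (simp add: has_field_derivative_def)
  from has_derivative_compose[OF u this] show ?thesis using nn by simp
qed

lemma inner_Basis_partials_le:
  fixes x :: "'a::euclidean_space"
  shows "(\<Sum>c\<in>Basis. (x \<bullet> c) * d c)\<^sup>2 \<le> (norm x)\<^sup>2 * (\<Sum>c\<in>Basis. (d c)\<^sup>2)"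
proof -
  have "(\<Sum>c\<in>Basis. (x \<bullet> c) * d c)\<^sup>2 \<le> (\<Sum>c\<in>Basis. (x \<bullet> c)\<^sup>2) * (\<Sum>c\<in>Basis. (d c)\<^sup>2)"
    by (rule Cauchy_Schwarz_ineq_sum)
  also have "(\<Sum>c\<in>Basis. (x \<bullet> c)\<^sup>2) = (norm x)\<^sup>2"
    unfolding power2_norm_eq_inner euclidean_inner[of x x] by (simp add: power2_eq_square)
  finally show ?thesis .
qed

text \<open>The multiplier \<open>x \<bullet> \<nabla>u + n/2 u\<close> generates the
  \<open>L\<^sup>2\<close>-invariant dilations; the cut-off \<open>bump 2 (\<epsilon> x)\<close> removes the boundary terms as \<open>\<epsilon> \<rightarrow> 0\<close>.\<close>

lemma pohozaev_identity:
  fixes u :: "'a::euclidean_space \<Rightarrow> real"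
  assumes u: "C2 u" and nn: "\<And>x. 0 \<le> u x" and \<sigma>: "\<sigma> = 4 / real DIM('a)"
    and eq: "\<And>x. laplacian u x + u x powr (\<sigma> + 1) = (k * (norm x)\<^sup>2 + \<gamma>) * u x"
    and iu: "integrable lborel (\<lambda>x. (u x)\<^sup>2)"
    and ig: "integrable lborel (grad_sq u)"
    and ix: "integrable lborel (\<lambda>x. (norm x)\<^sup>2 * (u x)\<^sup>2)"
    and ip: "integrable lborel (\<lambda>x. u x powr (\<sigma> + 2))"
  shows "(LINT x|lborel. grad_sq u x) - 2 / (\<sigma> + 2) * (LINT x|lborel. u x powr (\<sigma> + 2))
    = k * (LINT x|lborel. (norm x)\<^sup>2 * (u x)\<^sup>2)"
proof -
  define n where "n = real DIM('a)"
  have n: "1 \<le> n" using DIM_positive[where 'a='a] by (simp add: n_def)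
  have \<sigma>0: "0 < \<sigma>" using n by (simp add: \<sigma> n_def[symmetric])
  have n\<sigma>: "n * \<sigma> = 4" using n by (simp add: \<sigma> n_def[symmetric])
  define D where "D b = partial_deriv b u" for b
  define DD where "DD b c = partial_deriv c (partial_deriv b u)" for b c
  have uc: "continuous_on S u" for S using C1_continuous_on C2_C1 u by blast
  have Dc: "continuous_on S (D b)" if "b \<in> Basis" for b S
    unfolding D_def using C1_partial_continuous_on C2_C1 u that by blast
  have DDc: "continuous_on S (DD b c)" if "b \<in> Basis" "c \<in> Basis" for b c S
    unfolding DD_def using C1_partial_continuous_on C2_partial_C1 u that by blast
  have du: "(u has_derivative (\<lambda>h. \<Sum>c\<in>Basis. (h \<bullet> c) * D c x)) (at x)" for x
    using C1_has_derivative[OF C2_C1[OF u]] by (simp add: D_def)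
  have dD: "(D b has_derivative (\<lambda>h. \<Sum>c\<in>Basis. (h \<bullet> c) * DD b c x)) (at x)" if "b \<in> Basis" for b x
    using C1_has_derivative[OF C2_partial_C1[OF u that]] by (simp add: D_def DD_def)
  have sB: "(\<Sum>c\<in>Basis. (b \<bullet> c) * f c) = f b" if "b \<in> Basis" for b :: 'a and f :: "'a \<Rightarrow> real"
    using sum_Basis_inner_scaleR[OF that, of f] by simp
  define Xu where "Xu x = (\<Sum>c\<in>Basis. (x \<bullet> c) * D c x)" for x
  define V where "V x = k * (norm x)\<^sup>2 + \<gamma>" for x :: 'a
  define G where "G x = (\<Sum>c\<in>Basis. (D c x)\<^sup>2)" for x
  \<comment> \<open>\<open>W\<close> is the Lagrangian density of the profile equation and
    \<open>Y\<close> the flux belonging to the multiplier, balanced so that the divergence of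
    \<open>Y\<close> is \<open>Z\<close>, the density of the identity. \<open>Q x\<close> is the
    inner product of \<open>x\<close> and \<open>Y\<close>.\<close>
  define W where "W x = u x powr (\<sigma> + 2) / (\<sigma> + 2) - G x / 2 - V x * (u x)\<^sup>2 / 2" for x
  define Y where "Y b x = D b x * (Xu x + n / 2 * u x) + (x \<bullet> b) * W x" for b x
  define Z where "Z x = G x - 2 / (\<sigma> + 2) * u x powr (\<sigma> + 2) - k * ((norm x)\<^sup>2 * (u x)\<^sup>2)" for x
  define Q where "Q x = Xu x * (Xu x + n / 2 * u x) + (norm x)\<^sup>2 * W x" for x
  have G: "grad_sq u x = G x" for x by (simp add: grad_sq_def G_def D_def)
  have Gc: "continuous_on S G" for S unfolding G_def[abs_def] by (intro continuous_intros Dc)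
  have Xc: "continuous_on S Xu" for S unfolding Xu_def[abs_def] by (intro continuous_intros Dc)
  have pc: "continuous_on S (\<lambda>x. u x powr p)" if "0 < p" for S p
    by (rule continuous_on_powr') (use nn that uc in \<open>auto intro: continuous_intros\<close>)
  have Wc: "continuous_on S W" for S
    unfolding W_def[abs_def] V_def by (intro continuous_intros Gc uc pc) (use \<sigma>0 in auto)
  define Y' where "Y' b x h = (D b x * ((\<Sum>c\<in>Basis. (x \<bullet> c) * (\<Sum>d\<in>Basis. (h \<bullet> d) * DD c d x) + (h \<bullet> c) * D c x)
         + n / 2 * (\<Sum>c\<in>Basis. (h \<bullet> c) * D c x))
      + (\<Sum>c\<in>Basis. (h \<bullet> c) * DD b c x) * (Xu x + n / 2 * u x))
    + ((x \<bullet> b) * ((\<sigma> + 2) * u x powr (\<sigma> + 2 - 1) * (\<Sum>c\<in>Basis. (h \<bullet> c) * D c x) / (\<sigma> + 2)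
          - (\<Sum>c\<in>Basis. 2 * (\<Sum>d\<in>Basis. (h \<bullet> d) * DD c d x) * D c x) / 2
          - (V x * (2 * (\<Sum>c\<in>Basis. (h \<bullet> c) * D c x) * u x) + k * (2 * (x \<bullet> h)) * (u x)\<^sup>2) / 2)
      + (h \<bullet> b) * W x)" for b x h
  have dY: "(Y b has_derivative Y' b x) (at x)" if b: "b \<in> Basis" for b x
  proof -
    have sq: "((\<lambda>x. (f x)\<^sup>2) has_derivative (\<lambda>h. 2 * f' h * f x)) (at x)"
      if "(f has_derivative f') (at x)" for f :: "'a \<Rightarrow> real" and f'
      using has_derivative_power[OF that, of 2] by (simp add: mult_ac)
    have dv: "((\<lambda>x. f x / c) has_derivative (\<lambda>h. f' h / c)) (at x)"
      if "(f has_derivative f') (at x)" for f :: "'a \<Rightarrow> real" and f' c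
      by (rule bounded_linear.has_derivative[OF bounded_linear_divide that])
    have i: "((\<lambda>x. x \<bullet> c) has_derivative (\<lambda>h. h \<bullet> c)) (at x)" for c :: 'a
      by (auto intro!: derivative_eq_intros)
    have dV: "(V has_derivative (\<lambda>h. k * (2 * (x \<bullet> h)))) (at x)"
      unfolding V_def[abs_def] power2_norm_eq_inner
      by (auto intro!: derivative_eq_intros simp: inner_commute)
    have dX: "(Xu has_derivative (\<lambda>h. \<Sum>c\<in>Basis. (x \<bullet> c) * (\<Sum>d\<in>Basis. (h \<bullet> d) * DD c d x) + (h \<bullet> c) * D c x)) (at x)"
      unfolding Xu_def[abs_def] by (intro has_derivative_sum has_derivative_mult i dD)
    have dG: "(G has_derivative (\<lambda>h. \<Sum>c\<in>Basis. 2 * (\<Sum>d\<in>Basis. (h \<bullet> d) * DD c d x) * D c x)) (at x)"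
      unfolding G_def[abs_def] by (intro has_derivative_sum sq dD)
    have dp: "((\<lambda>x. u x powr (\<sigma> + 2)) has_derivative
      (\<lambda>h. (\<sigma> + 2) * u x powr (\<sigma> + 2 - 1) * (\<Sum>c\<in>Basis. (h \<bullet> c) * D c x))) (at x)"
      by (rule has_derivative_nonneg_powr[OF du nn]) (use \<sigma>0 in simp)
    show ?thesis
      unfolding Y_def[abs_def] Y'_def[abs_def] W_def[abs_def]
      by (intro has_derivative_add has_derivative_diff has_derivative_mult has_derivative_mult_right
          dv i dX dG dp dV sq du dD[OF b])
  qed
  have Y'b: "Y' b x b = D b x * ((\<Sum>c\<in>Basis. (x \<bullet> c) * DD c b x) + D b x + n / 2 * D b x)
      + DD b b x * (Xu x + n / 2 * u x)
      + (x \<bullet> b) * (u x powr (\<sigma> + 1) * D b x - (\<Sum>c\<in>Basis. DD c b x * D c x) - V x * D b x * u x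
          - k * (x \<bullet> b) * (u x)\<^sup>2) + W x"
    if b: "b \<in> Basis" for b x
  proof -
    have "(\<Sum>c\<in>Basis. (x \<bullet> c) * DD c b x + (b \<bullet> c) * D c x) = (\<Sum>c\<in>Basis. (x \<bullet> c) * DD c b x) + D b x"
      unfolding sum.distrib sB[OF b] ..
    moreover have "(\<Sum>c\<in>Basis. 2 * DD c b x * D c x) / 2 = (\<Sum>c\<in>Basis. DD c b x * D c x)"
      by (simp add: sum_divide_distrib)
    moreover have "\<sigma> + 2 - 1 = \<sigma> + 1" by simp
    ultimately show ?thesis
      using b \<sigma>0 unfolding Y'_def sB[OF b] by (simp add: field_simps)
  qed
  have Y'c: "continuous_on UNIV (\<lambda>x. Y' b x b)" if b: "b \<in> Basis" for b
    unfolding Y'b[OF b] V_def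
    by (intro continuous_intros Dc DDc Xc uc Wc pc b) (use \<sigma>0 in auto)
  have div: "(\<Sum>b\<in>Basis. Y' b x b) = Z x" for x
  proof -
    \<comment> \<open>Symmetry of the second derivatives makes the Hessian terms from
      \<open>Xu\<close> and from the gradient of \<open>G\<close> cancel.\<close>
    have cross: "(\<Sum>b\<in>Basis. (x \<bullet> b) * (\<Sum>c\<in>Basis. DD c b x * D c x))
      = (\<Sum>b\<in>Basis. D b x * (\<Sum>c\<in>Basis. (x \<bullet> c) * DD c b x))"
    proof -
      have "(\<Sum>b\<in>Basis. (x \<bullet> b) * (\<Sum>c\<in>Basis. DD c b x * D c x))
        = (\<Sum>b\<in>Basis. \<Sum>c\<in>Basis. (x \<bullet> b) * (DD c b x * D c x))" by (simp add: sum_distrib_left)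
      also have "\<dots> = (\<Sum>c\<in>Basis. \<Sum>b\<in>Basis. (x \<bullet> b) * (DD c b x * D c x))" by (rule sum.swap)
      also have "\<dots> = (\<Sum>c\<in>Basis. \<Sum>b\<in>Basis. D c x * ((x \<bullet> b) * DD b c x))"
        using partial_deriv_commute[OF u] by (intro sum.cong) (auto simp: DD_def)
      finally show ?thesis by (simp add: sum_distrib_left)
    qed
    have nx: "(\<Sum>b\<in>Basis. (x \<bullet> b) * (k * (x \<bullet> b) * (u x)\<^sup>2)) = k * (norm x)\<^sup>2 * (u x)\<^sup>2"
      unfolding power2_norm_eq_inner euclidean_inner[of x x] sum_distrib_left sum_distrib_right
      by (simp add: mult_ac)
    have s1: "(\<Sum>b\<in>Basis. (x \<bullet> b) * (u x powr (\<sigma> + 1) * D b x)) = u x powr (\<sigma> + 1) * Xu x"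
      unfolding Xu_def sum_distrib_left by (simp add: mult_ac)
    have s2: "(\<Sum>b\<in>Basis. (x \<bullet> b) * (V x * D b x * u x)) = V x * Xu x * u x"
      unfolding Xu_def sum_distrib_left sum_distrib_right by (simp add: mult_ac)
    have s3: "(\<Sum>b\<in>Basis. DD b b x * (Xu x + n / 2 * u x)) = laplacian u x * (Xu x + n / 2 * u x)"
      unfolding laplacian_def DD_def sum_distrib_right ..
    have s4: "(\<Sum>b\<in>Basis. D b x * D b x) = G x" "(\<Sum>b\<in>Basis. D b x * (n / 2 * D b x)) = n / 2 * G x"
      unfolding G_def sum_distrib_left by (simp_all add: power2_eq_square mult_ac)
    have s5: "(\<Sum>b\<in>(Basis::'a set). W x) = n * W x" by (simp add: n_def)
    have "(\<Sum>b\<in>Basis. Y' b x b) = G x + n / 2 * G x + laplacian u x * (Xu x + n / 2 * u x)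
        + u x powr (\<sigma> + 1) * Xu x - V x * Xu x * u x - k * (norm x)\<^sup>2 * (u x)\<^sup>2 + n * W x"
      using cross nx s1 s2 s3 s4 s5
      by (simp add: Y'b distrib_left right_diff_distrib sum.distrib sum_subtractf del: sum_constant)
    also have "laplacian u x = V x * u x - u x powr (\<sigma> + 1)" using eq[of x] by (simp add: V_def)
    also have "G x + n / 2 * G x + (V x * u x - u x powr (\<sigma> + 1)) * (Xu x + n / 2 * u x)
        + u x powr (\<sigma> + 1) * Xu x - V x * Xu x * u x - k * (norm x)\<^sup>2 * (u x)\<^sup>2 + n * W x
      = G x - n / 2 * (u x powr (\<sigma> + 1) * u x) + n * (u x powr (\<sigma> + 2) / (\<sigma> + 2)) - k * (norm x)\<^sup>2 * (u x)\<^sup>2"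
      unfolding W_def by (simp add: algebra_simps power2_eq_square)
    also have "u x powr (\<sigma> + 1) * u x = u x powr (\<sigma> + 2)"
    proof -
      have "u x powr ((\<sigma> + 1) + 1) = u x powr (\<sigma> + 1) * u x powr 1" by (rule powr_add)
      then have "u x powr ((\<sigma> + 1) + 1) = u x powr (\<sigma> + 1) * u x" using nn[of x] by simp
      then show ?thesis by (simp only: add.assoc one_add_one)
    qed
    also have "G x - n / 2 * u x powr (\<sigma> + 2) + n * (u x powr (\<sigma> + 2) / (\<sigma> + 2)) - k * (norm x)\<^sup>2 * (u x)\<^sup>2 = Z x"
    proof -
      \<comment> \<open>Criticality \<open>n * \<sigma> = 4\<close> yields the coefficient
        \<open>2 / (\<sigma> + 2)\<close> here.\<close>
      have "n / 2 - n / (\<sigma> + 2) = (n * \<sigma>) / (2 * (\<sigma> + 2))" using \<sigma>0 by (simp add: field_simps)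
      also have "\<dots> = 2 / (\<sigma> + 2)" unfolding n\<sigma> using \<sigma>0 by (simp add: field_simps)
      finally have "n / 2 * p - n * (p / (\<sigma> + 2)) = 2 / (\<sigma> + 2) * p" for p
        by (metis left_diff_distrib times_divide_eq_left times_divide_eq_right)
      from this[of "u x powr (\<sigma> + 2)"] show ?thesis unfolding Z_def by (simp add: mult.assoc)
    qed
    finally show ?thesis .
  qed
  have zero: "(LINT x|lborel. bump 2 (e *\<^sub>R x) * Z x - 4 * e\<^sup>2 * bump 1 (e *\<^sub>R x) * Q x) = 0"
    if e: "0 < e" for e
  proof -
    \<comment> \<open>The derivative of \<open>bump 2 (e x) * Y b x\<close>. The second part comes
      from the gradient of the cut-off and sums to the term with \<open>Q\<close>.\<close>
    define F' where "F' b x h = bump 2 (e *\<^sub>R x) * Y' b x h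
      + - (4 * bump 1 (e *\<^sub>R x) * ((e *\<^sub>R x) \<bullet> (e *\<^sub>R h))) * Y b x" for b x h
    have "integrable lborel (\<lambda>x. F' b x b) \<and> (LINT x|lborel. F' b x b) = 0" if b: "b \<in> Basis" for b
    proof -
      have d: "((\<lambda>x. bump 2 (e *\<^sub>R x) * Y b x) has_derivative F' b x) (at x)" for x
      proof -
        have "((\<lambda>x. e *\<^sub>R x) has_derivative (\<lambda>h. e *\<^sub>R h)) (at x)"
          by (auto intro!: derivative_eq_intros)
        from has_derivative_bump_comp[OF this, of 0]
        have "((\<lambda>x. bump 2 (e *\<^sub>R x)) has_derivative
          (\<lambda>h. - (4 * bump 1 (e *\<^sub>R x) * ((e *\<^sub>R x) \<bullet> (e *\<^sub>R h))))) (at x)"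
          by (simp add: numeral_2_eq_2)
        then show ?thesis unfolding F'_def[abs_def] by (rule has_derivative_mult[OF _ dY[OF b]])
      qed
      have c: "continuous_on UNIV (\<lambda>x. F' b x b)"
        unfolding F'_def Y_def by (intro continuous_intros Y'c b Dc Xc uc Wc)
      have s: "bump 2 (e *\<^sub>R x) * Y b x = 0" if "1 / e < norm x" for x
        using that e by (simp add: bump_eq_0 field_simps)
      show ?thesis using integral_partial_deriv_eq_0[OF d c s] by blast
    qed
    then have "(LINT x|lborel. (\<Sum>b\<in>Basis. F' b x b)) = 0"
      by (simp add: Bochner_Integration.integral_sum)
    moreover have "(\<Sum>b\<in>Basis. F' b x b) = bump 2 (e *\<^sub>R x) * Z x - 4 * e\<^sup>2 * bump 1 (e *\<^sub>R x) * Q x" for x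
    proof -
      have QY: "Q x = (\<Sum>b\<in>Basis. (x \<bullet> b) * Y b x)"
      proof -
        have "(\<Sum>b\<in>Basis. (x \<bullet> b) * (D b x * (Xu x + n / 2 * u x))) = Xu x * (Xu x + n / 2 * u x)"
          by (subst (2) Xu_def) (simp add: sum_distrib_right mult_ac)
        moreover have "(\<Sum>b\<in>Basis. (x \<bullet> b) * ((x \<bullet> b) * W x)) = (norm x)\<^sup>2 * W x"
          unfolding power2_norm_eq_inner euclidean_inner[of x x] by (simp add: sum_distrib_left mult_ac)
        ultimately show ?thesis unfolding Q_def Y_def by (simp add: distrib_left sum.distrib)
      qed
      have "4 * e\<^sup>2 * bump 1 (e *\<^sub>R x) * Q x
        = (\<Sum>b\<in>Basis. 4 * bump 1 (e *\<^sub>R x) * ((e *\<^sub>R x) \<bullet> (e *\<^sub>R b)) * Y b x)"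
        unfolding QY sum_distrib_left by (simp add: power2_eq_square mult_ac)
      moreover have "bump 2 (e *\<^sub>R x) * Z x = (\<Sum>b\<in>Basis. bump 2 (e *\<^sub>R x) * Y' b x b)"
        by (simp add: div[symmetric] sum_distrib_left)
      ultimately show ?thesis unfolding F'_def by (simp add: sum_subtractf)
    qed
    ultimately show ?thesis by simp
  qed
  have iG: "integrable lborel G" using ig unfolding G[abs_def] .
  have Zi: "integrable lborel Z"
    unfolding Z_def[abs_def] using iG ip ix by simp
  have Wi: "integrable lborel W"
  proof -
    have "integrable lborel (\<lambda>x. u x powr (\<sigma> + 2) / (\<sigma> + 2) - G x / 2
      - (k / 2 * ((norm x)\<^sup>2 * (u x)\<^sup>2) + \<gamma> / 2 * (u x)\<^sup>2))"
      using iG ip ix iu by simp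
    then show ?thesis unfolding W_def[abs_def] V_def by (simp add: field_simps)
  qed
  have Zc: "continuous_on UNIV Z"
    unfolding Z_def[abs_def] by (intro continuous_intros Gc pc uc) (use \<sigma>0 in auto)
  have Qc: "continuous_on UNIV Q" unfolding Q_def[abs_def] by (intro continuous_intros Xc uc Wc)
  define e where "e i = 1 / real (Suc i)" for i
  have e: "0 < e i" "e i \<le> 1" for i by (simp_all add: e_def)
  have e0: "e \<longlonglongrightarrow> 0" unfolding e_def[abs_def] by (rule LIMSEQ_Suc[OF lim_1_over_n])
  have "(\<lambda>i. LINT x|lborel. bump 2 (e i *\<^sub>R x) * Z x - 4 * (e i)\<^sup>2 * bump 1 (e i *\<^sub>R x) * Q x)
    \<longlonglongrightarrow> (LINT x|lborel. Z x)"
  proof (rule integral_dominated_convergence)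
    show "Z \<in> borel_measurable lborel" using Zi by auto
    \<comment> \<open>On the support of the cut-off \<open>e^2 |x|^2 \<le> 1\<close>, so
      \<open>e^2\<close> absorbs the growth of the multiplier: \<open>e^2 (Xu)^2 \<le> G\<close>,
      and AM-GM with \<open>e \<le> 1\<close> bounds the mixed term. Together these give the
      dominating function.\<close>
    show "integrable lborel (\<lambda>x. \<bar>Z x\<bar> + 4 * ((1 + n / 4) * G x + n / 4 * (u x)\<^sup>2 + \<bar>W x\<bar>))"
      using Zi iG iu Wi by simp
    show "(\<lambda>x. bump 2 (e i *\<^sub>R x) * Z x - 4 * (e i)\<^sup>2 * bump 1 (e i *\<^sub>R x) * Q x) \<in> borel_measurable lborel" for i
    proof -
      have "(\<lambda>x. bump 2 (e i *\<^sub>R x) * Z x - 4 * (e i)\<^sup>2 * bump 1 (e i *\<^sub>R x) * Q x) \<in> borel_measurable borel"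
        by (intro borel_measurable_continuous_onI continuous_intros Zc Qc)
      then show ?thesis by simp
    qed
    show "AE x in lborel. (\<lambda>i. bump 2 (e i *\<^sub>R x) * Z x - 4 * (e i)\<^sup>2 * bump 1 (e i *\<^sub>R x) * Q x) \<longlonglongrightarrow> Z x"
    proof (rule AE_I2)
      fix x :: 'a
      have "(\<lambda>i. bump m (e i *\<^sub>R x)) \<longlonglongrightarrow> bump m (0 *\<^sub>R x)" for m
        unfolding bump_def by (intro tendsto_intros e0)
      then have b: "(\<lambda>i. bump m (e i *\<^sub>R x)) \<longlonglongrightarrow> 1" for m by (simp add: bump_def)
      have "(\<lambda>i. bump 2 (e i *\<^sub>R x) * Z x - 4 * (e i)\<^sup>2 * bump 1 (e i *\<^sub>R x) * Q x)
        \<longlonglongrightarrow> 1 * Z x - 4 * 0\<^sup>2 * 1 * Q x" by (intro tendsto_intros b e0)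
      then show "(\<lambda>i. bump 2 (e i *\<^sub>R x) * Z x - 4 * (e i)\<^sup>2 * bump 1 (e i *\<^sub>R x) * Q x) \<longlonglongrightarrow> Z x" by simp
    qed
    show "AE x in lborel. norm (bump 2 (e i *\<^sub>R x) * Z x - 4 * (e i)\<^sup>2 * bump 1 (e i *\<^sub>R x) * Q x)
      \<le> \<bar>Z x\<bar> + 4 * ((1 + n / 4) * G x + n / 4 * (u x)\<^sup>2 + \<bar>W x\<bar>)" for i
    proof (rule AE_I2)
      fix x :: 'a
      have G0: "0 \<le> G x" unfolding G_def by (intro sum_nonneg) simp
      have n0: "0 \<le> n" using n by simp
      let ?B = "(1 + n / 4) * G x + n / 4 * (u x)\<^sup>2 + \<bar>W x\<bar>"
      have B0: "0 \<le> ?B" using G0 n0 by simp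
      have 1: "\<bar>bump 2 (e i *\<^sub>R x) * Z x\<bar> \<le> \<bar>Z x\<bar>"
        using mult_right_mono[OF bump_le_1[of 2 "e i *\<^sub>R x"] abs_ge_zero[of "Z x"]] by (simp add: abs_mult)
      have 2: "\<bar>4 * (e i)\<^sup>2 * bump 1 (e i *\<^sub>R x) * Q x\<bar> \<le> 4 * ?B"
      proof (cases "norm (e i *\<^sub>R x) \<le> 1")
        case False
        then have "bump 1 (e i *\<^sub>R x) = 0" by (simp add: bump_eq_0)
        then show ?thesis using B0 by simp
      next
        case True
        then have "(norm (e i *\<^sub>R x))\<^sup>2 \<le> 1" by (simp add: power_le_one)
        then have ex: "(e i)\<^sup>2 * (norm x)\<^sup>2 \<le> 1" by (simp add: power_mult_distrib)
        have e1: "(e i)\<^sup>2 \<le> 1" using e[of i] by (simp add: power_le_one)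
        have "(Xu x)\<^sup>2 \<le> (norm x)\<^sup>2 * G x" unfolding Xu_def G_def by (rule inner_Basis_partials_le)
        then have "(e i)\<^sup>2 * (Xu x)\<^sup>2 \<le> (e i)\<^sup>2 * ((norm x)\<^sup>2 * G x)" by (rule mult_left_mono) simp
        also have "\<dots> \<le> 1 * G x" unfolding mult.assoc[symmetric] using ex G0 by (rule mult_right_mono)
        finally have X: "(e i)\<^sup>2 * (Xu x)\<^sup>2 \<le> G x" by simp
        have "\<bar>Xu x * u x\<bar> \<le> ((Xu x)\<^sup>2 + (u x)\<^sup>2) / 2"
          using sum_squares_bound[of "\<bar>Xu x\<bar>" "\<bar>u x\<bar>"] by (simp add: abs_mult)
        then have "(e i)\<^sup>2 * \<bar>Xu x * u x\<bar> \<le> (e i)\<^sup>2 * (((Xu x)\<^sup>2 + (u x)\<^sup>2) / 2)" by (rule mult_left_mono) simp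
        also have "\<dots> = ((e i)\<^sup>2 * (Xu x)\<^sup>2 + (e i)\<^sup>2 * (u x)\<^sup>2) / 2" by (simp add: algebra_simps)
        also have "\<dots> \<le> (G x + 1 * (u x)\<^sup>2) / 2"
          by (intro divide_right_mono add_mono X mult_right_mono[OF e1]) auto
        finally have Xu': "(e i)\<^sup>2 * \<bar>Xu x * u x\<bar> \<le> (G x + (u x)\<^sup>2) / 2" by simp
        have W': "(e i)\<^sup>2 * (norm x)\<^sup>2 * \<bar>W x\<bar> \<le> 1 * \<bar>W x\<bar>" using ex by (rule mult_right_mono) simp
        have "\<bar>Q x\<bar> \<le> (Xu x)\<^sup>2 + n / 2 * \<bar>Xu x * u x\<bar> + (norm x)\<^sup>2 * \<bar>W x\<bar>"
        proof -
          have "Q x = (Xu x)\<^sup>2 + n / 2 * (Xu x * u x) + (norm x)\<^sup>2 * W x"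
            unfolding Q_def by (simp add: algebra_simps power2_eq_square)
          moreover have "\<bar>n / 2 * (Xu x * u x)\<bar> = n / 2 * \<bar>Xu x * u x\<bar>" using n0 by (simp add: abs_mult)
          moreover have "\<bar>(norm x)\<^sup>2 * W x\<bar> = (norm x)\<^sup>2 * \<bar>W x\<bar>" by (simp add: abs_mult)
          ultimately show ?thesis using zero_le_power2[of "Xu x"] by linarith
        qed
        then have "(e i)\<^sup>2 * \<bar>Q x\<bar> \<le> (e i)\<^sup>2 * ((Xu x)\<^sup>2 + n / 2 * \<bar>Xu x * u x\<bar> + (norm x)\<^sup>2 * \<bar>W x\<bar>)"
          by (rule mult_left_mono) simp
        also have "\<dots> = (e i)\<^sup>2 * (Xu x)\<^sup>2 + n / 2 * ((e i)\<^sup>2 * \<bar>Xu x * u x\<bar>) + (e i)\<^sup>2 * (norm x)\<^sup>2 * \<bar>W x\<bar>"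
          by (simp add: algebra_simps)
        also have "\<dots> \<le> G x + n / 2 * ((G x + (u x)\<^sup>2) / 2) + 1 * \<bar>W x\<bar>"
          by (intro add_mono X W' mult_left_mono[OF Xu']) (use n0 in simp)
        also have "\<dots> = ?B" by (simp add: field_simps)
        finally have Q: "(e i)\<^sup>2 * \<bar>Q x\<bar> \<le> ?B" .
        have "\<bar>4 * (e i)\<^sup>2 * bump 1 (e i *\<^sub>R x) * Q x\<bar> = bump 1 (e i *\<^sub>R x) * (4 * ((e i)\<^sup>2 * \<bar>Q x\<bar>))"
          by (simp add: abs_mult mult_ac)
        also have "\<dots> \<le> 1 * (4 * ((e i)\<^sup>2 * \<bar>Q x\<bar>))"
          by (rule mult_right_mono[OF bump_le_1]) simp
        finally show ?thesis using Q by simp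
      qed
      show "norm (bump 2 (e i *\<^sub>R x) * Z x - 4 * (e i)\<^sup>2 * bump 1 (e i *\<^sub>R x) * Q x)
        \<le> \<bar>Z x\<bar> + 4 * ?B"
        using 1 2 unfolding real_norm_def by linarith
    qed
  qed
  then have "(LINT x|lborel. Z x) = 0"
    using zero[OF e(1)] by (simp add: LIMSEQ_const_iff)
  moreover have "(LINT x|lborel. Z x) = (LINT x|lborel. G x) - 2 / (\<sigma> + 2) * (LINT x|lborel. u x powr (\<sigma> + 2))
    - k * (LINT x|lborel. (norm x)\<^sup>2 * (u x)\<^sup>2)"
    unfolding Z_def using iG ip ix by simp
  ultimately show ?thesis by (simp add: G)
qed

section \<open>The dilation factor\<close>

text \<open>The fundamental theorem on a compact interval in \<open>I\<close> that contains 0 and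
  has \<open>t\<close> in its interior; minimum and maximum treat both signs of \<open>t\<close> at
  once.\<close>

lemma interval_integral_DERIV:
  fixes f :: "real \<Rightarrow> real"
  assumes I: "open I" "is_interval I" "0 \<in> I" and f: "continuous_on I f" and t: "t \<in> I"
  shows "((\<lambda>u. LBINT y=0..u. f y) has_real_derivative f t) (at t)"
proof -
  obtain e where e: "0 < e" "cball t e \<subseteq> I" using I(1)[unfolded open_contains_cball] t by blast
  define c d where "c = min 0 (t - e)" and "d = max 0 (t + e)"
  have "t - e \<in> cball t e" "t + e \<in> cball t e" using e(1) by (simp_all add: dist_real_def)
  then have "t - e \<in> I" "t + e \<in> I" using e(2) by blast+
  then have "c \<in> I" "d \<in> I" using I(3) unfolding c_def d_def min_def max_def by simp_all
  from mem_is_interval_1_I[OF I(2) this] have cd: "{c..d} \<subseteq> I" by auto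
  have "((\<lambda>u. LBINT y=ereal 0..ereal u. f y) has_vector_derivative f t) (at t within {c..d})"
  proof (rule interval_integral_FTC2)
    show "c \<le> 0" "0 \<le> d" "c \<le> t" "t \<le> d" using e(1) by (simp_all add: c_def d_def min_le_iff_disj le_max_iff_disj)
  qed (rule continuous_on_subset[OF f cd])
  moreover have "t \<in> interior {c..d}" using e(1) by (simp add: c_def d_def min_less_iff_disj less_max_iff_disj)
  ultimately show ?thesis
    unfolding has_real_derivative_iff_has_vector_derivative zero_ereal_def
    by (simp only: at_within_interior)
qed

lemma eq_0_if_DERIV_0:
  fixes f :: "real \<Rightarrow> real"
  assumes "is_interval I" "0 \<in> I" "f 0 = 0" "\<And>t. t \<in> I \<Longrightarrow> (f has_real_derivative 0) (at t)" "t \<in> I"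
  shows "f t = 0"
proof -
  have "\<exists>c. \<forall>x\<in>I. f x = c"
    using assms(1,4) by (intro has_field_derivative_zero_constant)
      (auto simp: is_interval_convex intro: has_field_derivative_at_within)
  then obtain c where "\<forall>x\<in>I. f x = c" ..
  then show ?thesis using assms(2,3,5) by auto
qed

lemma a_solutionD:
  assumes "a_solution k I a"
  shows "open I" "is_interval I" "0 \<in> I" "continuous_on I a"
    and "t \<in> I \<Longrightarrow> ((\<lambda>t. LBINT \<tau>=0..t. a \<tau>) has_real_derivative a t) (at t)"
    and "t \<in> I \<Longrightarrow>
      (a has_real_derivative 4 * k * exp (- 4 * (LBINT \<tau>=0..t. a \<tau>)) - (a t)\<^sup>2) (at t)"
proof -
  have 1: "(a has_real_derivative 4 * k * exp (- 4 * (LBINT \<tau>=0..t. a \<tau>)) - (a t)\<^sup>2) (at t)"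
    if t: "t \<in> I" for t
  proof -
    obtain a' where a': "(a has_real_derivative a') (at t)"
      "a' + (a t)\<^sup>2 = 4 * k * exp (- 4 * (LBINT \<tau>=0..t. a \<tau>))"
      using assms[unfolded a_solution_def, THEN conjunct2, THEN conjunct2, THEN conjunct2, rule_format, OF t]
      by blast
    then have "a' = 4 * k * exp (- 4 * (LBINT \<tau>=0..t. a \<tau>)) - (a t)\<^sup>2" by linarith
    then show ?thesis using a'(1) by simp
  qed
  show I: "open I" "is_interval I" "0 \<in> I" using assms by (auto simp: a_solution_def)
  show c: "continuous_on I a"
    by (intro continuous_at_imp_continuous_on ballI DERIV_isCont[OF 1])
  show "t \<in> I \<Longrightarrow> ((\<lambda>t. LBINT \<tau>=0..t. a \<tau>) has_real_derivative a t) (at t)"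
    by (rule interval_integral_DERIV[OF I c])
  show "t \<in> I \<Longrightarrow>
      (a has_real_derivative 4 * k * exp (- 4 * (LBINT \<tau>=0..t. a \<tau>)) - (a t)\<^sup>2) (at t)"
    by (rule 1)
qed

definition spread :: "real \<Rightarrow> real \<Rightarrow> real \<Rightarrow> real" where
  "spread k \<alpha> t = (1 + \<alpha> * t)\<^sup>2 + 4 * k * t\<^sup>2"

text \<open>\<open>\<mu> = exp (2 \<integral> a)\<close> satisfies \<open>\<mu>'' = 2 a\<^sup>2 \<mu> + 8 k / \<mu>\<close>, and this right-hand side is a
  conserved quantity of the equation for \<open>a\<close>.\<close>

lemma a_solution_spread:
  assumes a: "a_solution k I a" and t: "t \<in> I"
  shows "exp (2 * (LBINT \<tau>=0..t. a \<tau>)) = spread k (a 0) t"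
    and "a t * spread k (a 0) t = a 0 + ((a 0)\<^sup>2 + 4 * k) * t"
proof -
  note I = a_solutionD(1-3)[OF a]
  define L where "L t = (LBINT \<tau>=0..t. a \<tau>)" for t :: real
  have L0: "L 0 = 0" by (simp add: L_def interval_integral_endpoints_same flip: zero_ereal_def)
  have dL: "(L has_real_derivative a t) (at t)" if "t \<in> I" for t
    unfolding L_def[abs_def] by (rule a_solutionD(5)[OF a that])
  have da: "(a has_real_derivative 4 * k * exp (- 4 * L t) - (a t)\<^sup>2) (at t)" if "t \<in> I" for t
    unfolding L_def by (rule a_solutionD(6)[OF a that])
  \<comment> \<open>Half of the constant value of the second derivative of the dilation factor, read
    off at time 0.\<close>
  define c where "c = (a 0)\<^sup>2 + 4 * k"
  have e1: "exp (2 * L t) * exp (- 4 * L t) = exp (- 2 * L t)" for t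
    by (simp flip: exp_add)
  have E: "2 * (a t)\<^sup>2 * exp (2 * L t) + 8 * k * exp (- 2 * L t) - 2 * c = 0" if "t \<in> I" for t
  proof (rule eq_0_if_DERIV_0[where f="\<lambda>t. 2 * (a t)\<^sup>2 * exp (2 * L t) + 8 * k * exp (- 2 * L t) - 2 * c", OF I(2,3) _ _ that])
    show "2 * (a 0)\<^sup>2 * exp (2 * L 0) + 8 * k * exp (- 2 * L 0) - 2 * c = 0" by (simp add: L0 c_def)
    fix t assume t: "t \<in> I"
    have "((\<lambda>t. 2 * (a t)\<^sup>2 * exp (2 * L t) + 8 * k * exp (- 2 * L t) - 2 * c) has_real_derivative
       4 * a t * (4 * k * exp (- 4 * L t) - (a t)\<^sup>2) * exp (2 * L t) + 2 * (a t)\<^sup>2 * (exp (2 * L t) * (2 * a t))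
        + 8 * k * (exp (- 2 * L t) * (- 2 * a t))) (at t)"
      by (auto intro!: derivative_eq_intros da dL t)
    also have "4 * a t * (4 * k * exp (- 4 * L t) - (a t)\<^sup>2) * exp (2 * L t) + 2 * (a t)\<^sup>2 * (exp (2 * L t) * (2 * a t))
        + 8 * k * (exp (- 2 * L t) * (- 2 * a t)) = 0"
      unfolding e1[symmetric] by (simp add: algebra_simps power2_eq_square)
    finally show "((\<lambda>t. 2 * (a t)\<^sup>2 * exp (2 * L t) + 8 * k * exp (- 2 * L t) - 2 * c) has_real_derivative 0) (at t)" .
  qed
  \<comment> \<open>\<open>2 a \<mu>\<close> is the derivative of \<open>\<mu>\<close>; its own
    derivative is the conserved \<open>2 * c\<close>, so it is affine in \<open>t\<close>.\<close>
  have p: "2 * a t * exp (2 * L t) - 2 * a 0 - 2 * c * t = 0" if "t \<in> I" for t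
  proof (rule eq_0_if_DERIV_0[where f="\<lambda>t. 2 * a t * exp (2 * L t) - 2 * a 0 - 2 * c * t", OF I(2,3) _ _ that])
    show "2 * a 0 * exp (2 * L 0) - 2 * a 0 - 2 * c * 0 = 0" by (simp add: L0)
    fix t assume t: "t \<in> I"
    have "((\<lambda>t. 2 * a t * exp (2 * L t) - 2 * a 0 - 2 * c * t) has_real_derivative
      2 * (4 * k * exp (- 4 * L t) - (a t)\<^sup>2) * exp (2 * L t) + 2 * a t * (exp (2 * L t) * (2 * a t)) - 2 * c) (at t)"
      by (auto intro!: derivative_eq_intros da dL t)
    also have "2 * (4 * k * exp (- 4 * L t) - (a t)\<^sup>2) * exp (2 * L t) + 2 * a t * (exp (2 * L t) * (2 * a t)) - 2 * c
      = 2 * (a t)\<^sup>2 * exp (2 * L t) + 8 * k * exp (- 2 * L t) - 2 * c"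
      unfolding e1[symmetric] by (simp add: algebra_simps power2_eq_square)
    finally show "((\<lambda>t. 2 * a t * exp (2 * L t) - 2 * a 0 - 2 * c * t) has_real_derivative 0) (at t)"
      using E[OF t] by simp
  qed
  have "exp (2 * L t) - spread k (a 0) t = 0"
  proof (rule eq_0_if_DERIV_0[where f="\<lambda>t. exp (2 * L t) - spread k (a 0) t", OF I(2,3) _ _ t])
    show "exp (2 * L 0) - spread k (a 0) 0 = 0" by (simp add: L0 spread_def)
    fix t assume t: "t \<in> I"
    have "((\<lambda>t. exp (2 * L t) - spread k (a 0) t) has_real_derivative
      exp (2 * L t) * (2 * a t) - (2 * (1 + a 0 * t) * a 0 + 4 * k * (2 * t))) (at t)"
      unfolding spread_def by (auto intro!: derivative_eq_intros da dL t)
    also have "exp (2 * L t) * (2 * a t) - (2 * (1 + a 0 * t) * a 0 + 4 * k * (2 * t)) = 0"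
      using p[OF t] by (simp add: algebra_simps power2_eq_square c_def)
    finally show "((\<lambda>t. exp (2 * L t) - spread k (a 0) t) has_real_derivative 0) (at t)" .
  qed
  then show 1: "exp (2 * (LBINT \<tau>=0..t. a \<tau>)) = spread k (a 0) t" by (simp add: L_def)
  show "a t * spread k (a 0) t = a 0 + ((a 0)\<^sup>2 + 4 * k) * t"
    using p[OF t] unfolding 1[symmetric] by (simp add: L_def c_def algebra_simps)
qed

section \<open>The domain of the maximal solution\<close>

lemma spread_0 [simp]: "spread k \<alpha> 0 = 1"
  by (simp add: spread_def)

lemma spread_continuous_on: "continuous_on S (spread k \<alpha>)"
  unfolding spread_def[abs_def] by (intro continuous_intros)

text \<open>A component is taken because solutions live on intervals around 0: for
  \<open>k = 0\<close> and nonzero \<open>\<alpha>\<close> the polynomial is positive again beyond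
  its double zero.\<close>

definition spread_domain :: "real \<Rightarrow> real \<Rightarrow> real set" where
  "spread_domain k \<alpha> = connected_component_set {t. 0 < spread k \<alpha> t} 0"

lemma spread_domain_basic:
  "open (spread_domain k \<alpha>)" "is_interval (spread_domain k \<alpha>)" "0 \<in> spread_domain k \<alpha>"
  "t \<in> spread_domain k \<alpha> \<Longrightarrow> 0 < spread k \<alpha> t"
proof -
  have "open {t. 0 < spread k \<alpha> t}"
    by (rule open_Collect_less) (auto intro: spread_continuous_on)
  then show "open (spread_domain k \<alpha>)" unfolding spread_domain_def by (rule open_connected_component)
  show "is_interval (spread_domain k \<alpha>)" unfolding spread_domain_def is_interval_connected_1 by simp
  show "0 \<in> spread_domain k \<alpha>" unfolding spread_domain_def by (simp add: connected_component_refl)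
  show "t \<in> spread_domain k \<alpha> \<Longrightarrow> 0 < spread k \<alpha> t"
    unfolding spread_domain_def using connected_component_subset by fastforce
qed

text \<open>On \<open>I\<close> the polynomial equals an exponential, so a solution cannot reach one
  of its zeros.\<close>

lemma a_solution_subset_spread_domain:
  assumes "a_solution k I a"
  shows "I \<subseteq> spread_domain k (a 0)"
  unfolding spread_domain_def
proof (rule connected_component_maximal)
  show "0 \<in> I" "connected I"
    using a_solutionD(2,3)[OF assms] by (auto simp: is_interval_connected_1)
  have "0 < spread k (a 0) t" if "t \<in> I" for t
    unfolding a_solution_spread(1)[OF assms that, symmetric] by simp
  then show "I \<subseteq> {t. 0 < spread k (a 0) t}" by blast
qed

text \<open>The candidate is half the logarithmic derivative of \<open>spread\<close>, so its
  integral is \<open>ln (spread k \<alpha> t) / 2\<close> and the right-hand side of the equation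
  becomes a rational function.\<close>

lemma a_solution_on_spread_domain:
  defines "a k \<alpha> t \<equiv> (\<alpha> + (\<alpha>\<^sup>2 + 4 * k) * t) / spread k \<alpha> t"
  shows "a_solution k (spread_domain k \<alpha>) (a k \<alpha>)"
proof -
  let ?I = "spread_domain k \<alpha>"
  note I = spread_domain_basic[where k=k and \<alpha>=\<alpha>]
  have dq: "(spread k \<alpha> has_real_derivative 2 * (\<alpha> + (\<alpha>\<^sup>2 + 4 * k) * t)) (at t)" for t
    unfolding spread_def[abs_def]
    by (auto intro!: derivative_eq_intros simp: algebra_simps power2_eq_square)
  have cont: "continuous_on ?I (a k \<alpha>)"
    unfolding a_def by (intro continuous_intros spread_continuous_on) (use I(4) in fastforce)
  have int: "(LBINT \<tau>=0..t. a k \<alpha> \<tau>) = ln (spread k \<alpha> t) / 2" if t: "t \<in> ?I" for t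
  proof -
    have "min 0 t \<in> ?I" "max 0 t \<in> ?I" using t I(3) by (auto simp: min_def max_def)
    from mem_is_interval_1_I[OF I(2) this] have sub: "{min 0 t..max 0 t} \<subseteq> ?I" by auto
    have "(LBINT \<tau>=ereal 0..ereal t. a k \<alpha> \<tau>) = ln (spread k \<alpha> t) / 2 - ln (spread k \<alpha> 0) / 2"
    proof (rule interval_integral_FTC_finite)
      show "continuous_on {min 0 t..max 0 t} (a k \<alpha>)" by (rule continuous_on_subset[OF cont sub])
      fix x assume "min 0 t \<le> x" "x \<le> max 0 t"
      then have x: "0 < spread k \<alpha> x" using sub I(4) by auto
      have "((\<lambda>t. ln (spread k \<alpha> t) / 2) has_real_derivative a k \<alpha> x) (at x)"
        using x by (auto intro!: derivative_eq_intros dq simp: a_def field_simps)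
      then show "((\<lambda>t. ln (spread k \<alpha> t) / 2) has_vector_derivative a k \<alpha> x)
        (at x within {min 0 t..max 0 t})"
        by (simp add: has_real_derivative_iff_has_vector_derivative has_vector_derivative_at_within)
    qed
    then show ?thesis by (simp flip: zero_ereal_def)
  qed
  have "\<exists>a'. (a k \<alpha> has_real_derivative a') (at t) \<and>
        a' + (a k \<alpha> t)\<^sup>2 = 4 * k * exp (- 4 * (LBINT \<tau>=0..t. a k \<alpha> \<tau>))" if t: "t \<in> ?I" for t
  proof -
    define q N where "q = spread k \<alpha> t" and "N = \<alpha> + (\<alpha>\<^sup>2 + 4 * k) * t"
    have q: "0 < q" using I(4)[OF t] by (simp add: q_def)
    have "((\<lambda>t. (\<alpha> + (\<alpha>\<^sup>2 + 4 * k) * t) / spread k \<alpha> t) has_real_derivative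
      ((\<alpha>\<^sup>2 + 4 * k) * q - N * (2 * N)) / (q * q)) (at t)"
      unfolding q_def N_def
      by (rule DERIV_cong[OF DERIV_divide[OF _ dq]]) (use q in \<open>auto intro!: derivative_eq_intros simp: q_def\<close>)
    then have "(a k \<alpha> has_real_derivative ((\<alpha>\<^sup>2 + 4 * k) * q - N * (2 * N)) / (q * q)) (at t)"
      unfolding a_def .
    moreover have "((\<alpha>\<^sup>2 + 4 * k) * q - N * (2 * N)) / (q * q) + (a k \<alpha> t)\<^sup>2
      = 4 * k * exp (- 4 * (LBINT \<tau>=0..t. a k \<alpha> \<tau>))"
    proof -
      have "exp (- 4 * (LBINT \<tau>=0..t. a k \<alpha> \<tau>)) = exp (- (ln q + ln q))"
        unfolding int[OF t] q_def by simp
      then have e: "exp (- 4 * (LBINT \<tau>=0..t. a k \<alpha> \<tau>)) = 1 / (q * q)"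
        unfolding exp_minus exp_add using q by (simp add: divide_inverse)
      have "(a k \<alpha> t)\<^sup>2 = N * N / (q * q)"
        by (simp add: a_def q_def N_def power2_eq_square)
      then have "((\<alpha>\<^sup>2 + 4 * k) * q - N * (2 * N)) / (q * q) + (a k \<alpha> t)\<^sup>2
        = ((\<alpha>\<^sup>2 + 4 * k) * q - N * (2 * N) + N * N) / (q * q)" by (simp only: add_divide_distrib)
      \<comment> \<open>The numerator is constant by the discriminant identity
        \<open>N^2 = (\<alpha>^2 + 4 k) q - 4 k\<close>.\<close>
      also have "(\<alpha>\<^sup>2 + 4 * k) * q - N * (2 * N) + N * N = 4 * k"
        unfolding q_def N_def spread_def by (simp add: algebra_simps power2_eq_square)
      finally show ?thesis unfolding e by simp
    qed
    ultimately show ?thesis by blast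
  qed
  then show ?thesis unfolding a_solution_def using I by blast
qed

lemma maximal_a_solution_exists: "\<exists>I a. maximal_a_solution k I a \<and> a 0 = \<alpha>"
proof -
  define a where "a t = (\<alpha> + (\<alpha>\<^sup>2 + 4 * k) * t) / spread k \<alpha> t" for t
  have a: "a_solution k (spread_domain k \<alpha>) a"
    using a_solution_on_spread_domain[of k \<alpha>] by (simp add: a_def[abs_def])
  have a0: "a 0 = \<alpha>" by (simp add: a_def)
  have "J = spread_domain k \<alpha>"
    if "a_solution k J b" "spread_domain k \<alpha> \<subseteq> J" "\<forall>t\<in>spread_domain k \<alpha>. b t = a t" for J b
    using a_solution_subset_spread_domain[OF that(1)] that(2,3) spread_domain_basic(3)[of k \<alpha>] a0 by auto
  then show ?thesis using a a0 unfolding maximal_a_solution_def by blast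
qed

text \<open>A solution is determined by \<open>a 0\<close>, since \<open>a * spread\<close> is an
  explicit affine function. It is thus a restriction of the explicit solution, and maximality leaves
  no room for a proper one.\<close>

lemma maximal_a_solution_domain:
  assumes "maximal_a_solution k I a"
  shows "I = spread_domain k (a 0)"
proof -
  have a: "a_solution k I a" using assms by (simp add: maximal_a_solution_def)
  define b where "b t = (a 0 + ((a 0)\<^sup>2 + 4 * k) * t) / spread k (a 0) t" for t
  have b: "a_solution k (spread_domain k (a 0)) b"
    using a_solution_on_spread_domain[of k "a 0"] by (simp add: b_def[abs_def])
  note sub = a_solution_subset_spread_domain[OF a]
  have "b t = a t" if "t \<in> I" for t
    using a_solution_spread(2)[OF a that] spread_domain_basic(4)[of t k "a 0"] sub that
    by (auto simp: b_def field_simps)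
  then show ?thesis using assms b sub unfolding maximal_a_solution_def by blast
qed

lemma spread_domain_pos: "0 < k \<Longrightarrow> spread_domain k \<alpha> = UNIV"
proof -
  assume k: "0 < k"
  have "0 < spread k \<alpha> t" for t
  proof (cases "t = 0")
    case False
    then have "0 < 4 * k * t\<^sup>2" using k by simp
    then show ?thesis unfolding spread_def by (intro add_nonneg_pos) auto
  qed simp
  then have "{t. 0 < spread k \<alpha> t} = UNIV" by blast
  then show ?thesis unfolding spread_domain_def by simp
qed

text \<open>\<open>spread\<close> is here the square of \<open>1 + \<alpha> t\<close>; by the
  intermediate value theorem a connected set that contains 0 and avoids the zero stays on one side.
  The result is a half-line, or the whole line for \<open>\<alpha> = 0\<close>.\<close>

lemma spread_domain_zero: "spread_domain 0 \<alpha> = {t. 0 < 1 + \<alpha> * t}"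
proof
  let ?f = "\<lambda>t. 1 + \<alpha> * t"
  have "convex {t. 0 < ?f t}"
  proof -
    have "{t. 0 < ?f t} = {t. - 1 < \<alpha> \<bullet> t}" by auto
    then show ?thesis using convex_halfspace_gt[of "- 1" \<alpha>] by simp
  qed
  then have "connected {t. 0 < ?f t}" by (rule convex_connected)
  then show "{t. 0 < ?f t} \<subseteq> spread_domain 0 \<alpha>"
    unfolding spread_domain_def by (intro connected_component_maximal) (auto simp: spread_def)
  show "spread_domain 0 \<alpha> \<subseteq> {t. 0 < ?f t}"
  proof
    fix t assume t: "t \<in> spread_domain 0 \<alpha>"
    show "t \<in> {t. 0 < ?f t}"
    proof (rule ccontr)
      assume "t \<notin> {t. 0 < ?f t}"
      then have le: "?f t \<le> 0" by simp
      have "connected (?f ` spread_domain 0 \<alpha>)"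
        using spread_domain_basic(2)[of 0 \<alpha>]
        by (intro connected_continuous_image continuous_intros) (simp add: is_interval_connected_1)
      moreover have "?f t \<in> ?f ` spread_domain 0 \<alpha>" "?f 0 \<in> ?f ` spread_domain 0 \<alpha>"
        using t spread_domain_basic(3) by blast+
      ultimately have "0 \<in> ?f ` spread_domain 0 \<alpha>"
        using le connectedD_interval[of "?f ` spread_domain 0 \<alpha>" "?f t" "?f 0" 0] by simp
      then show False using spread_domain_basic(4)[of _ 0 \<alpha>] by (auto simp: spread_def)
    qed
  qed
qed

section \<open>The wave solves the Schroedinger equation\<close>

definition chirp :: "real \<Rightarrow> 'a::euclidean_space \<Rightarrow> complex" where
  "chirp c y = exp (\<i> * complex_of_real (c * (norm y)\<^sup>2))"

lemma chirp_continuous_on [continuous_intros]: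
  "continuous_on S f \<Longrightarrow> continuous_on S g \<Longrightarrow> continuous_on S (\<lambda>x. chirp (f x) (g x))"
  unfolding chirp_def by (intro continuous_intros)

lemma norm_chirp [simp]: "cmod (chirp c y) = 1"
  unfolding chirp_def by (rule norm_exp_i_times)

lemma has_derivative_of_real_comp:
  "(f has_derivative f') F \<Longrightarrow> ((\<lambda>x. complex_of_real (f x)) has_derivative (\<lambda>h. complex_of_real (f' h))) F"
  by (rule bounded_linear.has_derivative[OF bounded_linear_of_real])

lemma has_derivative_chirp:
  "(chirp c has_derivative (\<lambda>h. \<i> * complex_of_real (2 * c * (y \<bullet> h)) * chirp c y)) (at y)"
proof -
  have "((\<lambda>y::'a. c * (norm y)\<^sup>2) has_derivative (\<lambda>h. 2 * c * (y \<bullet> h))) (at y)"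
    unfolding power2_norm_eq_inner
    by (auto intro!: derivative_eq_intros simp: inner_commute)
  from has_derivative_compose[OF has_derivative_mult_right[OF has_derivative_of_real_comp[OF this], of \<i>]
      DERIV_exp[unfolded has_field_derivative_def]]
  show ?thesis
    unfolding chirp_def[abs_def] by (rule has_derivative_eq_rhs) (simp add: fun_eq_iff mult_ac)
qed

text \<open>Differentiation keeps the chirp as a right factor and acts on \<open>G\<close> by adding
  a term linear in \<open>x - x0\<close>. The same rule therefore serves the second derivative, with
  \<open>chirped_D\<close> in place of \<open>G\<close>.\<close>

lemma has_derivative_chirped:
  assumes "(G has_derivative G') (at (x - x0))"
  shows "((\<lambda>x. E * G (x - x0) * chirp c (x - x0)) has_derivative
    (\<lambda>h. E * (G' h + \<i> * complex_of_real (2 * c * ((x - x0) \<bullet> h)) * G (x - x0)) * chirp c (x - x0))) (at x)"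
proof -
  have d: "((\<lambda>x. x - x0) has_derivative (\<lambda>h. h)) (at x)" by (auto intro!: derivative_eq_intros)
  have "((\<lambda>x. E * G (x - x0) * chirp c (x - x0)) has_derivative
    (\<lambda>h. E * G (x - x0) * (\<i> * complex_of_real (2 * c * ((x - x0) \<bullet> h)) * chirp c (x - x0))
      + E * G' h * chirp c (x - x0))) (at x)"
    by (intro has_derivative_mult has_derivative_mult_right has_derivative_compose[OF d] assms
        has_derivative_chirp)
  then show ?thesis by (rule has_derivative_eq_rhs) (simp add: fun_eq_iff algebra_simps)
qed

text \<open>One time slice of the wave, with amplitude, dilation and phase as independent
  parameters: the calculus in space is done before the equation for \<open>a\<close> couples
  them.\<close>

definition chirped :: "('a::euclidean_space \<Rightarrow> real) \<Rightarrow> complex \<Rightarrow> real \<Rightarrow> real \<Rightarrow> 'a \<Rightarrow> 'a \<Rightarrow> complex" where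
  "chirped A E s c x0 x = E * complex_of_real (A (s *\<^sub>R (x - x0))) * chirp c (x - x0)"

text \<open>What remains of a partial derivative once amplitude and chirp are pulled out: the
  derivative in direction \<open>b\<close> plus multiplication by
  \<open>2 i c (y \<bullet> b)\<close>, applied to the dilated profile.\<close>

definition chirped_D :: "('a::euclidean_space \<Rightarrow> real) \<Rightarrow> real \<Rightarrow> real \<Rightarrow> 'a \<Rightarrow> 'a \<Rightarrow> complex" where
  "chirped_D A s c b y = complex_of_real (s * partial_deriv b A (s *\<^sub>R y))
    + \<i> * complex_of_real (2 * c * (y \<bullet> b) * A (s *\<^sub>R y))"

definition chirped_DD :: "('a::euclidean_space \<Rightarrow> real) \<Rightarrow> real \<Rightarrow> real \<Rightarrow> 'a \<Rightarrow> 'a \<Rightarrow> 'a \<Rightarrow> complex" where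
  "chirped_DD A s c b d y = complex_of_real (s * (s * partial_deriv d (partial_deriv b A) (s *\<^sub>R y)))
    + \<i> * complex_of_real (2 * c * ((y \<bullet> b) * (s * partial_deriv d A (s *\<^sub>R y)) + (d \<bullet> b) * A (s *\<^sub>R y)))
    + \<i> * complex_of_real (2 * c * (y \<bullet> d)) * chirped_D A s c b y"

lemma sum_Basis_inner_mult:
  fixes f :: "'a::euclidean_space \<Rightarrow> real"
  shows "b \<in> Basis \<Longrightarrow> (\<Sum>c\<in>Basis. ((s *\<^sub>R b) \<bullet> c) * f c) = s * f b"
  using sum_Basis_inner_scaleR[of b f] by (simp add: mult.assoc flip: sum_distrib_left)

context
  fixes A :: "'a::euclidean_space \<Rightarrow> real" and E :: complex and s c :: real and x0 :: 'a
  assumes A: "C2 A"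
begin

lemma scaled_has_derivative:
  fixes f :: "'a \<Rightarrow> real"
  assumes "C1 f"
  shows "((\<lambda>y. f (s *\<^sub>R y)) has_derivative
    (\<lambda>h. \<Sum>b\<in>Basis. ((s *\<^sub>R h) \<bullet> b) * partial_deriv b f (s *\<^sub>R y))) (at y)"
proof -
  have "((\<lambda>y. s *\<^sub>R y) has_derivative (\<lambda>h. s *\<^sub>R h)) (at y)" by (auto intro!: derivative_eq_intros)
  from C1_has_derivative_comp[OF assms this] show ?thesis by simp
qed

lemma chirped_has_derivative:
  "(chirped A E s c x0 has_derivative
    (\<lambda>h. E * (complex_of_real (\<Sum>b\<in>Basis. ((s *\<^sub>R h) \<bullet> b) * partial_deriv b A (s *\<^sub>R (x - x0)))
      + \<i> * complex_of_real (2 * c * ((x - x0) \<bullet> h)) * complex_of_real (A (s *\<^sub>R (x - x0))))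
      * chirp c (x - x0))) (at x)"
  unfolding chirped_def[abs_def]
  by (rule has_derivative_chirped[where G="\<lambda>y. complex_of_real (A (s *\<^sub>R y))",
        OF has_derivative_of_real_comp[OF scaled_has_derivative[OF C2_C1[OF A]]]])

lemma chirped_partial:
  assumes "b \<in> Basis"
  shows "partial_deriv b (chirped A E s c x0) = (\<lambda>x. E * chirped_D A s c b (x - x0) * chirp c (x - x0))"
  by (rule ext) (simp only: partial_deriv_eq[OF chirped_has_derivative] chirped_D_def
      sum_Basis_inner_mult[OF assms] of_real_mult mult.assoc)

lemma chirped_partial_has_derivative:
  assumes "b \<in> Basis"
  shows "(partial_deriv b (chirped A E s c x0) has_derivative
    (\<lambda>h. E * ((complex_of_real (s * (\<Sum>d\<in>Basis. ((s *\<^sub>R h) \<bullet> d) * partial_deriv d (partial_deriv b A) (s *\<^sub>R (x - x0))))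
        + \<i> * complex_of_real (2 * c * (((x - x0) \<bullet> b) * (\<Sum>d\<in>Basis. ((s *\<^sub>R h) \<bullet> d) * partial_deriv d A (s *\<^sub>R (x - x0)))
           + (h \<bullet> b) * A (s *\<^sub>R (x - x0)))))
      + \<i> * complex_of_real (2 * c * ((x - x0) \<bullet> h)) * chirped_D A s c b (x - x0))
      * chirp c (x - x0))) (at x)"
  unfolding chirped_partial[OF assms]
proof (rule has_derivative_chirped)
  let ?y = "x - x0"
  have i: "((\<lambda>y. y \<bullet> b) has_derivative (\<lambda>h. h \<bullet> b)) (at ?y)" by (auto intro!: derivative_eq_intros)
  have g: "((\<lambda>y. 2 * c * ((y \<bullet> b) * A (s *\<^sub>R y))) has_derivative
    (\<lambda>h. 2 * c * ((?y \<bullet> b) * (\<Sum>d\<in>Basis. ((s *\<^sub>R h) \<bullet> d) * partial_deriv d A (s *\<^sub>R ?y))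
           + (h \<bullet> b) * A (s *\<^sub>R ?y)))) (at ?y)"
    by (intro has_derivative_mult_right has_derivative_mult i scaled_has_derivative C2_C1 A)
  show "(chirped_D A s c b has_derivative
    (\<lambda>h. complex_of_real (s * (\<Sum>d\<in>Basis. ((s *\<^sub>R h) \<bullet> d) * partial_deriv d (partial_deriv b A) (s *\<^sub>R ?y)))
      + \<i> * complex_of_real (2 * c * ((?y \<bullet> b) * (\<Sum>d\<in>Basis. ((s *\<^sub>R h) \<bullet> d) * partial_deriv d A (s *\<^sub>R ?y))
           + (h \<bullet> b) * A (s *\<^sub>R ?y))))) (at ?y)"
    unfolding chirped_D_def[abs_def] mult.assoc[of "2 * c"]
    by (rule has_derivative_add[OF
          has_derivative_of_real_comp[OF has_derivative_mult_right[OF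
            scaled_has_derivative[OF C2_partial_C1[OF A assms]]]]
          has_derivative_mult_right[OF has_derivative_of_real_comp[OF g]]])
qed

lemma chirped_partial2:
  assumes "b \<in> Basis" "d \<in> Basis"
  shows "partial_deriv d (partial_deriv b (chirped A E s c x0))
    = (\<lambda>x. E * chirped_DD A s c b d (x - x0) * chirp c (x - x0))"
  by (rule ext) (simp only: partial_deriv_eq[OF chirped_partial_has_derivative[OF assms(1)]]
      chirped_DD_def sum_Basis_inner_mult[OF assms(2)])

lemma chirped_continuities:
  "continuous_on S A"
  "b \<in> Basis \<Longrightarrow> continuous_on S (partial_deriv b A)"
  "b \<in> Basis \<Longrightarrow> d \<in> Basis \<Longrightarrow> continuous_on S (partial_deriv d (partial_deriv b A))"
  using A C1_continuous_on C2_C1 C1_partial_continuous_on C2_partial_C1 by blast+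

lemma C2_chirped: "C2 (chirped A E s c x0)"
proof -
  note ci = continuous_on_compose2[OF chirped_continuities(1)[of UNIV]]
    continuous_on_compose2[OF chirped_continuities(2)[of _ UNIV]]
    continuous_on_compose2[OF chirped_continuities(3)[of _ _ UNIV]]
  have D: "continuous_on UNIV (\<lambda>x. chirped_D A s c b (x - x0))" if "b \<in> Basis" for b
    unfolding chirped_D_def by (intro continuous_intros ci that) auto
  have 1: "C1 (chirped A E s c x0)"
  proof (rule C1I[OF chirped_has_derivative])
    fix b :: 'a assume b: "b \<in> Basis"
    show "continuous_on UNIV (\<lambda>x. E * (complex_of_real (\<Sum>d\<in>Basis. ((s *\<^sub>R b) \<bullet> d) * partial_deriv d A (s *\<^sub>R (x - x0)))
      + \<i> * complex_of_real (2 * c * ((x - x0) \<bullet> b)) * complex_of_real (A (s *\<^sub>R (x - x0))))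
      * chirp c (x - x0))"
      unfolding sum_Basis_inner_mult[OF b] by (intro continuous_intros ci b) auto
  qed
  have "C1 (partial_deriv b (chirped A E s c x0))" if b: "b \<in> Basis" for b
  proof (rule C1I[OF chirped_partial_has_derivative[OF b]])
    fix d :: 'a assume d: "d \<in> Basis"
    show "continuous_on UNIV (\<lambda>x. E * ((complex_of_real (s * (\<Sum>e\<in>Basis. ((s *\<^sub>R d) \<bullet> e) * partial_deriv e (partial_deriv b A) (s *\<^sub>R (x - x0))))
        + \<i> * complex_of_real (2 * c * (((x - x0) \<bullet> b) * (\<Sum>e\<in>Basis. ((s *\<^sub>R d) \<bullet> e) * partial_deriv e A (s *\<^sub>R (x - x0)))
           + (d \<bullet> b) * A (s *\<^sub>R (x - x0)))))
      + \<i> * complex_of_real (2 * c * ((x - x0) \<bullet> d)) * chirped_D A s c b (x - x0))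
      * chirp c (x - x0))"
      unfolding sum_Basis_inner_mult[OF d] by (intro continuous_intros ci D b d) auto
  qed
  with 1 show ?thesis by (simp add: C2_def)
qed

text \<open>The groups are kept apart for the equation: the imaginary one has to cancel the time
  derivatives of the real amplitude and of the dilation, the last real one is compensated by the
  time derivative of the phase.\<close>

lemma chirped_laplacian:
  fixes x :: 'a
  defines "y \<equiv> x - x0"
  shows "laplacian (chirped A E s c x0) x = E * (complex_of_real (s\<^sup>2 * laplacian A (s *\<^sub>R y))
    + \<i> * complex_of_real (2 * c * (real DIM('a) * A (s *\<^sub>R y))
        + 4 * c * (s * (\<Sum>b\<in>Basis. (y \<bullet> b) * partial_deriv b A (s *\<^sub>R y))))
    - complex_of_real (4 * c\<^sup>2 * ((norm y)\<^sup>2 * A (s *\<^sub>R y)))) * chirp c y"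
proof -
  let ?a = "A (s *\<^sub>R y)"
  have DD: "chirped_DD A s c b b y
    = complex_of_real (s\<^sup>2 * partial_deriv b (partial_deriv b A) (s *\<^sub>R y))
      + \<i> * complex_of_real (2 * c * ?a + 4 * c * s * ((y \<bullet> b) * partial_deriv b A (s *\<^sub>R y)))
      - complex_of_real (4 * c\<^sup>2 * ((y \<bullet> b)\<^sup>2 * ?a))" if "b \<in> Basis" for b
    unfolding chirped_DD_def chirped_D_def using that
    by (simp add: complex_eq_iff algebra_simps power2_eq_square)
  have nn: "(\<Sum>b\<in>Basis. (y \<bullet> b)\<^sup>2) = (norm y)\<^sup>2"
    unfolding power2_norm_eq_inner euclidean_inner[of y y] by (simp add: power2_eq_square)
  have "(\<Sum>b\<in>Basis. chirped_DD A s c b b y)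
    = complex_of_real (\<Sum>b\<in>Basis. s\<^sup>2 * partial_deriv b (partial_deriv b A) (s *\<^sub>R y))
      + \<i> * complex_of_real (\<Sum>b\<in>(Basis::'a set). 2 * c * ?a + 4 * c * s * ((y \<bullet> b) * partial_deriv b A (s *\<^sub>R y)))
      - complex_of_real (\<Sum>b\<in>Basis. 4 * c\<^sup>2 * ((y \<bullet> b)\<^sup>2 * ?a))"
    unfolding of_real_sum sum_distrib_left sum.distrib[symmetric] sum_subtractf[symmetric]
    by (rule sum.cong[OF refl]) (simp only: DD)
  also have "(\<Sum>b\<in>Basis. s\<^sup>2 * partial_deriv b (partial_deriv b A) (s *\<^sub>R y)) = s\<^sup>2 * laplacian A (s *\<^sub>R y)"
    by (simp add: laplacian_def sum_distrib_left)
  also have "(\<Sum>b\<in>(Basis::'a set). 2 * c * ?a + 4 * c * s * ((y \<bullet> b) * partial_deriv b A (s *\<^sub>R y)))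
    = 2 * c * (real DIM('a) * ?a) + 4 * c * (s * (\<Sum>b\<in>Basis. (y \<bullet> b) * partial_deriv b A (s *\<^sub>R y)))"
    unfolding sum.distrib sum_distrib_left[symmetric] by simp
  also have "(\<Sum>b\<in>Basis. 4 * c\<^sup>2 * ((y \<bullet> b)\<^sup>2 * ?a)) = 4 * c\<^sup>2 * ((norm y)\<^sup>2 * ?a)"
    unfolding sum_distrib_left[symmetric] sum_distrib_right[symmetric] nn ..
  finally have sum: "(\<Sum>b\<in>Basis. chirped_DD A s c b b y) = complex_of_real (s\<^sup>2 * laplacian A (s *\<^sub>R y))
    + \<i> * complex_of_real (2 * c * (real DIM('a) * ?a)
        + 4 * c * (s * (\<Sum>b\<in>Basis. (y \<bullet> b) * partial_deriv b A (s *\<^sub>R y))))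
    - complex_of_real (4 * c\<^sup>2 * ((norm y)\<^sup>2 * ?a))" .
  have "laplacian (chirped A E s c x0) x = (\<Sum>b\<in>Basis. E * chirped_DD A s c b b y * chirp c y)"
    unfolding laplacian_def y_def by (intro sum.cong refl) (simp only: chirped_partial2)
  also have "\<dots> = E * (\<Sum>b\<in>Basis. chirped_DD A s c b b y) * chirp c y"
    by (simp add: sum_distrib_left sum_distrib_right)
  finally show ?thesis unfolding sum .
qed

lemma norm_chirped: "cmod (chirped A E s c x0 x) = cmod E * \<bar>A (s *\<^sub>R (x - x0))\<bar>"
  by (simp add: chirped_def norm_mult)

text \<open>\<open>A\<close> is real, so the two terms of \<open>chirped_D\<close> are its real and
  imaginary parts and no cross term arises; the gradient energy splits into a profile and a phase
  contribution.\<close>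

lemma norm_chirped_partial:
  assumes "b \<in> Basis"
  shows "(cmod (partial_deriv b (chirped A E s c x0) x))\<^sup>2 = (cmod E)\<^sup>2 *
    (s\<^sup>2 * (partial_deriv b A (s *\<^sub>R (x - x0)))\<^sup>2 + 4 * c\<^sup>2 * (((x - x0) \<bullet> b)\<^sup>2 * (A (s *\<^sub>R (x - x0)))\<^sup>2))"
proof -
  have "(cmod (chirped_D A s c b y))\<^sup>2
    = s\<^sup>2 * (partial_deriv b A (s *\<^sub>R y))\<^sup>2 + 4 * c\<^sup>2 * ((y \<bullet> b)\<^sup>2 * (A (s *\<^sub>R y))\<^sup>2)" for y
    unfolding chirped_D_def cmod_power2 by (simp add: power_mult_distrib)
  then show ?thesis by (simp add: chirped_partial[OF assms] norm_mult power_mult_distrib)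
qed

lemma grad_sq_chirped:
  "grad_sq (chirped A E s c x0) x = (cmod E)\<^sup>2 * (s\<^sup>2 * grad_sq A (s *\<^sub>R (x - x0))
    + 4 * c\<^sup>2 * ((norm (x - x0))\<^sup>2 * (A (s *\<^sub>R (x - x0)))\<^sup>2))"
proof -
  have nn: "(\<Sum>b\<in>Basis. ((x - x0) \<bullet> b)\<^sup>2) = (norm (x - x0))\<^sup>2"
    unfolding power2_norm_eq_inner euclidean_inner[of "x - x0" "x - x0"] by (simp add: power2_eq_square)
  have "grad_sq (chirped A E s c x0) x = (\<Sum>b\<in>Basis. (cmod E)\<^sup>2 *
    (s\<^sup>2 * (partial_deriv b A (s *\<^sub>R (x - x0)))\<^sup>2 + 4 * c\<^sup>2 * (((x - x0) \<bullet> b)\<^sup>2 * (A (s *\<^sub>R (x - x0)))\<^sup>2)))"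
    unfolding grad_sq_def by (rule sum.cong[OF refl]) (rule norm_chirped_partial)
  also have "\<dots> = (cmod E)\<^sup>2 * (s\<^sup>2 * grad_sq A (s *\<^sub>R (x - x0))
    + 4 * c\<^sup>2 * ((norm (x - x0))\<^sup>2 * (A (s *\<^sub>R (x - x0)))\<^sup>2))"
    unfolding sum_distrib_left[symmetric] sum.distrib sum_distrib_right[symmetric] nn by (simp add: grad_sq_def)
  finally show ?thesis .
qed

end

section \<open>Time derivative of the wave and the equation\<close>

lemma has_vector_derivative_cis:
  assumes "(g has_real_derivative g') (at t)"
  shows "((\<lambda>t. exp (\<i> * complex_of_real (g t))) has_vector_derivative
    \<i> * complex_of_real g' * exp (\<i> * complex_of_real (g t))) (at t)"
proof -
  have "((\<lambda>t. \<i> * complex_of_real (g t)) has_vector_derivative \<i> * complex_of_real g') (at t)"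
    by (intro has_vector_derivative_mult_right has_vector_derivative_of_real assms)
  from field_vector_diff_chain_at[OF this DERIV_exp] show ?thesis by (simp add: o_def)
qed

definition wave_amp :: "real \<Rightarrow> real \<Rightarrow> real \<Rightarrow> (real \<Rightarrow> real) \<Rightarrow> real \<Rightarrow> complex" where
  "wave_amp n \<gamma> \<theta> a t = complex_of_real (exp (- (n / 2) * (LBINT \<tau>=0..t. a \<tau>))) *
     exp (\<i> * complex_of_real (\<gamma> * (LBINT \<tau>=0..t. exp (- 2 * (LBINT \<tau>1=0..\<tau>. a \<tau>1))))) *
     exp (\<i> * complex_of_real \<theta>)"

lemma special_wave_chirped:
  "special_wave A0 \<gamma> x0 \<theta> a t
    = chirped A0 (wave_amp (real CARD('n)) \<gamma> \<theta> a t) (exp (- (LBINT \<tau>=0..t. a \<tau>))) (a t / 4) x0"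
  for A0 :: "real^'n \<Rightarrow> real"
  by (simp add: fun_eq_iff special_wave_def chirped_def wave_amp_def chirp_def mult_ac)

lemma norm_wave_amp: "cmod (wave_amp n \<gamma> \<theta> a t) = exp (- (n / 2) * (LBINT \<tau>=0..t. a \<tau>))"
  unfolding wave_amp_def by (simp add: norm_mult)

text \<open>With chirp and amplitude factored out, the imaginary part cancels because
  \<open>c = a / 4\<close>, and the real part is the profile equation at the dilated point combined
  with the equation for \<open>a\<close>.\<close>

lemma chirped_nls_solution:
  fixes A :: "'a::euclidean_space \<Rightarrow> real"
  assumes A: "C2 A" and nn: "\<And>x. 0 \<le> A x" and \<sigma>: "\<sigma> = 4 / real DIM('a)"
    and eq: "\<And>x. laplacian A x + A x powr (\<sigma> + 1) = (k * (norm x)\<^sup>2 + \<gamma>) * A x"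
    and a: "a_solution k I a"
  shows "nls_solution \<sigma> I (\<lambda>t. chirped A (wave_amp (real DIM('a)) \<gamma> \<theta> a t)
    (exp (- (LBINT \<tau>=0..t. a \<tau>))) (a t / 4) x0)"
proof -
  define n where "n = real DIM('a)"
  have n: "0 < n" by (simp add: n_def)
  define L where "L t = (LBINT \<tau>=0..t. a \<tau>)" for t :: real
  define s where "s t = exp (- L t)" for t
  define E where "E = wave_amp n \<gamma> \<theta> a"
  define c where "c t = a t / 4" for t
  define \<Psi> where "\<Psi> t = chirped A (E t) (s t) (c t) x0" for t
  \<comment> \<open>The derivative of \<open>c\<close>, with the equation for \<open>a\<close>
    inserted and its exponential written as \<open>s ^ 4\<close>.\<close>
  define c' where "c' t = (4 * k * s t ^ 4 - (a t)\<^sup>2) / 4" for t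
  define E' where "E' t = E t * (complex_of_real (- (n / 2 * a t)) + \<i> * complex_of_real (\<gamma> * (s t)\<^sup>2))" for t
  note I = a_solutionD(1-4)[OF a]
  have dL: "(L has_real_derivative a t) (at t)" if "t \<in> I" for t
    unfolding L_def[abs_def] by (rule a_solutionD(5)[OF a that])
  have s4: "exp (- 4 * L t) = s t ^ 4" for t
    unfolding s_def by (simp flip: exp_of_nat_mult)
  have s2: "exp (- 2 * L t) = (s t)\<^sup>2" for t
    unfolding s_def by (simp flip: exp_of_nat_mult)
  have dc: "(c has_real_derivative c' t) (at t)" if "t \<in> I" for t
    using DERIV_cdivide[OF a_solutionD(6)[OF a that], of 4]
    unfolding c_def[abs_def] c'_def L_def[symmetric] s4 .
  have ds: "(s has_real_derivative - (a t * s t)) (at t)" if "t \<in> I" for t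
    unfolding s_def[abs_def] using dL[OF that] by (auto intro!: derivative_eq_intros)
  have Lc: "continuous_on I L" by (intro continuous_at_imp_continuous_on ballI DERIV_isCont[OF dL])
  have sc: "continuous_on I s" by (intro continuous_at_imp_continuous_on ballI DERIV_isCont[OF ds])
  have cc: "continuous_on I c" by (intro continuous_at_imp_continuous_on ballI DERIV_isCont[OF dc])
  have dE: "(E has_vector_derivative E' t) (at t)" if t: "t \<in> I" for t
  proof -
    have "continuous_on I (\<lambda>t. exp (- 2 * L t))" by (intro continuous_intros Lc)
    from interval_integral_DERIV[OF I(1-3) this t]
    have dG: "((\<lambda>t. \<gamma> * (LBINT \<tau>=0..t. exp (- 2 * L \<tau>))) has_real_derivative \<gamma> * (s t)\<^sup>2) (at t)"
      unfolding s2 by (rule DERIV_cmult)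
    have "((\<lambda>t. exp (- (n / 2) * L t)) has_real_derivative exp (- (n / 2) * L t) * (- (n / 2) * a t)) (at t)"
      using dL[OF t] by (auto intro!: derivative_eq_intros)
    from has_vector_derivative_mult_left[OF has_vector_derivative_mult[OF has_vector_derivative_of_real[OF this]
        has_vector_derivative_cis[OF dG]], of "exp (\<i> * complex_of_real \<theta>)"]
    have "(E has_vector_derivative
      (complex_of_real (exp (- (n / 2) * L t)) *
        (\<i> * complex_of_real (\<gamma> * (s t)\<^sup>2) * exp (\<i> * complex_of_real (\<gamma> * (LBINT \<tau>=0..t. exp (- 2 * L \<tau>)))))
       + complex_of_real (exp (- (n / 2) * L t) * (- (n / 2) * a t)) *
        exp (\<i> * complex_of_real (\<gamma> * (LBINT \<tau>=0..t. exp (- 2 * L \<tau>))))) * exp (\<i> * complex_of_real \<theta>)) (at t)"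
      unfolding E_def wave_amp_def[abs_def] L_def .
    also have "(complex_of_real (exp (- (n / 2) * L t)) *
        (\<i> * complex_of_real (\<gamma> * (s t)\<^sup>2) * exp (\<i> * complex_of_real (\<gamma> * (LBINT \<tau>=0..t. exp (- 2 * L \<tau>)))))
       + complex_of_real (exp (- (n / 2) * L t) * (- (n / 2) * a t)) *
        exp (\<i> * complex_of_real (\<gamma> * (LBINT \<tau>=0..t. exp (- 2 * L \<tau>))))) * exp (\<i> * complex_of_real \<theta>) = E' t"
      unfolding E'_def E_def wave_amp_def L_def[symmetric] of_real_mult[of "exp _"]
      by (simp only: algebra_simps mult_minus_left mult_minus_right)
    finally show ?thesis .
  qed
  have Ec: "continuous_on I E"
    by (intro continuous_at_imp_continuous_on ballI has_vector_derivative_continuous[OF dE])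
  note Ac = chirped_continuities[OF A]
  have ac: "continuous_on I a" by (rule I(4))
  note ci = continuous_on_compose2[OF Ac(1)[of UNIV]]
    continuous_on_compose2[OF Ac(2)[of _ UNIV]] continuous_on_compose2[OF Ac(3)[of _ _ UNIV]]
    continuous_on_compose2[OF Ec continuous_on_fst[OF continuous_on_id]]
    continuous_on_compose2[OF sc continuous_on_fst[OF continuous_on_id]]
    continuous_on_compose2[OF cc continuous_on_fst[OF continuous_on_id]]
    continuous_on_compose2[OF ac continuous_on_fst[OF continuous_on_id]]
  \<comment> \<open>The time derivative in the variable \<open>y = x - x0\<close>; its terms stem
    from the amplitude, the dilation and the quadratic phase, in this order.\<close>
  define T where "T t y = E' t * complex_of_real (A (s t *\<^sub>R y)) * chirp (c t) y
    + E t * (complex_of_real (- (a t * s t) * (\<Sum>b\<in>Basis. (y \<bullet> b) * partial_deriv b A (s t *\<^sub>R y)))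
      + \<i> * complex_of_real (c' t * (norm y)\<^sup>2) * complex_of_real (A (s t *\<^sub>R y))) * chirp (c t) y" for t y
  have dT: "((\<lambda>t. \<Psi> t x) has_vector_derivative T t (x - x0)) (at t)" if t: "t \<in> I" for t x
  proof -
    let ?y = "x - x0"
    have "((\<lambda>t. s t *\<^sub>R ?y) has_derivative (\<lambda>h. (- (a t * s t) * h) *\<^sub>R ?y)) (at t)"
      using ds[OF t] unfolding has_field_derivative_def by (rule has_derivative_scaleR_left)
    from C1_has_derivative_comp[OF C2_C1[OF A] this]
    have dA: "((\<lambda>t. A (s t *\<^sub>R ?y)) has_real_derivative
      - (a t * s t) * (\<Sum>b\<in>Basis. (?y \<bullet> b) * partial_deriv b A (s t *\<^sub>R ?y))) (at t)"
      unfolding has_field_derivative_def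
      by (rule has_derivative_eq_rhs) (simp add: fun_eq_iff sum_distrib_left mult_ac sum_negf)
    have dchirp: "((\<lambda>t. chirp (c t) ?y) has_vector_derivative
      \<i> * complex_of_real (c' t * (norm ?y)\<^sup>2) * chirp (c t) ?y) (at t)"
      unfolding chirp_def by (intro has_vector_derivative_cis DERIV_cmult_right dc t)
    have "((\<lambda>t. \<Psi> t x) has_vector_derivative
      (E t * complex_of_real (A (s t *\<^sub>R ?y))) * (\<i> * complex_of_real (c' t * (norm ?y)\<^sup>2) * chirp (c t) ?y)
      + (E t * complex_of_real (- (a t * s t) * (\<Sum>b\<in>Basis. (?y \<bullet> b) * partial_deriv b A (s t *\<^sub>R ?y)))
         + E' t * complex_of_real (A (s t *\<^sub>R ?y))) * chirp (c t) ?y) (at t)"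
      unfolding \<Psi>_def chirped_def
      by (intro has_vector_derivative_mult dE[OF t] has_vector_derivative_of_real dA dchirp)
    then show ?thesis by (rule has_vector_derivative_eq_rhs) (simp add: T_def algebra_simps)
  qed
  have pde: "\<i> * T t (x - x0) + laplacian (\<Psi> t) x
    + complex_of_real (cmod (\<Psi> t x) powr \<sigma>) * \<Psi> t x = 0" if t: "t \<in> I" for t x
  proof -
    define y where "y = x - x0"
    define \<alpha> where "\<alpha> = A (s t *\<^sub>R y)"
    define X where "X = (\<Sum>b\<in>Basis. (y \<bullet> b) * partial_deriv b A (s t *\<^sub>R y))"
    have s: "0 < s t" by (simp add: s_def)
    have \<alpha>: "0 \<le> \<alpha>" using nn by (simp add: \<alpha>_def)
    \<comment> \<open>Criticality again: \<open>cmod (E t) powr \<sigma>\<close> is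
      \<open>exp (- 2 L) = s^2\<close>, the factor that dilation also gives the Laplacian.\<close>
    have cm: "cmod (\<Psi> t x) powr \<sigma> = (s t)\<^sup>2 * \<alpha> powr \<sigma>"
    proof -
      have "exp (- (n / 2) * L t) powr \<sigma> = exp (\<sigma> * (- (n / 2) * L t))" by (simp add: powr_def)
      also have "\<sigma> * (- (n / 2) * L t) = - 2 * L t" using n by (simp add: \<sigma> n_def[symmetric])
      finally have "exp (- (n / 2) * L t) powr \<sigma> = (s t)\<^sup>2" by (simp only: s2)
      moreover have "cmod (\<Psi> t x) = exp (- (n / 2) * L t) * \<alpha>"
        using \<alpha> unfolding \<Psi>_def norm_chirped[OF A] E_def norm_wave_amp L_def \<alpha>_def y_def by simp
      ultimately show ?thesis by (simp add: powr_mult)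
    qed
    have "\<alpha> powr (\<sigma> + 1) = \<alpha> powr \<sigma> * \<alpha> powr 1" by (rule powr_add)
    then have p1: "\<alpha> powr \<sigma> * \<alpha> = \<alpha> powr (\<sigma> + 1)" using \<alpha> by simp
    have lapA: "laplacian A (s t *\<^sub>R y) = (k * ((s t)\<^sup>2 * (norm y)\<^sup>2) + \<gamma>) * \<alpha> - \<alpha> powr \<sigma> * \<alpha>"
      using eq[of "s t *\<^sub>R y"] unfolding p1 by (simp add: \<alpha>_def[symmetric] power_mult_distrib)
    have lap: "laplacian (\<Psi> t) x = E t * (complex_of_real ((s t)\<^sup>2 * laplacian A (s t *\<^sub>R y))
      + \<i> * complex_of_real (2 * c t * (n * \<alpha>) + 4 * c t * (s t * X))
      - complex_of_real (4 * (c t)\<^sup>2 * ((norm y)\<^sup>2 * \<alpha>))) * chirp (c t) y"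
      unfolding \<Psi>_def chirped_laplacian[OF A] y_def[symmetric] \<alpha>_def[symmetric] X_def n_def ..
    have T: "T t y = E t * ((complex_of_real (- (n / 2 * a t)) + \<i> * complex_of_real (\<gamma> * (s t)\<^sup>2)) * complex_of_real \<alpha>
      + complex_of_real (- (a t * s t) * X) + \<i> * complex_of_real (c' t * (norm y)\<^sup>2) * complex_of_real \<alpha>) * chirp (c t) y"
      unfolding T_def E'_def \<alpha>_def[symmetric] X_def[symmetric] by (simp add: algebra_simps)
    have \<Psi>x: "\<Psi> t x = E t * complex_of_real \<alpha> * chirp (c t) y"
      by (simp add: \<Psi>_def chirped_def \<alpha>_def y_def)
    have "\<i> * ((complex_of_real (- (n / 2 * a t)) + \<i> * complex_of_real (\<gamma> * (s t)\<^sup>2)) * complex_of_real \<alpha>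
      + complex_of_real (- (a t * s t) * X) + \<i> * complex_of_real (c' t * (norm y)\<^sup>2) * complex_of_real \<alpha>)
      + (complex_of_real ((s t)\<^sup>2 * laplacian A (s t *\<^sub>R y))
      + \<i> * complex_of_real (2 * c t * (n * \<alpha>) + 4 * c t * (s t * X))
      - complex_of_real (4 * (c t)\<^sup>2 * ((norm y)\<^sup>2 * \<alpha>)))
      + complex_of_real ((s t)\<^sup>2 * \<alpha> powr \<sigma>) * complex_of_real \<alpha> = 0" (is "?Z = 0")
    proof (rule complex_eqI)
      have "Re ?Z = - (\<gamma> * (s t)\<^sup>2 * \<alpha>) - c' t * (norm y)\<^sup>2 * \<alpha> + (s t)\<^sup>2 * laplacian A (s t *\<^sub>R y)
        - 4 * (c t)\<^sup>2 * ((norm y)\<^sup>2 * \<alpha>) + (s t)\<^sup>2 * \<alpha> powr \<sigma> * \<alpha>"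
        by simp
      also have "\<dots> = 0"
        unfolding lapA c'_def c_def
        by (simp add: field_simps power2_eq_square power4_eq_xxxx)
      finally show "Re ?Z = Re 0" by simp
      show "Im ?Z = Im 0" by (simp add: c_def field_simps)
    qed
    moreover have "\<i> * (E t * B * chirp (c t) y) + E t * B' * chirp (c t) y
      + S * (E t * complex_of_real \<alpha> * chirp (c t) y)
      = E t * (\<i> * B + B' + S * complex_of_real \<alpha>) * chirp (c t) y" for B B' S
      by (simp add: algebra_simps)
    ultimately show ?thesis
      unfolding cm unfolding y_def[symmetric] T lap \<Psi>x by (simp only: mult_zero_left mult_zero_right)
  qed
  have "nls_solution \<sigma> I \<Psi>"
    unfolding nls_solution_def
  proof (intro conjI ballI exI[of _ "\<lambda>t x. T t (x - x0)"] allI)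
    show "C2 (\<Psi> t)" for t unfolding \<Psi>_def by (rule C2_chirped[OF A])
    show "continuous_on (I \<times> UNIV) (\<lambda>(t, x). \<Psi> t x)"
      unfolding \<Psi>_def chirped_def case_prod_beta by (intro continuous_intros ci) auto
    show "continuous_on (I \<times> UNIV) (\<lambda>(t, x). partial_deriv b (\<Psi> t) x)" if "b \<in> Basis" for b
      unfolding \<Psi>_def chirped_partial[OF A that] chirped_D_def case_prod_beta
      by (intro continuous_intros ci that) auto
    show "continuous_on (I \<times> UNIV) (\<lambda>(t, x). partial_deriv d (partial_deriv b (\<Psi> t)) x)"
      if "b \<in> Basis" "d \<in> Basis" for b d
      unfolding \<Psi>_def chirped_partial2[OF A that] chirped_DD_def chirped_D_def case_prod_beta
      by (intro continuous_intros ci that) auto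
    show "continuous_on (I \<times> UNIV) (\<lambda>(t, x). T t (x - x0))"
      unfolding T_def E'_def c'_def case_prod_beta by (intro continuous_intros ci) auto
  qed (use dT pde in auto)
  then show ?thesis unfolding \<Psi>_def E_def s_def c_def L_def n_def .
qed

section \<open>Functionals of the wave\<close>

definition wave ::
  "('a::euclidean_space \<Rightarrow> real) \<Rightarrow> real \<Rightarrow> real \<Rightarrow> (real \<Rightarrow> real) \<Rightarrow> 'a \<Rightarrow> real \<Rightarrow> 'a \<Rightarrow> complex" where
  "wave A \<gamma> \<theta> a x0 t = chirped A (wave_amp (real DIM('a)) \<gamma> \<theta> a t)
    (exp (- (LBINT \<tau>=0..t. a \<tau>))) (a t / 4) x0"

lemma special_wave_eq_wave: "special_wave A \<gamma> x0 \<theta> a = wave A \<gamma> \<theta> a x0"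
  by (simp add: fun_eq_iff special_wave_chirped wave_def)

lemma integral_dilate:
  fixes F :: "'a::euclidean_space \<Rightarrow> real"
  assumes "0 < s" "integrable lborel F"
  shows "integrable lborel (\<lambda>x. F (s *\<^sub>R (x - x0)))"
    and "(LINT x|lborel. F (s *\<^sub>R (x - x0))) = (LINT x|lborel. F x) / s ^ DIM('a)"
proof -
  have e: "s *\<^sub>R (x - x0) = - s *\<^sub>R x0 + s *\<^sub>R x" for x by (simp add: algebra_simps)
  show "integrable lborel (\<lambda>x. F (s *\<^sub>R (x - x0)))"
    and "(LINT x|lborel. F (s *\<^sub>R (x - x0))) = (LINT x|lborel. F x) / s ^ DIM('a)"
    unfolding e using lborel_has_integral_affine[of s F "- s *\<^sub>R x0"] assms by simp_all
qed

lemma continuous_in_L2I: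
  "continuous_on UNIV f \<Longrightarrow> integrable lborel (\<lambda>x. (norm (f x))\<^sup>2) \<Longrightarrow> in_L2 f"
  by (simp add: in_L2_def borel_measurable_continuous_onI)

text \<open>A nontrivial profile with the decay that gives the functionals a meaning. No sign of
  \<open>k\<close> is assumed; it is derived from the existence of such a profile.\<close>

locale profile =
  fixes A :: "'a::euclidean_space \<Rightarrow> real" and \<sigma> k \<gamma> :: real
  assumes \<sigma>: "\<sigma> = 4 / real DIM('a)"
    and C2: "C2 A"
    and nonneg: "\<And>x. 0 \<le> A x"
    and eq: "\<And>x. laplacian A x + A x powr (\<sigma> + 1) = (k * (norm x)\<^sup>2 + \<gamma>) * A x"
    and H1: "in_H1 A"
    and xL2: "in_L2 (\<lambda>x. A x *\<^sub>R x)"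
    and nz: "\<exists>x. A x \<noteq> 0"
begin

section \<open>Integrals of the profile\<close>

definition P :: real where "P = (LINT x|lborel. grad_sq A x)"
definition Q :: real where "Q = (LINT x|lborel. (norm x)\<^sup>2 * (A x)\<^sup>2)"
definition R :: real where "R = (LINT x|lborel. A x powr (\<sigma> + 2))"

lemma \<sigma>_pos: "0 < \<sigma>"
  by (simp add: \<sigma>)

lemma continuous: "continuous_on S A"
  using C2 C1_continuous_on C2_C1 by blast

lemma pos_somewhere: obtains p where "0 < A p"
  using nz nonneg by (metis less_le)

lemma integrable_sq: "integrable lborel (\<lambda>x. (A x)\<^sup>2)"
  using H1 by (simp add: in_H1_def in_L2_def)

lemma integrable_partial_sq: "b \<in> Basis \<Longrightarrow> integrable lborel (\<lambda>x. (partial_deriv b A x)\<^sup>2)"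
  using H1 by (simp add: in_H1_def in_L2_def)

lemma integrable_grad_sq: "integrable lborel (grad_sq A)"
  unfolding grad_sq_def[abs_def] by (simp add: integrable_partial_sq)

lemma integrable_moment: "integrable lborel (\<lambda>x. (norm x)\<^sup>2 * (A x)\<^sup>2)"
  using xL2 by (simp add: in_L2_def power_mult_distrib mult.commute)

lemma integrable_partial_moment:
  assumes "b \<in> Basis"
  shows "integrable lborel (\<lambda>x. (x \<bullet> b)\<^sup>2 * (A x)\<^sup>2)"
proof (rule Bochner_Integration.integrable_bound[OF integrable_moment])
  have "(\<lambda>x. (x \<bullet> b)\<^sup>2 * (A x)\<^sup>2) \<in> borel_measurable borel"
    by (intro borel_measurable_continuous_onI continuous_intros continuous)
  then show "(\<lambda>x. (x \<bullet> b)\<^sup>2 * (A x)\<^sup>2) \<in> borel_measurable lborel" by simp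
  show "AE x in lborel. norm ((x \<bullet> b)\<^sup>2 * (A x)\<^sup>2) \<le> norm ((norm x)\<^sup>2 * (A x)\<^sup>2)"
  proof (rule AE_I2)
    fix x :: 'a
    have "(x \<bullet> b)\<^sup>2 \<le> (norm x)\<^sup>2"
      using power_mono[OF Basis_le_norm[OF assms, of x] abs_ge_zero, of 2] by simp
    then show "norm ((x \<bullet> b)\<^sup>2 * (A x)\<^sup>2) \<le> norm ((norm x)\<^sup>2 * (A x)\<^sup>2)"
      by (simp add: abs_mult mult_right_mono)
  qed
qed

lemma k_nonneg: "0 \<le> k"
proof (rule ccontr)
  assume "\<not> 0 \<le> k"
  then have "A x = 0" for x using profile_eq_0_if_neg[OF C2 nonneg eq] by simp
  then show False using nz by blast
qed

lemma has_max_ex: "\<exists>m. has_max A m"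
proof -
  obtain p where "0 < A p" by (rule pos_somewhere)
  then show ?thesis
    using profile_has_max[OF C2 nonneg integrable_sq _ k_nonneg] eq unfolding \<sigma> by blast
qed

text \<open>A maximum \<open>m\<close> of \<open>A\<close> dominates the power by
  \<open>m powr \<sigma> * A^2\<close>, which is integrable.\<close>

lemma integrable_powr: "integrable lborel (\<lambda>x. A x powr (\<sigma> + 2))"
proof -
  obtain m where m: "\<And>x. A x \<le> m" using has_max_ex by (auto simp: has_max_def)
  have split: "A x powr (\<sigma> + 2) = A x powr \<sigma> * (A x)\<^sup>2" for x
  proof -
    have "A x powr (\<sigma> + 2) = A x powr \<sigma> * A x powr 2" by (rule powr_add)
    then show ?thesis using nonneg[of x] by simp
  qed
  show ?thesis
  proof (rule Bochner_Integration.integrable_bound)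
    show "integrable lborel (\<lambda>x. m powr \<sigma> * (A x)\<^sup>2)" using integrable_sq by simp
    have "continuous_on UNIV (\<lambda>x. A x powr (\<sigma> + 2))"
      by (rule continuous_on_powr') (use nonneg \<sigma>_pos continuous in \<open>auto intro: continuous_intros\<close>)
    then show "(\<lambda>x. A x powr (\<sigma> + 2)) \<in> borel_measurable lborel"
      by (simp add: borel_measurable_continuous_onI)
    show "AE x in lborel. norm (A x powr (\<sigma> + 2)) \<le> norm (m powr \<sigma> * (A x)\<^sup>2)"
    proof (rule AE_I2)
      fix x
      have "A x powr \<sigma> \<le> m powr \<sigma>" using \<sigma>_pos nonneg m by (intro powr_mono2) auto
      then have "A x powr \<sigma> * (A x)\<^sup>2 \<le> m powr \<sigma> * (A x)\<^sup>2" by (rule mult_right_mono) simp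
      then show "norm (A x powr (\<sigma> + 2)) \<le> norm (m powr \<sigma> * (A x)\<^sup>2)"
        unfolding split by (simp add: abs_mult)
    qed
  qed
qed

lemma pohozaev: "P - 2 / (\<sigma> + 2) * R = k * Q"
  unfolding P_def Q_def R_def
  by (rule pohozaev_identity[OF C2 nonneg \<sigma> eq integrable_sq integrable_grad_sq integrable_moment integrable_powr])

lemma Q_pos: "0 < Q"
proof -
  obtain p where p: "0 < A p" by (rule pos_somewhere)
  \<comment> \<open>The weight of the second moment vanishes at the origin, so a positive value
    elsewhere is wanted; continuity supplies one near 0.\<close>
  have "\<exists>p. p \<noteq> 0 \<and> 0 < A p"
  proof (cases "p = 0")
    case True
    have "open {x. 0 < A x}" by (rule open_Collect_less) (auto intro: continuous)
    then obtain e where e: "0 < e" "ball p e \<subseteq> {x. 0 < A x}" using p open_contains_ball by blast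
    obtain v :: 'a where v: "norm v = e / 2" using vector_choose_size[of "e / 2"] e by auto
    then have "v \<in> ball p e" "v \<noteq> 0" using e True by auto
    then show ?thesis using e by blast
  qed (use p in blast)
  then obtain p where "p \<noteq> 0" "0 < A p" by blast
  then show ?thesis unfolding Q_def
    by (intro integral_pos_if_pos_at[OF _ integrable_moment, where p=p] continuous_intros continuous) auto
qed

lemma R_pos: "0 < R"
proof -
  obtain p where "0 < A p" by (rule pos_somewhere)
  moreover have "continuous_on UNIV (\<lambda>x. A x powr (\<sigma> + 2))"
    by (rule continuous_on_powr') (use nonneg \<sigma>_pos continuous in \<open>auto intro: continuous_intros\<close>)
  ultimately show ?thesis unfolding R_def
    by (intro integral_pos_if_pos_at[OF _ integrable_powr, where p=p]) auto
qed

text \<open>Solved for \<open>P\<close>, the Pohozaev identity has a positive term from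
  \<open>R\<close> and the nonnegative \<open>k * Q\<close> on the right. The blow-up of the
  gradient rests on this positivity.\<close>

lemma P_pos: "0 < P"
  using pohozaev k_nonneg Q_pos R_pos \<sigma>_pos
  by (metis add_nonneg_pos add_pos_pos diff_add_cancel divide_pos_pos mult_nonneg_nonneg mult_pos_pos
      less_imp_le zero_less_numeral)

section \<open>Functionals of the wave along a solution of the equation for a\<close>

context
  fixes I a and x0 :: 'a and \<theta> :: real
  assumes a: "a_solution k I a"
begin

abbreviation q :: "real \<Rightarrow> real" where "q \<equiv> spread k (a 0)"
abbreviation N :: "real \<Rightarrow> real" where "N t \<equiv> a 0 + ((a 0)\<^sup>2 + 4 * k) * t"
abbreviation \<Psi> :: "real \<Rightarrow> 'a \<Rightarrow> complex" where "\<Psi> \<equiv> wave A \<gamma> \<theta> a x0"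

definition s :: "real \<Rightarrow> real" where "s t = exp (- (LBINT \<tau>=0..t. a \<tau>))"
definition E :: "real \<Rightarrow> complex" where "E t = wave_amp (real DIM('a)) \<gamma> \<theta> a t"

lemma \<Psi>_chirped: "\<Psi> t = chirped A (E t) (s t) (a t / 4) x0"
  by (simp add: wave_def E_def s_def)

lemma s_pos: "0 < s t"
  by (simp add: s_def)

lemma q_pos: "t \<in> I \<Longrightarrow> 0 < q t"
  unfolding a_solution_spread(1)[OF a, symmetric] by simp

lemma a_eq: "t \<in> I \<Longrightarrow> a t = N t / q t"
  using a_solution_spread(2)[OF a, of t] q_pos[of t] by (simp add: field_simps)

lemma s_sq: "t \<in> I \<Longrightarrow> (s t)\<^sup>2 = 1 / q t"
proof -
  assume t: "t \<in> I"
  have "(s t)\<^sup>2 = exp (- (2 * (LBINT \<tau>=0..t. a \<tau>)))"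
    unfolding s_def by (simp flip: exp_of_nat_mult)
  then show ?thesis unfolding exp_minus a_solution_spread(1)[OF a t] by (simp add: divide_inverse)
qed

text \<open>The discriminant identity of the quadratic \<open>q\<close>, whose derivative is
  \<open>2 * N\<close>; it lets the phase energy cancel the time dependence of the profile
  energy.\<close>

lemma N_sq: "(N t)\<^sup>2 = ((a 0)\<^sup>2 + 4 * k) * q t - 4 * k"
  by (simp add: spread_def power2_eq_square algebra_simps)

text \<open>The squared amplitude is the Jacobian of the dilation: the L2 norm is preserved in time,
  and quadratic integrals lose the factor \<open>s ^ n\<close> altogether.\<close>

lemma norm_E_sq: "(cmod (E t))\<^sup>2 = s t ^ DIM('a)"
  unfolding E_def norm_wave_amp s_def by (simp flip: exp_of_nat_mult)

lemma norm_E: "t \<in> I \<Longrightarrow> cmod (E t) = q t powr (- (real DIM('a) / 4))"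
proof -
  assume t: "t \<in> I"
  have "q t powr (- (real DIM('a) / 4)) = exp (- (real DIM('a) / 2) * (LBINT \<tau>=0..t. a \<tau>))"
    unfolding a_solution_spread(1)[OF a t, symmetric] powr_def by simp
  then show ?thesis by (simp add: E_def norm_wave_amp)
qed

text \<open>Criticality in the form \<open>\<sigma> n / 2 = 2\<close>: besides the Jacobian the
  potential term gains \<open>s^2\<close>, exactly as the squared gradient of the profile
  does.\<close>

lemma norm_E_powr: "cmod (E t) powr (\<sigma> + 2) = (s t)\<^sup>2 * s t ^ DIM('a)"
proof -
  have "cmod (E t) powr (\<sigma> + 2) = cmod (E t) powr \<sigma> * cmod (E t) powr 2" by (rule powr_add)
  also have "cmod (E t) powr 2 = s t ^ DIM('a)" unfolding norm_E_sq[symmetric] by simp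
  also have "cmod (E t) powr \<sigma> = (s t)\<^sup>2"
  proof -
    have "cmod (E t) powr \<sigma> = exp (\<sigma> * (- (real DIM('a) / 2) * (LBINT \<tau>=0..t. a \<tau>)))"
      by (simp add: E_def norm_wave_amp powr_def)
    also have "\<sigma> * (- (real DIM('a) / 2) * (LBINT \<tau>=0..t. a \<tau>)) = real 2 * (- (LBINT \<tau>=0..t. a \<tau>))"
      by (simp add: \<sigma>)
    finally show ?thesis unfolding s_def exp_of_nat_mult .
  qed
  finally show ?thesis .
qed

lemma norm_\<Psi>: "cmod (\<Psi> t x) = cmod (E t) * A (s t *\<^sub>R (x - x0))"
  unfolding \<Psi>_chirped norm_chirped[OF C2] using nonneg by simp

lemmas dil = integral_dilate[OF s_pos, of _ _ x0]

lemma moment_integral: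
  "integrable lborel (\<lambda>x. (cmod (\<Psi> t x))\<^sup>2 * (norm (x - x0))\<^sup>2)"
  "t \<in> I \<Longrightarrow> second_moment x0 (\<Psi> t) = Q * q t"
proof -
  have e: "(cmod (\<Psi> t x))\<^sup>2 * (norm (x - x0))\<^sup>2 = s t ^ DIM('a) / (s t)\<^sup>2 *
    ((norm (s t *\<^sub>R (x - x0)))\<^sup>2 * (A (s t *\<^sub>R (x - x0)))\<^sup>2)" for x
    using s_pos[of t] by (simp add: norm_\<Psi> power_mult_distrib norm_E_sq)
  show "integrable lborel (\<lambda>x. (cmod (\<Psi> t x))\<^sup>2 * (norm (x - x0))\<^sup>2)"
    unfolding e using dil(1)[OF integrable_moment, of t] by simp
  show "second_moment x0 (\<Psi> t) = Q * q t" if "t \<in> I"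
  proof -
    have "second_moment x0 (\<Psi> t) = s t ^ DIM('a) / (s t)\<^sup>2 * (Q / s t ^ DIM('a))"
      unfolding second_moment_def e Q_def dil(2)[OF integrable_moment, of t, symmetric] by simp
    then show ?thesis using s_pos[of t] s_sq[OF that] q_pos[OF that] by simp
  qed
qed

text \<open>The first summand is the gradient of the dilated profile; the second is that of the
  quadratic phase and therefore a multiple of the second moment.\<close>

lemma grad_integral:
  assumes t: "t \<in> I"
  shows "(LINT x|lborel. grad_sq (\<Psi> t) x) = P / q t + (N t)\<^sup>2 * Q / (4 * q t)"
proof -
  have e: "grad_sq (\<Psi> t) x = s t ^ DIM('a) * (s t)\<^sup>2 * grad_sq A (s t *\<^sub>R (x - x0))
    + s t ^ DIM('a) * ((a t)\<^sup>2 / 4) / (s t)\<^sup>2 * ((norm (s t *\<^sub>R (x - x0)))\<^sup>2 * (A (s t *\<^sub>R (x - x0)))\<^sup>2)" for x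
    unfolding \<Psi>_chirped grad_sq_chirped[OF C2] norm_E_sq norm_scaleR
    using s_pos[of t] by (simp add: power_mult_distrib power_divide field_simps)
  have "(LINT x|lborel. grad_sq (\<Psi> t) x) = s t ^ DIM('a) * (s t)\<^sup>2 * (P / s t ^ DIM('a))
    + s t ^ DIM('a) * ((a t)\<^sup>2 / 4) / (s t)\<^sup>2 * (Q / s t ^ DIM('a))"
    unfolding e P_def Q_def dil(2)[OF integrable_moment, of t, symmetric]
      dil(2)[OF integrable_grad_sq, of t, symmetric]
    using dil(1)[OF integrable_moment, of t] dil(1)[OF integrable_grad_sq, of t]
    by (subst Bochner_Integration.integral_add) auto
  also have "\<dots> = (s t)\<^sup>2 * P + (a t)\<^sup>2 / 4 / (s t)\<^sup>2 * Q" using s_pos[of t] by simp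
  also have "\<dots> = P / q t + (N t)\<^sup>2 * Q / (4 * q t)"
    unfolding s_sq[OF t] a_eq[OF t] using q_pos[OF t] by (simp add: field_simps power2_eq_square)
  finally show ?thesis .
qed

lemma powr_integral:
  "integrable lborel (\<lambda>x. cmod (\<Psi> t x) powr (\<sigma> + 2))"
  "t \<in> I \<Longrightarrow> (LINT x|lborel. cmod (\<Psi> t x) powr (\<sigma> + 2)) = R / q t"
proof -
  have e: "cmod (\<Psi> t x) powr (\<sigma> + 2) = (s t)\<^sup>2 * s t ^ DIM('a) * A (s t *\<^sub>R (x - x0)) powr (\<sigma> + 2)" for x
    unfolding norm_\<Psi> powr_mult norm_E_powr ..
  show "integrable lborel (\<lambda>x. cmod (\<Psi> t x) powr (\<sigma> + 2))"
    unfolding e using dil(1)[OF integrable_powr, of t] by simp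
  show "(LINT x|lborel. cmod (\<Psi> t x) powr (\<sigma> + 2)) = R / q t" if "t \<in> I"
  proof -
    have "(LINT x|lborel. cmod (\<Psi> t x) powr (\<sigma> + 2)) = (s t)\<^sup>2 * s t ^ DIM('a) * (R / s t ^ DIM('a))"
      unfolding e R_def dil(2)[OF integrable_powr, of t, symmetric] by simp
    then show ?thesis using s_pos[of t] s_sq[OF that] by simp
  qed
qed

text \<open>The Pohozaev identity turns the profile part into \<open>k Q / q\<close>, and by
  \<open>N_sq\<close> the phase part is a constant minus just this.\<close>

lemma energy_\<Psi>: "t \<in> I \<Longrightarrow> energy \<sigma> (\<Psi> t) = Q * ((a 0)\<^sup>2 + 4 * k) / 4"
proof -
  assume t: "t \<in> I"
  have "energy \<sigma> (\<Psi> t) = (P - 2 / (\<sigma> + 2) * R) / q t + (N t)\<^sup>2 * Q / (4 * q t)"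
    unfolding energy_def grad_integral[OF t] powr_integral(2)[OF t] by (simp add: diff_divide_distrib)
  also have "\<dots> = Q * ((a 0)\<^sup>2 + 4 * k) / 4"
    unfolding pohozaev N_sq using q_pos[OF t] by (simp add: field_simps)
  finally show ?thesis .
qed

text \<open>With the next lemma and the integrability of the power this ensures that the integrals
  in \<open>energy\<close> and \<open>second_moment\<close> are genuine, not the default value 0 of
  a non-integrable function.\<close>

lemma \<Psi>_in_H1: "in_H1 (\<Psi> t)"
proof -
  have c2: "C2 (\<Psi> t)" unfolding \<Psi>_chirped by (rule C2_chirped[OF C2])
  have "in_L2 (\<Psi> t)"
  proof (rule continuous_in_L2I[OF C1_continuous_on[OF C2_C1[OF c2]]])
    have "(norm (\<Psi> t x))\<^sup>2 = (cmod (E t))\<^sup>2 * (A (s t *\<^sub>R (x - x0)))\<^sup>2" for x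
      by (simp add: norm_\<Psi> power_mult_distrib)
    then show "integrable lborel (\<lambda>x. (norm (\<Psi> t x))\<^sup>2)" using dil(1)[OF integrable_sq, of t] by simp
  qed
  moreover have "in_L2 (partial_deriv b (\<Psi> t))" if b: "b \<in> Basis" for b
  proof (rule continuous_in_L2I[OF C1_partial_continuous_on[OF C2_C1[OF c2] b]])
    have "(norm (partial_deriv b (\<Psi> t) x))\<^sup>2 = (cmod (E t))\<^sup>2 * ((s t)\<^sup>2 * (partial_deriv b A (s t *\<^sub>R (x - x0)))\<^sup>2
      + 4 * (a t / 4)\<^sup>2 / (s t)\<^sup>2 * (((s t *\<^sub>R (x - x0)) \<bullet> b)\<^sup>2 * (A (s t *\<^sub>R (x - x0)))\<^sup>2))" for x
      unfolding \<Psi>_chirped norm_chirped_partial[OF C2 b] using s_pos[of t] by (simp add: power_mult_distrib)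
    then show "integrable lborel (\<lambda>x. (norm (partial_deriv b (\<Psi> t) x))\<^sup>2)"
      using dil(1)[OF integrable_partial_sq[OF b], of t] dil(1)[OF integrable_partial_moment[OF b], of t]
      by simp
  qed
  ultimately show ?thesis by (simp add: in_H1_def)
qed

lemma \<Psi>_moment_in_L2: "in_L2 (\<lambda>x. norm (x - x0) *\<^sub>R \<Psi> t x)"
proof (rule continuous_in_L2I)
  have c2: "C2 (\<Psi> t)" unfolding \<Psi>_chirped by (rule C2_chirped[OF C2])
  show "continuous_on UNIV (\<lambda>x. norm (x - x0) *\<^sub>R \<Psi> t x)"
    by (intro continuous_intros C1_continuous_on[OF C2_C1[OF c2]])
  show "integrable lborel (\<lambda>x. (norm (norm (x - x0) *\<^sub>R \<Psi> t x))\<^sup>2)"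
    using moment_integral(1)[of t] by (simp add: power_mult_distrib mult.commute)
qed

lemma deriv_moment: "t \<in> I \<Longrightarrow> deriv (\<lambda>t. second_moment x0 (\<Psi> t)) t = 2 * Q * N t"
proof (rule DERIV_imp_deriv)
  assume t: "t \<in> I"
  have "((\<lambda>t. Q * q t) has_real_derivative 2 * Q * N t) (at t)"
    unfolding spread_def by (auto intro!: derivative_eq_intros simp: algebra_simps power2_eq_square)
  \<comment> \<open>The moment formula is available only on \<open>I\<close>, so the derivative of
    \<open>Q * q\<close> is transferred on this open set.\<close>
  then show "((\<lambda>t. second_moment x0 (\<Psi> t)) has_real_derivative 2 * Q * N t) (at t)"
    by (rule has_field_derivative_transform_within_open[OF _ a_solutionD(1)[OF a] t])
      (simp add: moment_integral(2))
qed

lemma \<Psi>_has_max: "t \<in> I \<Longrightarrow> has_max A m \<Longrightarrow>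
  has_max (\<lambda>x. cmod (\<Psi> t x)) (m * q t powr (- (real DIM('a) / 4)))"
proof -
  assume t: "t \<in> I" and m: "has_max A m"
  then obtain z where z: "A z = m" and le: "\<And>x. A x \<le> m" by (auto simp: has_max_def)
  have "cmod (\<Psi> t (x0 + (1 / s t) *\<^sub>R z)) = m * q t powr (- (real DIM('a) / 4))"
    using s_pos[of t] by (simp add: norm_\<Psi> norm_E[OF t] z)
  moreover have "cmod (\<Psi> t x) \<le> m * q t powr (- (real DIM('a) / 4))" for x
    unfolding norm_\<Psi> norm_E[OF t] by (subst mult.commute) (intro mult_right_mono le, simp)
  ultimately show ?thesis unfolding has_max_def by blast
qed

end

end

section \<open>The wave in terms of its second moment, and collapse for k = 0\<close>

context profile
begin

context
  fixes I a and x0 :: 'a and \<theta> :: real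
  assumes a: "a_solution k I a"
begin

text \<open>Everything follows from \<open>M = Q * exp (2 L)\<close> on \<open>I\<close>: the
  quotient \<open>M 0 / M t\<close> is the squared dilation, and the logarithmic derivative of
  \<open>M\<close> is \<open>2 a\<close>.\<close>

lemma wave_eq_wave_M:
  assumes t: "t \<in> I"
  defines "M \<equiv> \<lambda>t. second_moment x0 (wave A \<gamma> \<theta> a x0 t)"
  shows "wave A \<gamma> \<theta> a x0 t x =
     complex_of_real ((M 0 / M t) powr (real DIM('a) / 4)) *
     complex_of_real (A (((M 0 / M t) powr (1/2)) *\<^sub>R (x - x0))) *
     exp (\<i> * complex_of_real (deriv M t / (8 * M t) * (norm (x - x0))\<^sup>2)) *
     exp (\<i> * complex_of_real (\<gamma> * M 0 * (LBINT \<tau>=0..t. 1 / M \<tau>))) *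
     exp (\<i> * complex_of_real \<theta>)"
proof -
  let ?q = "spread k (a 0)"
  define L where "L t = (LBINT \<tau>=0..t. a \<tau>)" for t :: real
  have 0: "0 \<in> I" by (rule a_solutionD(3)[OF a])
  have M: "M t = Q * ?q t" if "t \<in> I" for t unfolding M_def by (rule moment_integral(2)[OF a that])
  have M0: "M 0 = Q" using M[OF 0] by simp
  have q: "?q t = exp (2 * L t)" if "t \<in> I" for t
    unfolding L_def by (rule a_solution_spread(1)[OF a that, symmetric])
  have ratio: "M 0 / M t = exp (- 2 * L t)"
    unfolding M0 M[OF t] q[OF t] using Q_pos by (simp add: exp_minus divide_inverse)
  have r1: "(M 0 / M t) powr (real DIM('a) / 4) = exp (- (real DIM('a) / 2) * L t)"
    unfolding ratio powr_def by simp
  have r2: "(M 0 / M t) powr (1 / 2) = exp (- L t)" unfolding ratio powr_def by simp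
  have r3: "deriv M t / (8 * M t) = a t / 4"
  proof -
    have "deriv M t = 2 * Q * (a t * ?q t)"
      using deriv_moment[OF a t, of x0 \<theta>] unfolding M_def[symmetric] a_solution_spread(2)[OF a t] .
    then show ?thesis unfolding M[OF t] using Q_pos q_pos[OF a t] by simp
  qed
  have "(LBINT \<tau>=0..t. 1 / M \<tau>) = (LBINT \<tau>=0..t. (1 / Q) * exp (- 2 * L \<tau>))"
  \<comment> \<open>The integral sees only times between 0 and \<open>t\<close>; they lie in the
    interval \<open>I\<close>, where the formula for \<open>M\<close> holds.\<close>
  proof (rule interval_integral_cong)
    fix \<tau> assume "\<tau> \<in> einterval (min 0 (ereal t)) (max 0 (ereal t))"
    then have "0 \<le> \<tau> \<and> \<tau> \<le> t \<or> t \<le> \<tau> \<and> \<tau> \<le> 0"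
      by (auto simp: einterval_def min_def max_def split: if_splits)
    then have "\<tau> \<in> I"
      using mem_is_interval_1_I[OF a_solutionD(2)[OF a] 0 t] mem_is_interval_1_I[OF a_solutionD(2)[OF a] t 0]
      by blast
    then show "1 / M \<tau> = (1 / Q) * exp (- 2 * L \<tau>)"
      by (simp add: M q exp_minus divide_inverse)
  qed
  then have r4: "\<gamma> * M 0 * (LBINT \<tau>=0..t. 1 / M \<tau>) = \<gamma> * (LBINT \<tau>=0..t. exp (- 2 * L \<tau>))"
    using Q_pos by (simp add: M0)
  show ?thesis
    unfolding r1 r2 r3 r4 wave_def chirped_def wave_amp_def chirp_def L_def by (simp add: mult_ac)
qed

text \<open>For \<open>k = 0\<close> the square of \<open>N\<close> is \<open>(a 0)^2 * q\<close>,
  so the gradient integral is a constant plus \<open>P / q\<close>, while the moment is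
  \<open>Q * q\<close>; at the endpoint \<open>q\<close> tends to 0 through positive values.\<close>

lemma blows_up_at_zero_of_spread:
  assumes k: "k = 0" and \<alpha>: "a 0 \<noteq> 0" and I: "I = {t. 0 < 1 + a 0 * t}"
  shows "blows_up_at I (wave A \<gamma> \<theta> a x0) x0 (- 1 / a 0)"
proof -
  let ?T = "- 1 / a 0"
  let ?q = "spread k (a 0)"
  \<comment> \<open>The sign of \<open>a 0\<close> decides on which side of \<open>?T\<close> the
    half-line lies; for \<open>0 < a 0\<close> the collapse is in the past.\<close>
  have "I = {?T<..} \<or> I = {..<?T}"
  proof (cases "0 < a 0")
    case True then have "I = {?T<..}" unfolding I by (auto simp: field_simps)
    then show ?thesis ..
  next
    case False
    then have "a 0 < 0" using \<alpha> by simp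
    then have "I = {..<?T}" unfolding I by (auto simp: field_simps)
    then show ?thesis ..
  qed
  then have fr: "?T \<in> frontier I" by (auto simp: frontier_def interior_open)
  have ev: "\<forall>\<^sub>F t in at ?T within I. t \<in> I" by (simp add: eventually_at_filter)
  have "(?q \<longlongrightarrow> ?q ?T) (at ?T within I)"
  proof (rule tendsto_within_subset)
    show "(?q \<longlongrightarrow> ?q ?T) (at ?T)"
      using spread_continuous_on[of UNIV k "a 0"] by (simp add: continuous_on_eq_continuous_at isCont_def)
  qed simp
  moreover have "?q ?T = 0" using \<alpha> by (simp add: spread_def k)
  ultimately have q0: "(?q \<longlongrightarrow> 0) (at ?T within I)" by simp
  have qp: "\<forall>\<^sub>F t in at ?T within I. 0 < ?q t"
    using ev by eventually_elim (rule q_pos[OF a])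
  have "filterlim (\<lambda>t. Q * (a 0)\<^sup>2 / 4 + P * inverse (?q t)) at_top (at ?T within I)"
    by (intro filterlim_tendsto_add_at_top[OF tendsto_const] filterlim_tendsto_pos_mult_at_top[OF tendsto_const P_pos]
        filterlim_inverse_at_top q0 qp)
  moreover have "\<forall>\<^sub>F t in at ?T within I. Q * (a 0)\<^sup>2 / 4 + P * inverse (?q t)
    = (LINT x|lborel. grad_sq (wave A \<gamma> \<theta> a x0 t) x)"
    using ev
  proof eventually_elim
    fix t assume t: "t \<in> I"
    have N: "(a 0 + ((a 0)\<^sup>2 + 4 * k) * t)\<^sup>2 = (a 0)\<^sup>2 * ?q t"
      by (simp add: spread_def k power2_eq_square algebra_simps)
    show "Q * (a 0)\<^sup>2 / 4 + P * inverse (?q t) = (LINT x|lborel. grad_sq (wave A \<gamma> \<theta> a x0 t) x)"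
      unfolding grad_integral[OF a t] N using q_pos[OF a t] by (simp add: field_simps)
  qed
  ultimately have 1: "filterlim (\<lambda>t. LINT x|lborel. grad_sq (wave A \<gamma> \<theta> a x0 t) x) at_top (at ?T within I)"
    by (rule filterlim_mono_eventually[OF _ order_refl order_refl])
  have "((\<lambda>t. Q * ?q t) \<longlongrightarrow> Q * 0) (at ?T within I)" by (intro tendsto_intros q0)
  moreover have "\<forall>\<^sub>F t in at ?T within I. Q * ?q t = second_moment x0 (wave A \<gamma> \<theta> a x0 t)"
    using ev by eventually_elim (simp add: moment_integral(2)[OF a])
  ultimately have "((\<lambda>t. second_moment x0 (wave A \<gamma> \<theta> a x0 t)) \<longlongrightarrow> 0) (at ?T within I)"
    by (simp add: tendsto_cong)
  with fr 1 show ?thesis unfolding blows_up_at_def by blast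
qed

end

end

text \<open>\<open>\<alpha>^2 + 4 k\<close> is the leading coefficient of the quadratic, so its
  quotient by \<open>(\<alpha>^2 + 4 k) t^2\<close> tends to 1. The constant term 1 prevents an
  exact identity.\<close>

lemma spread_powr_asymp_equiv:
  assumes k: "0 < k"
  shows "(\<lambda>t. spread k \<alpha> t powr (- (p / 4))) \<sim>[at_top]
    (\<lambda>t. (1 / (\<alpha>\<^sup>2 + 4 * k)) powr (p / 4) * t powr (- p / 2))"
proof -
  define c where "c = \<alpha>\<^sup>2 + 4 * k"
  have c: "0 < c" unfolding c_def using k by (intro add_nonneg_pos) auto
  have "((\<lambda>t. 1 + 2 * \<alpha> / c * inverse t + 1 / c * (inverse t)\<^sup>2) \<longlongrightarrow> 1 + 2 * \<alpha> / c * 0 + 1 / c * 0\<^sup>2) at_top"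
    by (intro tendsto_intros tendsto_inverse_0_at_top filterlim_ident)
  moreover have "\<forall>\<^sub>F t in at_top. 1 + 2 * \<alpha> / c * inverse t + 1 / c * (inverse t)\<^sup>2 = spread k \<alpha> t / (c * t\<^sup>2)"
    using eventually_gt_at_top[of 0]
  proof eventually_elim
    fix t :: real assume "0 < t"
    have "spread k \<alpha> t = 1 + 2 * \<alpha> * t + c * t\<^sup>2"
      by (simp add: spread_def c_def power2_eq_square algebra_simps)
    then show "1 + 2 * \<alpha> / c * inverse t + 1 / c * (inverse t)\<^sup>2 = spread k \<alpha> t / (c * t\<^sup>2)"
      using c \<open>0 < t\<close> by (simp add: field_simps power2_eq_square)
  qed
  ultimately have "((\<lambda>t. spread k \<alpha> t / (c * t\<^sup>2)) \<longlongrightarrow> 1) at_top"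
    by (simp add: tendsto_cong)
  then have e: "spread k \<alpha> \<sim>[at_top] (\<lambda>t. c * t\<^sup>2)" by (rule asymp_equivI')
  have A: "(\<lambda>t. spread k \<alpha> t powr (- (p / 4))) \<sim>[at_top] (\<lambda>t. (c * t\<^sup>2) powr (- (p / 4)))"
    by (rule asymp_equiv_powr_real[OF e]) (use c k in \<open>simp_all add: spread_def\<close>)
  have B: "\<forall>\<^sub>F t in at_top. (c * t\<^sup>2) powr (- (p / 4)) = (1 / c) powr (p / 4) * t powr (- p / 2)"
    using eventually_gt_at_top[of 0]
  proof eventually_elim
    fix t :: real assume t: "0 < t"
    have "(t\<^sup>2) powr (- (p / 4)) = t powr (- p / 2)" using t by (simp add: power_powr)
    moreover have "c powr (- (p / 4)) = (1 / c) powr (p / 4)"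
      unfolding powr_minus_divide using c by (simp add: powr_divide)
    ultimately show "(c * t\<^sup>2) powr (- (p / 4)) = (1 / c) powr (p / 4) * t powr (- p / 2)"
      by (simp add: powr_mult)
  qed
  show ?thesis
    unfolding c_def[symmetric] using A by (rule iffD1[OF asymp_equiv_cong[OF _ B], rotated]) simp
qed

text \<open>The rate is exact because \<open>spread 0 \<alpha>\<close> is \<open>\<alpha>^2\<close>
  times the squared distance from \<open>t\<close> to its double root
  \<open>- 1 / \<alpha>\<close>.\<close>

lemma spread_powr_critical:
  assumes \<alpha>: "\<alpha> \<noteq> 0" and t: "0 < 1 + \<alpha> * t"
  shows "spread 0 \<alpha> t powr (- (p / 4)) = (1 / \<alpha>\<^sup>2) powr (p / 4) * \<bar>- 1 / \<alpha> - t\<bar> powr (- p / 2)"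
proof -
  have "\<bar>- 1 / \<alpha> - t\<bar> = \<bar>(1 + \<alpha> * t) / \<alpha>\<bar>"
    using \<alpha> by (subst abs_minus_cancel[symmetric]) (simp add: field_simps)
  also have "\<dots> = (1 + \<alpha> * t) / \<bar>\<alpha>\<bar>" using t by (simp add: abs_divide)
  finally have d: "\<bar>- 1 / \<alpha> - t\<bar> = (1 + \<alpha> * t) / \<bar>\<alpha>\<bar>" .
  have 1: "spread 0 \<alpha> t powr (- (p / 4)) = (1 + \<alpha> * t) powr (- p / 2)"
    using power_powr[OF t, of 2 "- (p / 4)"] by (simp add: spread_def)
  have "(1 / \<alpha>\<^sup>2) powr (p / 4) = ((1 / \<bar>\<alpha>\<bar>) ^ 2) powr (p / 4)" by (simp add: power_divide)
  also have "\<dots> = (1 / \<bar>\<alpha>\<bar>) powr (p / 2)" using power_powr[of "1 / \<bar>\<alpha>\<bar>" 2 "p / 4"] \<alpha> by simp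
  finally have 2: "(1 / \<alpha>\<^sup>2) powr (p / 4) = (1 / \<bar>\<alpha>\<bar>) powr (p / 2)" .
  have 3: "((1 + \<alpha> * t) / \<bar>\<alpha>\<bar>) powr (- p / 2) = (1 + \<alpha> * t) powr (- p / 2) * (1 / \<bar>\<alpha>\<bar>) powr (- p / 2)"
    by (simp flip: powr_mult)
  have "(1 / \<bar>\<alpha>\<bar>) powr (p / 2) * (1 / \<bar>\<alpha>\<bar>) powr (- p / 2) = 1" using \<alpha> by (simp flip: powr_add)
  then show ?thesis unfolding 1 2 d 3 by (simp add: mult.left_commute)
qed

section \<open>Decay, blow-up times and rates for maximal solutions\<close>

context profile
begin

text \<open>The denominators \<open>8 * H\<close> come from the roots of
  \<open>4 H t^2 + M1 t + M 0\<close>; for \<open>H < 0\<close> the positive root also carries the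
  minus sign in front of the square root. By \<open>k_nonneg\<close> the case
  \<open>k \<le> 0\<close> is \<open>k = 0\<close>, where \<open>K = 0\<close>,
  \<open>H = Q (a 0)^2 / 4\<close> and \<open>M1 = 2 Q a 0\<close>: the only candidate for
  \<open>T\<close> is \<open>- 1 / a 0\<close>, and \<open>H = M1 = 0\<close> means
  \<open>a 0 = 0\<close>.\<close>

lemma maximal_wave:
  fixes x0 :: 'a and \<theta> :: real
  assumes max: "maximal_a_solution k I a" and Ap: "has_max A Ap"
  defines "\<Phi> \<equiv> wave A \<gamma> \<theta> a x0"
  defines "M \<equiv> \<lambda>t. second_moment x0 (\<Phi> t)"
  defines "M1 \<equiv> deriv M 0"
  defines "H \<equiv> energy \<sigma> (\<Phi> 0)"
  defines "K \<equiv> 16 * H * M 0 - M1\<^sup>2"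
  shows "\<exists>m. (\<forall>t\<in>I. has_max (\<lambda>x. cmod (\<Phi> t x)) (m t))
    \<and> (k > 0 \<longrightarrow> {0..} \<subseteq> I
        \<and> m \<sim>[at_top]
          (\<lambda>t. Ap * (M 0 / (4 * H)) powr (real DIM('a) / 4)
                * t powr (- real DIM('a) / 2)))
    \<and> (k \<le> 0 \<longrightarrow>
        (\<not> (H = 0 \<and> M1 = 0) \<longrightarrow> (\<exists>T. blows_up_at I \<Phi> x0 T))
        \<and> (H = 0 \<and> M1 < 0 \<longrightarrow>
            (let T = - M 0 / M1 in T > 0 \<and> blows_up_at I \<Phi> x0 T))
        \<and> (H > 0 \<and> M1 < 0 \<longrightarrow>
            (let T = (- M1 - sqrt \<bar>K\<bar>) / (8 * H)
             in T > 0 \<and> blows_up_at I \<Phi> x0 T))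
        \<and> (H < 0 \<longrightarrow>
            (let T = (- M1 - sqrt \<bar>K\<bar>) / (8 * H)
             in T > 0 \<and> blows_up_at I \<Phi> x0 T)))
    \<and> (\<forall>T. blows_up_at I \<Phi> x0 T \<longrightarrow>
        (k = 0 \<longrightarrow> (\<forall>t\<in>I.
            m t = Ap * (M 0 / (4 * H)) powr (real DIM('a) / 4)
                  * \<bar>T - t\<bar> powr (- real DIM('a) / 2)))
        \<and> (k < 0 \<longrightarrow>
            m \<sim>[at T within I]
              (\<lambda>t. Ap * (M 0 / sqrt \<bar>K\<bar>) powr (real DIM('a) / 4)
                    * \<bar>T - t\<bar> powr (- real DIM('a) / 4))))"
proof -
  let ?q = "spread k (a 0)"
  let ?n = "real DIM('a)"
  define m where "m t = Ap * ?q t powr (- (?n / 4))" for t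
  have a: "a_solution k I a" using max by (simp add: maximal_a_solution_def)
  have 0: "0 \<in> I" by (rule a_solutionD(3)[OF a])
  have M0: "M 0 = Q" unfolding M_def \<Phi>_def using moment_integral(2)[OF a 0] by simp
  have M1: "M1 = 2 * Q * a 0" unfolding M1_def M_def \<Phi>_def using deriv_moment[OF a 0] by simp
  have H: "H = Q * ((a 0)\<^sup>2 + 4 * k) / 4" unfolding H_def \<Phi>_def by (rule energy_\<Psi>[OF a 0])
  have ratio: "M 0 / (4 * H) = 1 / ((a 0)\<^sup>2 + 4 * k)" unfolding M0 H using Q_pos by simp
  have dom: "I = spread_domain k (a 0)" by (rule maximal_a_solution_domain[OF max])
  have 1: "\<forall>t\<in>I. has_max (\<lambda>x. cmod (\<Phi> t x)) (m t)"
    unfolding m_def \<Phi>_def using \<Psi>_has_max[OF a _ Ap] by blast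
  have 2: "{0..} \<subseteq> I \<and> m \<sim>[at_top] (\<lambda>t. Ap * (M 0 / (4 * H)) powr (?n / 4) * t powr (- ?n / 2))" if k: "0 < k"
  proof
    show "{0..} \<subseteq> I" unfolding dom spread_domain_pos[OF k] by simp
    show "m \<sim>[at_top] (\<lambda>t. Ap * (M 0 / (4 * H)) powr (?n / 4) * t powr (- ?n / 2))"
      unfolding m_def[abs_def] ratio mult.assoc[of Ap]
      by (intro asymp_equiv_mult asymp_equiv_refl spread_powr_asymp_equiv k)
  qed
  have bu: "blows_up_at I \<Phi> x0 (- 1 / a 0)" if k: "k = 0" and \<alpha>: "a 0 \<noteq> 0"
    unfolding \<Phi>_def using dom spread_domain_zero[of "a 0"] k
    by (intro blows_up_at_zero_of_spread[OF a k \<alpha>]) simp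
  have K: "K = 16 * k * Q\<^sup>2"
    unfolding K_def M0 M1 H by (simp add: algebra_simps power2_eq_square)
  have 3: "(\<not> (H = 0 \<and> M1 = 0) \<longrightarrow> (\<exists>T. blows_up_at I \<Phi> x0 T))
        \<and> (H = 0 \<and> M1 < 0 \<longrightarrow> (let T = - M 0 / M1 in T > 0 \<and> blows_up_at I \<Phi> x0 T))
        \<and> (H > 0 \<and> M1 < 0 \<longrightarrow>
            (let T = (- M1 - sqrt \<bar>K\<bar>) / (8 * H) in T > 0 \<and> blows_up_at I \<Phi> x0 T))
        \<and> (H < 0 \<longrightarrow>
            (let T = (- M1 - sqrt \<bar>K\<bar>) / (8 * H) in T > 0 \<and> blows_up_at I \<Phi> x0 T))" if "k \<le> 0"
  proof -
    have k: "k = 0" using that k_nonneg by simp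
    have H0: "H = Q * (a 0)\<^sup>2 / 4" by (simp add: H k)
    have K0: "K = 0" by (simp add: K k)
    have "\<not> H < 0" using Q_pos by (simp add: H0 not_less)
    moreover have "\<not> (H = 0 \<and> M1 < 0)" using Q_pos by (auto simp: H0 M1)
    moreover have "a 0 \<noteq> 0" if "\<not> (H = 0 \<and> M1 = 0)" using that by (auto simp: H0 M1)
    moreover have "(- M1 - sqrt \<bar>K\<bar>) / (8 * H) = - 1 / a 0 \<and> 0 < - 1 / a 0" if "M1 < 0"
    proof -
      have "a 0 < 0" using that Q_pos by (simp add: M1 mult_less_0_iff)
      then show ?thesis using Q_pos by (simp add: M1 H0 K0 field_simps power2_eq_square)
    qed
    moreover have "a 0 \<noteq> 0" if "M1 < 0" using that by (auto simp: M1)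
    ultimately show ?thesis using bu[OF k] by (auto simp: Let_def)
  qed
  \<comment> \<open>All that is used of \<open>T\<close> is that it lies on the frontier of
    \<open>I\<close>: the half-line has the single endpoint \<open>- 1 / a 0\<close>, and for
    \<open>a 0 = 0\<close> there is none.\<close>
  have 4: "m t = Ap * (M 0 / (4 * H)) powr (?n / 4) * \<bar>T - t\<bar> powr (- ?n / 2)"
    if T: "blows_up_at I \<Phi> x0 T" and k: "k = 0" and t: "t \<in> I" for T t
  proof -
    have I: "I = {t. 0 < 1 + a 0 * t}" using dom spread_domain_zero[of "a 0"] k by simp
    have fr: "T \<in> frontier I" using T by (simp add: blows_up_at_def)
    have \<alpha>: "a 0 \<noteq> 0"
    proof
      assume "a 0 = 0"
      then have "I = UNIV" using I by simp
      then show False using fr by simp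
    qed
    have "T \<notin> I" using fr a_solutionD(1)[OF a] by (simp add: frontier_def interior_open)
    then have "1 + a 0 * T \<le> 0" using I by simp
    moreover have "closure I \<subseteq> {t. 0 \<le> 1 + a 0 * t}"
      by (rule closure_minimal) (auto simp: I intro!: closed_Collect_le continuous_intros)
    then have "0 \<le> 1 + a 0 * T" using fr by (auto simp: frontier_def)
    ultimately have "a 0 * T = - 1" by linarith
    then have T: "T = - 1 / a 0" using \<alpha> by (simp add: field_simps)
    have "0 < 1 + a 0 * t" using t I by simp
    from spread_powr_critical[OF \<alpha> this, of ?n] show ?thesis
      unfolding m_def ratio T by (simp add: k)
  qed
  show ?thesis using 1 2 3 4 k_nonneg by (intro exI[of _ m]) auto
qed

end

text \<open>A zero profile has \<open>M t = 0\<close>, which is why the claims that divide by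
  \<open>M\<close> ask for a nonzero value of \<open>A0\<close>. Maximality of \<open>I\<close> is
  asked for only where the end of the existence interval matters.\<close>

theorem theorem1:
  fixes A0 :: "real^'n \<Rightarrow> real" and \<sigma> k \<gamma>0 \<theta> :: real and x0 :: "real^'n"
  assumes "\<sigma> = 4 / real CARD('n)"
    and "C2 A0"
    and "\<And>x. A0 x \<ge> 0"
    and "\<And>x. laplacian A0 x + A0 x powr (\<sigma> + 1) = (k * (norm x)\<^sup>2 + \<gamma>0) * A0 x"
  shows "(\<forall>\<alpha>. \<exists>I a. maximal_a_solution k I a \<and> a 0 = \<alpha>)
    \<and> (\<forall>I a. a_solution k I a \<longrightarrow> nls_solution \<sigma> I (special_wave A0 \<gamma>0 x0 \<theta> a))
    \<and> (in_H1 A0 \<and> in_L2 (\<lambda>x. A0 x *\<^sub>R x) \<and> (\<exists>x. A0 x \<noteq> 0) \<longrightarrow>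
        (\<exists>Ap. has_max A0 Ap \<and>
          (\<forall>I a. a_solution k I a \<longrightarrow>
            (let \<Psi> = special_wave A0 \<gamma>0 x0 \<theta> a;
                 M = (\<lambda>t. second_moment x0 (\<Psi> t));
                 M1 = deriv M 0;
                 H = energy \<sigma> (\<Psi> 0);
                 K = 16 * H * M 0 - M1\<^sup>2
             in (\<forall>t\<in>I. in_H1 (\<Psi> t)
                     \<and> in_L2 (\<lambda>x. norm (x - x0) *\<^sub>R \<Psi> t x)
                     \<and> integrable lborel (\<lambda>x. cmod (\<Psi> t x) powr (\<sigma> + 2)))
              \<and> (\<forall>t\<in>I. energy \<sigma> (\<Psi> t) = H)
              \<and> (\<forall>t\<in>I. M t > 0 \<and> M t = 4 * H * t\<^sup>2 + M1 * t + M 0)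
              \<and> (\<forall>t\<in>I. \<forall>x. \<Psi> t x = special_wave_M A0 \<gamma>0 x0 \<theta> M t x)
              \<and> k = K / (16 * (M 0)\<^sup>2)
              \<and> (maximal_a_solution k I a \<longrightarrow>
                  (\<exists>m. (\<forall>t\<in>I. has_max (\<lambda>x. cmod (\<Psi> t x)) (m t))
                    \<and> (k > 0 \<longrightarrow> {0..} \<subseteq> I
                        \<and> m \<sim>[at_top]
                          (\<lambda>t. Ap * (M 0 / (4 * H)) powr (real CARD('n) / 4)
                                * t powr (- real CARD('n) / 2)))
                    \<and> (k \<le> 0 \<longrightarrow>
                        (\<not> (H = 0 \<and> M1 = 0) \<longrightarrow> (\<exists>T. blows_up_at I \<Psi> x0 T))
                        \<and> (H = 0 \<and> M1 < 0 \<longrightarrow>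
                            (let T = - M 0 / M1 in T > 0 \<and> blows_up_at I \<Psi> x0 T))
                        \<and> (H > 0 \<and> M1 < 0 \<longrightarrow>
                            (let T = (- M1 - sqrt \<bar>K\<bar>) / (8 * H)
                             in T > 0 \<and> blows_up_at I \<Psi> x0 T))
                        \<and> (H < 0 \<longrightarrow>
                            (let T = (- M1 - sqrt \<bar>K\<bar>) / (8 * H)
                             in T > 0 \<and> blows_up_at I \<Psi> x0 T)))
                    \<and> (\<forall>T. blows_up_at I \<Psi> x0 T \<longrightarrow>
                        (k = 0 \<longrightarrow> (\<forall>t\<in>I.
                            m t = Ap * (M 0 / (4 * H)) powr (real CARD('n) / 4)
                                  * \<bar>T - t\<bar> powr (- real CARD('n) / 2)))
                        \<and> (k < 0 \<longrightarrow>
                            m \<sim>[at T within I]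
                              (\<lambda>t. Ap * (M 0 / sqrt \<bar>K\<bar>) powr (real CARD('n) / 4)
                                    * \<bar>T - t\<bar> powr (- real CARD('n) / 4))))))))))"
proof (intro conjI allI impI)
  show "\<exists>I a. maximal_a_solution k I a \<and> a 0 = \<alpha>" for \<alpha> by (rule maximal_a_solution_exists)
  have \<sigma>: "\<sigma> = 4 / real DIM(real^'n)" using assms(1) by simp
  show "nls_solution \<sigma> I (special_wave A0 \<gamma>0 x0 \<theta> a)" if "a_solution k I a" for I a
    unfolding special_wave_eq_wave wave_def[abs_def]
    by (rule chirped_nls_solution[OF assms(2,3) \<sigma> assms(4) that])
  assume "in_H1 A0 \<and> in_L2 (\<lambda>x. A0 x *\<^sub>R x) \<and> (\<exists>x. A0 x \<noteq> 0)"
  then interpret profile A0 \<sigma> k \<gamma>0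
    using assms \<sigma> by unfold_locales auto
  obtain Ap where Ap: "has_max A0 Ap" using has_max_ex by blast
  have n: "real DIM(real^'n) = real CARD('n)" by simp
  show "(\<exists>Ap. has_max A0 Ap \<and>
          (\<forall>I a. a_solution k I a \<longrightarrow>
            (let \<Psi> = special_wave A0 \<gamma>0 x0 \<theta> a;
                 M = (\<lambda>t. second_moment x0 (\<Psi> t));
                 M1 = deriv M 0;
                 H = energy \<sigma> (\<Psi> 0);
                 K = 16 * H * M 0 - M1\<^sup>2
             in (\<forall>t\<in>I. in_H1 (\<Psi> t)
                     \<and> in_L2 (\<lambda>x. norm (x - x0) *\<^sub>R \<Psi> t x)
                     \<and> integrable lborel (\<lambda>x. cmod (\<Psi> t x) powr (\<sigma> + 2)))
              \<and> (\<forall>t\<in>I. energy \<sigma> (\<Psi> t) = H)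
              \<and> (\<forall>t\<in>I. M t > 0 \<and> M t = 4 * H * t\<^sup>2 + M1 * t + M 0)
              \<and> (\<forall>t\<in>I. \<forall>x. \<Psi> t x = special_wave_M A0 \<gamma>0 x0 \<theta> M t x)
              \<and> k = K / (16 * (M 0)\<^sup>2)
              \<and> (maximal_a_solution k I a \<longrightarrow>
                  (\<exists>m. (\<forall>t\<in>I. has_max (\<lambda>x. cmod (\<Psi> t x)) (m t))
                    \<and> (k > 0 \<longrightarrow> {0..} \<subseteq> I
                        \<and> m \<sim>[at_top]
                          (\<lambda>t. Ap * (M 0 / (4 * H)) powr (real CARD('n) / 4)
                                * t powr (- real CARD('n) / 2)))
                    \<and> (k \<le> 0 \<longrightarrow>
                        (\<not> (H = 0 \<and> M1 = 0) \<longrightarrow> (\<exists>T. blows_up_at I \<Psi> x0 T))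
                        \<and> (H = 0 \<and> M1 < 0 \<longrightarrow>
                            (let T = - M 0 / M1 in T > 0 \<and> blows_up_at I \<Psi> x0 T))
                        \<and> (H > 0 \<and> M1 < 0 \<longrightarrow>
                            (let T = (- M1 - sqrt \<bar>K\<bar>) / (8 * H)
                             in T > 0 \<and> blows_up_at I \<Psi> x0 T))
                        \<and> (H < 0 \<longrightarrow>
                            (let T = (- M1 - sqrt \<bar>K\<bar>) / (8 * H)
                             in T > 0 \<and> blows_up_at I \<Psi> x0 T)))
                    \<and> (\<forall>T. blows_up_at I \<Psi> x0 T \<longrightarrow>
                        (k = 0 \<longrightarrow> (\<forall>t\<in>I.
                            m t = Ap * (M 0 / (4 * H)) powr (real CARD('n) / 4)
                                  * \<bar>T - t\<bar> powr (- real CARD('n) / 2)))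
                        \<and> (k < 0 \<longrightarrow>
                            m \<sim>[at T within I]
                              (\<lambda>t. Ap * (M 0 / sqrt \<bar>K\<bar>) powr (real CARD('n) / 4)
                                    * \<bar>T - t\<bar> powr (- real CARD('n) / 4)))))))))"
  proof (intro exI[of _ Ap] conjI Ap allI impI, unfold Let_def, intro conjI ballI impI allI, unfold special_wave_eq_wave)
    fix I a assume a: "a_solution k I a"
    note 0 = a_solutionD(3)[OF a]
    show "in_H1 (wave A0 \<gamma>0 \<theta> a x0 t)" for t by (rule \<Psi>_in_H1[OF a])
    show "in_L2 (\<lambda>x. norm (x - x0) *\<^sub>R wave A0 \<gamma>0 \<theta> a x0 t x)" for t
      by (rule \<Psi>_moment_in_L2[OF a])
    show "integrable lborel (\<lambda>x. cmod (wave A0 \<gamma>0 \<theta> a x0 t x) powr (\<sigma> + 2))" for t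
      by (rule powr_integral(1)[OF a])
    show "energy \<sigma> (wave A0 \<gamma>0 \<theta> a x0 t) = energy \<sigma> (wave A0 \<gamma>0 \<theta> a x0 0)" if "t \<in> I" for t
      unfolding energy_\<Psi>[OF a that] energy_\<Psi>[OF a 0] ..
    show "0 < second_moment x0 (wave A0 \<gamma>0 \<theta> a x0 t)" if "t \<in> I" for t
      using moment_integral(2)[OF a that] Q_pos q_pos[OF a that] by simp
    show "second_moment x0 (wave A0 \<gamma>0 \<theta> a x0 t) = 4 * energy \<sigma> (wave A0 \<gamma>0 \<theta> a x0 0) * t\<^sup>2
      + deriv (\<lambda>t. second_moment x0 (wave A0 \<gamma>0 \<theta> a x0 t)) 0 * t
      + second_moment x0 (wave A0 \<gamma>0 \<theta> a x0 0)" if "t \<in> I" for t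
      unfolding moment_integral(2)[OF a that] moment_integral(2)[OF a 0] deriv_moment[OF a 0] energy_\<Psi>[OF a 0]
      by (simp add: spread_def algebra_simps power2_eq_square)
    show "wave A0 \<gamma>0 \<theta> a x0 t x = special_wave_M A0 \<gamma>0 x0 \<theta> (\<lambda>t. second_moment x0 (wave A0 \<gamma>0 \<theta> a x0 t)) t x"
      if "t \<in> I" for t x
      unfolding special_wave_M_def using wave_eq_wave_M[OF a that] by (simp only: n)
    show "k = (16 * energy \<sigma> (wave A0 \<gamma>0 \<theta> a x0 0) * second_moment x0 (wave A0 \<gamma>0 \<theta> a x0 0)
      - (deriv (\<lambda>t. second_moment x0 (wave A0 \<gamma>0 \<theta> a x0 t)) 0)\<^sup>2)
      / (16 * (second_moment x0 (wave A0 \<gamma>0 \<theta> a x0 0))\<^sup>2)"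
      unfolding moment_integral(2)[OF a 0] deriv_moment[OF a 0] energy_\<Psi>[OF a 0]
      using Q_pos by (simp add: field_simps power2_eq_square)
  qed (rule maximal_wave[OF _ Ap, where ?x0.0=x0 and \<theta>=\<theta>, unfolded n Let_def])
qed

end
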